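(* Assume that $\mathbf{E}\,\xi=0$, $\mathbf{E}\,\xi^2=1$, that $V(t)=t^{-\alpha}L(t)$ with $\alpha>2$ and $L$ slowly varying at infinity, and that $M_n\gg s_n$ as $n\to\infty$. Let $c>1$ and let $\{d_n\}_{n\ge1}$ be any sequence such that $M_n-cs_n>d_n\gg n^{1/2}$ as $n\to\infty$. Then $$\mathbf{P}(Y_n>x)\sim nV(x)\quad\text{as } n\to\infty,\ \text{uniformly in } x\in(cs_n,\,M_n-d_n).$$ Moreover, if in addition $\mathbf{E}(\xi^2;|\xi|>t)=o(1/\ln t)$ as $t\to\infty$, then also $$\mathbf{P}(Y_n>x)\sim H_n(x)\quad\text{as } n\to\infty,\ \text{uniformly in } x\in(0,\,M_n-d_n).$$
   Context: Let $\xi,\xi_1,\xi_2,\ldots$ be independent identically distributed real random variables, with right distribution tail $V(t):=\mathbf{P}(\xi>t)$. A function $L$ is slowly varying at infinity if for any $y>0$ one has $L(ty)/L(t)\to1$ as $t\to\infty$. Put $s_n:=((\alpha-2)n\ln n)^{1/2}$, $n\ge1$. Let $\{M_n\}_{n\ge 1}$ be a (deterministic) threshold sequence, and define the sums of censored variables $$Y_n:=\sum_{j=1}^n(\xi_j\wedge M_n),\quad n\ge1,$$ where $a\wedge b=\min(a,b)$. Let $\overline{\Phi}:=1-\Phi$, where $\Phi$ is the standard normal distribution function, and $$H_n(z):=\overline{\Phi}(zn^{-1/2})+nV(z)\mathbf{1}_{\{z>n^{1/2}\}},\quad z\in\mathbb{R}.$$ Notation: $\mathbf{E}(X;A):=\mathbf{E}(X\mathbf{1}_A)$;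 $a_n\gg b_n$ means $b_n/a_n\to0$ (so $M_n\gg s_n$ means $s_n/M_n\to 0$ with $M_n>0$ for large $n$); $f\sim g$ means $f/g\to1$; "$f_n(x)\sim g_n(x)$ uniformly in $x\in I_n$" means $\sup_{x\in I_n}|f_n(x)/g_n(x)-1|\to0$ as $n\to\infty$. *)

theory Defs
  imports "HOL-Probability.Probability"
begin

definition slowly_varying :: "(real \<Rightarrow> real) \<Rightarrow> bool" where
  "slowly_varying L \<longleftrightarrow> (\<forall>y>0. ((\<lambda>t. L (t * y) / L t) \<longlongrightarrow> 1) at_top)"

definition much_greater :: "(nat \<Rightarrow> real) \<Rightarrow> (nat \<Rightarrow> real) \<Rightarrow> bool" where
  "much_greater a b \<longleftrightarrow> (\<forall>\<^sub>F n in sequentially. a n > 0) \<and> (\<lambda>n. b n / a n) \<longlonglongrightarrow> 0"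

text \<open>
  Asymptotic equivalence \<open>f n x \<sim> g n x\<close>, uniformly in \<open>x \<in> I n\<close>. The supremum is taken in
  \<^typ>\<open>ennreal\<close>, so it is the genuine one even when the ratios are unbounded. Where
  \<open>g n x = 0\<close>, the term equals \<open>1\<close> by the convention \<open>r / 0 = 0\<close>, so such points
  never count as equivalent.
\<close>
definition uniformly_asymp ::
  "(nat \<Rightarrow> real set) \<Rightarrow> (nat \<Rightarrow> real \<Rightarrow> real) \<Rightarrow> (nat \<Rightarrow> real \<Rightarrow> real) \<Rightarrow> bool" where
  "uniformly_asymp I f g \<longleftrightarrow>
     (\<lambda>n. SUP x\<in>I n. ennreal \<bar>f n x / g n x - 1\<bar>) \<longlonglongrightarrow> 0"

definition right_tail :: "'a measure \<Rightarrow> ('a \<Rightarrow> real) \<Rightarrow> real \<Rightarrow> real" where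
  "right_tail P \<xi> t = \<P>(\<omega> in P. \<xi> \<omega> > t)"

definition s_seq :: "real \<Rightarrow> nat \<Rightarrow> real" where
  "s_seq \<alpha> n = sqrt ((\<alpha> - 2) * real n * ln (real n))"

definition censored_sum :: "(nat \<Rightarrow> 'a \<Rightarrow> real) \<Rightarrow> (nat \<Rightarrow> real) \<Rightarrow> nat \<Rightarrow> 'a \<Rightarrow> real" where
  "censored_sum X M n \<omega> = (\<Sum>j=1..n. min (X j \<omega>) (M n))"

definition std_normal_tail :: "real \<Rightarrow> real" where
  "std_normal_tail z = 1 - cdf std_normal_distribution z"

definition H_fun :: "(real \<Rightarrow> real) \<Rightarrow> nat \<Rightarrow> real \<Rightarrow> real" where
  "H_fun V n z =
     std_normal_tail (z / sqrt (real n)) + real n * V z * indicator {sqrt (real n)<..} z"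

end

theory Submission
  imports Defs "HOL-Real_Asymp.Real_Asymp"
begin

text \<open>
  Two mechanisms make the censored sum exceed \<open>x\<close>: a single summand beyond \<open>x\<close>, with
  probability about \<open>n V x\<close>, or the joint effect of moderate summands, with the Gaussian
  probability of exceeding \<open>x / sqrt n\<close>. They balance near \<open>s_seq \<alpha> n\<close>, because
  \<open>exp (- x\<^sup>2 / (2 n))\<close> and \<open>n V x\<close> both are \<open>n\<close> to the power \<open>1 - \<alpha> / 2\<close>
  there, up to slowly varying factors. Censoring does not interfere as long as \<open>x\<close> stays
  below the censoring level by much more than \<open>sqrt n\<close>: the big summand needs to exceed
  \<open>x\<close> only by a large multiple of \<open>sqrt n\<close> (the size of the remaining sum), and is then
  still uncensored.

  Beyond \<open>c s_seq \<alpha> n\<close> with \<open>c > 1\<close> the jump wins. The lower bound is an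
  inclusion-exclusion over the index of the jump (\<open>prob_jump_event\<close>,
  \<open>jump_event_lower\<close>). For the upper bound, if the largest summand is between \<open>x / 2\<close>
  and \<open>(1 - e) x\<close>, the others have to contribute \<open>e x\<close>, which by Chebyshev costs a
  factor tending to 0 (\<open>prob_with_jump_le\<close>); if all summands are at most \<open>x / 2\<close>, an
  exponential moment bound of Fuk-Nagaev type applies (\<open>fuk_nagaev\<close>). Regular
  variation enters through the Potter bounds \<open>potter_lower\<close> and \<open>potter_upper\<close>.

  Up to \<open>c s_seq \<alpha> n\<close> the sum is compared with the sum \<open>T\<close> of the variables censored
  at the much lower level \<open>sqrt (n / ln n)\<close>. That the tail of \<open>T\<close> is Gaussian up to a
  relative error tending to 0 (\<open>normal_approximation\<close>) is proved by a multiplicative form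
  of Lindeberg's replacement method. The indicator of the half-line is smoothed to a logistic
  function \<open>f\<close> of width \<open>w\<close>, a small multiple of \<open>sqrt (n / ln n)\<close>. All derivatives
  of \<open>f\<close> are bounded by \<open>f\<close> itself, so replacing one censored summand by a standard
  normal variable changes the mean of \<open>f\<close> by a factor \<open>1 + \<Delta>\<close>, uniformly in the
  starting point. Factors of this kind multiply along convolution powers
  (\<open>convolution_power_compare\<close>), and \<open>n \<Delta>\<close> tends to 0 precisely because the truncated
  second moment is \<open>o(1 / ln t)\<close>. On the scale \<open>w\<close> the Gaussian tail is nearly constant
  in relative terms, so the smoothing can be undone (\<open>normal_tail_sandwich\<close>).

  The two descriptions are joined on \<open>[s_seq \<alpha> n / 2, c s_seq \<alpha> n]\<close>, where a jump and
  an exceedance by \<open>T\<close> are asymptotically disjoint events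
  (\<open>moderate_deviation_asymp\<close>). Below \<open>s_seq \<alpha> n / 2\<close> even the probability that any
  summand exceeds \<open>sqrt (n / ln n)\<close> is negligible against the Gaussian tail
  (\<open>nV_level_negligible\<close>).
\<close>

section \<open>Regular variation\<close>

text \<open>
  A monotone tail that vanished somewhere would vanish from there on, so that the ratio would be
  eventually 0 by the convention \<open>r / 0 = 0\<close>.
\<close>
lemma regvar_pos:
  fixes V :: "real \<Rightarrow> real"
  assumes anti: "\<And>s t. s \<le> t \<Longrightarrow> V t \<le> V s"
    and nonneg: "\<And>t. 0 \<le> V t"
    and lim: "((\<lambda>t. V (t * y) / V t) \<longlongrightarrow> r) at_top" and r: "r \<noteq> 0"
  shows "0 < V t"
proof (rule ccontr)
  assume "\<not> 0 < V t"
  then have "V s = 0" if "t \<le> s" for s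
    using anti[OF that] nonneg[of s] by linarith
  then have "\<forall>\<^sub>F s in at_top. V (s * y) / V s = 0"
    by (intro eventually_at_top_linorderI[of t]) auto
  then have "((\<lambda>s. V (s * y) / V s) \<longlongrightarrow> 0) at_top"
    by (simp add: tendsto_eventually)
  with lim r show False
    using tendsto_unique[OF _ lim] by simp
qed

text \<open>
  Iterating the doubling inequality along \<open>t, 2 t, 4 t, \<dots>\<close> gives powers of 2, and monotonicity
  fills the gaps between them at the price of the factor 2 in front of \<open>s\<close>.
\<close>
lemma potter_lower:
  fixes V :: "real \<Rightarrow> real"
  assumes anti: "\<And>s t. s \<le> t \<Longrightarrow> V t \<le> V s"
    and nonneg: "\<And>t. 0 \<le> V t"
    and lim: "((\<lambda>t. V (t * 2) / V t) \<longlongrightarrow> 2 powr (-\<alpha>)) at_top"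
    and \<beta>: "\<alpha> < \<beta>" "0 < \<beta>"
  shows "\<exists>x0>0. \<forall>t\<ge>x0. \<forall>s\<ge>1. V t \<le> (2 * s) powr \<beta> * V (t * s)"
proof -
  have pos: "0 < V t" for t
    by (rule regvar_pos[OF anti nonneg lim]) auto
  have "2 powr (-\<beta>) < (2::real) powr (-\<alpha>)"
    using \<beta> by simp
  from order_tendstoD(1)[OF lim this]
  obtain x1 where x1: "\<And>t. t \<ge> x1 \<Longrightarrow> 2 powr (-\<beta>) < V (t * 2) / V t"
    unfolding eventually_at_top_linorder by blast
  have step: "V t \<le> 2 powr \<beta> * V (t * 2)" if "t \<ge> x1" for t
  proof -
    have "2 powr (-\<beta>) * V t \<le> V (t * 2)"
      using x1[OF that] pos[of t] by (simp add: field_simps)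
    then have "2 powr \<beta> * (2 powr (-\<beta>) * V t) \<le> 2 powr \<beta> * V (t * 2)"
      by (intro mult_left_mono) auto
    then show ?thesis
      by (simp add: mult.assoc[symmetric] powr_add[symmetric])
  qed
  define x0 where "x0 = max 1 x1"
  have iter: "V t \<le> (2 ^ k) powr \<beta> * V (t * 2 ^ k)" if "t \<ge> x0" for t k
  proof (induction k)
    case (Suc k)
    have "t * 1 \<le> t * 2 ^ k" using that by (intro mult_left_mono) (auto simp: x0_def)
    then have "x1 \<le> t * 2 ^ k" using that unfolding x0_def by linarith
    from step[OF this] have "V (t * 2 ^ k) \<le> 2 powr \<beta> * V (t * 2 ^ Suc k)"
      by (simp add: mult_ac)
    then have "(2 ^ k) powr \<beta> * V (t * 2 ^ k) \<le> (2 ^ k) powr \<beta> * (2 powr \<beta> * V (t * 2 ^ Suc k))"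
      by (intro mult_left_mono) auto
    also have "\<dots> = (2 ^ Suc k) powr \<beta> * V (t * 2 ^ Suc k)"
      by (simp add: powr_mult)
    finally show ?case using Suc by linarith
  qed simp
  have "V t \<le> (2 * s) powr \<beta> * V (t * s)" if "t \<ge> x0" "s \<ge> 1" for t s
  proof -
    define k where "k = nat \<lceil>log 2 s\<rceil>"
    have l: "0 \<le> log 2 s" using that by simp
    have k1: "log 2 s \<le> k" "k < log 2 s + 1" unfolding k_def using l by linarith+
    have "s = 2 powr (log 2 s)" using that by simp
    also have "\<dots> \<le> 2 powr k" using k1 by simp
    finally have s1: "s \<le> 2 ^ k" by (simp add: powr_realpow)
    have "2 ^ k = 2 powr real k" by (simp add: powr_realpow)
    also have "\<dots> \<le> 2 powr (log 2 s + 1)" using k1 by simp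
    also have "\<dots> = 2 * s" using that by (simp add: powr_add)
    finally have s2: "2 ^ k \<le> 2 * s" .
    have "V t \<le> (2 ^ k) powr \<beta> * V (t * 2 ^ k)" by (rule iter[OF that(1)])
    also have "\<dots> \<le> (2 * s) powr \<beta> * V (t * s)"
      using s1 s2 that \<beta> nonneg
      by (intro mult_mono powr_mono2 anti mult_left_mono) (auto simp: x0_def)
    finally show ?thesis .
  qed
  then show ?thesis by (intro exI[of _ x0]) (auto simp: x0_def)
qed

text \<open>
  The counterpart of \<open>potter_lower\<close>, with the scaling factor rounded down to a power of 2.
\<close>
lemma potter_upper:
  fixes V :: "real \<Rightarrow> real"
  assumes anti: "\<And>s t. s \<le> t \<Longrightarrow> V t \<le> V s"
    and nonneg: "\<And>t. 0 \<le> V t"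
    and lim: "((\<lambda>t. V (t * 2) / V t) \<longlongrightarrow> 2 powr (-\<alpha>)) at_top"
    and \<beta>: "\<beta> < \<alpha>" "0 < \<beta>"
  shows "\<exists>x0>0. \<forall>t\<ge>x0. \<forall>s\<ge>1. V (t * s) \<le> (2 / s) powr \<beta> * V t"
proof -
  have pos: "0 < V t" for t
    by (rule regvar_pos[OF anti nonneg lim]) auto
  have "2 powr (-\<beta>) > (2::real) powr (-\<alpha>)"
    using \<beta> by simp
  from order_tendstoD(2)[OF lim this]
  obtain x1 where x1: "\<And>t. t \<ge> x1 \<Longrightarrow> 2 powr (-\<beta>) > V (t * 2) / V t"
    unfolding eventually_at_top_linorder by blast
  have step: "V (t * 2) \<le> 2 powr (-\<beta>) * V t" if "t \<ge> x1" for t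
    using x1[OF that] pos[of t] by (simp add: field_simps)
  define x0 where "x0 = max 1 x1"
  have iter: "V (t * 2 ^ k) \<le> (2 ^ k) powr (-\<beta>) * V t" if "t \<ge> x0" for t k
  proof (induction k)
    case (Suc k)
    have "t * 1 \<le> t * 2 ^ k" using that by (intro mult_left_mono) (auto simp: x0_def)
    then have "x1 \<le> t * 2 ^ k" using that unfolding x0_def by linarith
    from step[OF this] have "V (t * 2 ^ Suc k) \<le> 2 powr (-\<beta>) * V (t * 2 ^ k)"
      by (simp add: mult_ac)
    also have "\<dots> \<le> 2 powr (-\<beta>) * ((2 ^ k) powr (-\<beta>) * V t)"
      using Suc by (intro mult_left_mono) auto
    also have "\<dots> = (2 ^ Suc k) powr (-\<beta>) * V t"
      by (simp add: powr_mult)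
    finally show ?case .
  qed simp
  have "V (t * s) \<le> (2 / s) powr \<beta> * V t" if "t \<ge> x0" "s \<ge> 1" for t s
  proof -
    define k where "k = nat \<lfloor>log 2 s\<rfloor>"
    have l: "0 \<le> log 2 s" using that by simp
    have k1: "k \<le> log 2 s" "log 2 s < k + 1" unfolding k_def using l by linarith+
    have "s = 2 powr (log 2 s)" using that by simp
    also have "\<dots> \<le> 2 powr (real k + 1)" using k1 by simp
    also have "\<dots> = 2 * 2 ^ k" by (simp add: powr_add powr_realpow)
    finally have s1: "s \<le> 2 * 2 ^ k" .
    have "2 ^ k = 2 powr real k" by (simp add: powr_realpow)
    also have "\<dots> \<le> 2 powr (log 2 s)" using k1 by simp
    also have "\<dots> = s" using that by simp
    finally have s2: "2 ^ k \<le> s" .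
    have "V (t * s) \<le> V (t * 2 ^ k)"
      using s2 that by (intro anti mult_left_mono) (auto simp: x0_def)
    also have "\<dots> \<le> (2 ^ k) powr (-\<beta>) * V t" by (rule iter[OF that(1)])
    also have "\<dots> \<le> (s / 2) powr (-\<beta>) * V t"
      using s1 that \<beta> nonneg[of t] by (intro mult_right_mono powr_mono2') auto
    also have "(s / 2) powr (-\<beta>) = (2 / s) powr \<beta>"
      using that by (simp add: powr_divide powr_minus_divide)
    finally show ?thesis .
  qed
  then show ?thesis by (intro exI[of _ x0]) (auto simp: x0_def)
qed

section \<open>Censored sums of a standardized sample\<close>

lemma exp_le_quadratic:
  fixes u a :: real
  assumes "u \<le> a" "0 \<le> a"
  shows "exp u \<le> 1 + u + u\<^sup>2 / 2 * exp a"
proof -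
  consider "u = 0" | "u < 0" | "u > 0" by linarith
  then show ?thesis
  proof cases
    case 2
    from Maclaurin_minus[OF this, of 2 "\<lambda>_. exp" exp]
    obtain t where t: "u < t" "t < 0" and e: "exp u = 1 + u + exp t / 2 * u\<^sup>2"
      by (auto simp: numeral_2_eq_2)
    have "exp t \<le> exp a" using t assms by simp
    then have "exp t * u\<^sup>2 \<le> exp a * u\<^sup>2" by (intro mult_right_mono) auto
    then show ?thesis using e by (simp add: mult.commute)
  next
    case 3
    from Maclaurin[OF this, of 2 "\<lambda>_. exp" exp]
    obtain t where t: "0 < t" "t < u" and e: "exp u = 1 + u + exp t / 2 * u\<^sup>2"
      by (auto simp: numeral_2_eq_2)
    have "exp t \<le> exp a" using t assms by simp
    then have "exp t * u\<^sup>2 \<le> exp a * u\<^sup>2" by (intro mult_right_mono) auto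
    then show ?thesis using e by (simp add: mult.commute)
  qed simp
qed

text \<open>
  All computations with a single summand take place under its law \<open>D\<close>; the sample space only
  serves to express independence.
\<close>
locale standardized_sample = prob_space P for P :: "'a measure" +
  fixes X :: "nat \<Rightarrow> 'a \<Rightarrow> real" and D :: "real measure"
  assumes indep: "indep_vars (\<lambda>_. borel) X {1..}"
    and law: "\<And>j. j \<ge> 1 \<Longrightarrow> distr P borel (X j) = D"
    and mean_integrable: "integrable D (\<lambda>v. v)" and mean_zero: "(\<integral>v. v \<partial>D) = 0"
    and square_integrable: "integrable D (\<lambda>v. v\<^sup>2)" and second_moment: "(\<integral>v. v\<^sup>2 \<partial>D) = 1"
begin

definition V :: "real \<Rightarrow> real" where
  "V t = measure D {t<..}"

definition csum :: "nat set \<Rightarrow> real \<Rightarrow> 'a \<Rightarrow> real" where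
  "csum I m \<omega> = (\<Sum>i\<in>I. min (X i \<omega>) m)"

abbreviation exceeds :: "nat set \<Rightarrow> real \<Rightarrow> real \<Rightarrow> 'a set" where
  "exceeds I m x \<equiv> {\<omega> \<in> space P. csum I m \<omega> > x}"

lemma measurable_X [measurable]: "j \<ge> 1 \<Longrightarrow> X j \<in> borel_measurable P"
  using indep unfolding indep_vars_def by auto

lemma sets_D [simp, measurable_cong]: "sets D = sets borel"
  using law[of 1] by (metis order_refl sets_distr)

lemma space_D [simp]: "space D = UNIV"
  using sets_eq_imp_space_eq[OF sets_D] by simp

sublocale D: prob_space D
  using prob_space_distr[of "X 1" borel] law[of 1] by auto

lemma D_UNIV [simp]: "measure D UNIV = 1"
  using D.prob_space by simp

lemma indicator_D: "(\<integral>v. indicator {t<..} v \<partial>D) = V t" "integrable D (\<lambda>v. indicator {t<..} v :: real)"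
  by (simp_all add: V_def D.emeasure_eq_measure)

lemma measurable_csum [measurable]: "I \<subseteq> {1..} \<Longrightarrow> csum I m \<in> borel_measurable P"
  unfolding csum_def by measurable (auto intro!: measurable_X)

lemma expectation_X:
  fixes g :: "real \<Rightarrow> real"
  assumes "j \<ge> 1" and [measurable]: "g \<in> borel_measurable borel"
  shows "(\<integral>\<omega>. g (X j \<omega>) \<partial>P) = (\<integral>v. g v \<partial>D)"
  unfolding law[OF assms(1), symmetric] using assms by (subst integral_distr) auto

lemma integrable_X:
  fixes g :: "real \<Rightarrow> real"
  assumes "j \<ge> 1" and [measurable]: "g \<in> borel_measurable borel" and "integrable D g"
  shows "integrable P (\<lambda>\<omega>. g (X j \<omega>))"
  using assms(3) unfolding law[OF assms(1), symmetric] using assms(1)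
  by (subst (asm) integrable_distr_eq) auto

lemma prob_X_gt: "j \<ge> 1 \<Longrightarrow> prob {\<omega> \<in> space P. X j \<omega> > t} = V t"
  using law[of j] measure_distr[of "X j" P borel "{t<..}"]
  by (auto simp: V_def vimage_def Int_def conj_commute)

lemma V_nonneg: "0 \<le> V t"
  by (simp add: V_def)

lemma V_antimono: "s \<le> t \<Longrightarrow> V t \<le> V s"
  unfolding V_def by (intro D.finite_measure_mono) auto

lemma V_le_inverse_square:
  assumes "0 < t" shows "V t \<le> 1 / t\<^sup>2"
proof -
  have "(\<integral>v. indicator {t<..} v \<partial>D) \<le> (\<integral>v. v\<^sup>2 / t\<^sup>2 \<partial>D)"
  proof (intro integral_mono indicator_D)
    show "indicator {t<..} v \<le> v\<^sup>2 / t\<^sup>2" for v :: real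
      using assms by (auto simp: indicator_def divide_simps intro!: power_mono)
  qed (use square_integrable in auto)
  then have "V t \<le> (\<integral>v. v\<^sup>2 / t\<^sup>2 \<partial>D)"
    unfolding indicator_D .
  then show ?thesis using second_moment by simp
qed

section \<open>Moments\<close>

lemma integrable_min: "integrable D (\<lambda>v. min v m)"
  using mean_integrable by (intro Bochner_Integration.integrable_min) auto

lemma mean_min_le: "(\<integral>v. min v m \<partial>D) \<le> 0"
  using integral_mono[OF integrable_min mean_integrable, of m] mean_zero by simp

text \<open>
  Censoring lowers the mean by at most \<open>1 / m\<close>, which is harmless for a sum of \<open>n\<close> terms as soon
  as \<open>n / m\<close> is at most of order \<open>sqrt n\<close>.
\<close>
lemma mean_min_ge:
  assumes "0 < m" shows "- 1 / m \<le> (\<integral>v. min v m \<partial>D)"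
proof -
  have "v - v\<^sup>2 / m \<le> min v m" for v
  proof (cases "v \<le> m")
    case False
    then have "v * m \<le> v * v" using assms by (intro mult_left_mono) auto
    then have "v \<le> v\<^sup>2 / m" using assms by (simp add: field_simps power2_eq_square)
    then show ?thesis using False assms by simp
  qed (use assms in auto)
  then have "(\<integral>v. v - v\<^sup>2 / m \<partial>D) \<le> (\<integral>v. min v m \<partial>D)"
    using mean_integrable square_integrable integrable_min by (intro integral_mono) auto
  also have "(\<integral>v. v - v\<^sup>2 / m \<partial>D) = - 1 / m"
    using mean_integrable square_integrable mean_zero second_moment by simp
  finally show ?thesis .
qed

lemma min_square_le:
  fixes v m :: real
  assumes "0 < m" shows "(min v m)\<^sup>2 \<le> v\<^sup>2"
  using assms by (intro abs_le_square_iff[THEN iffD1]) auto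

lemma integrable_min_square:
  assumes "0 < m" shows "integrable D (\<lambda>v. (min v m)\<^sup>2)"
  by (rule Bochner_Integration.integrable_bound[OF square_integrable])
     (auto simp: min_square_le[OF assms])

lemma min_square_le_1:
  assumes "0 < m" shows "(\<integral>v. (min v m)\<^sup>2 \<partial>D) \<le> 1"
  unfolding second_moment[symmetric]
  using integrable_min_square[OF assms] square_integrable
  by (intro integral_mono) (auto simp: min_square_le[OF assms])

lemma indep_vars_subset_compose:
  assumes "I \<subseteq> {1..}" "\<And>i. i \<in> I \<Longrightarrow> g i \<in> borel_measurable borel"
  shows "indep_vars (\<lambda>_. borel) (\<lambda>i \<omega>. g i (X i \<omega>) :: real) I"
  by (rule indep_vars_compose2[OF indep_vars_subset[OF indep assms(1)]]) (use assms in auto)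

lemma indep_var_rest:
  assumes "finite I" "I \<subseteq> {1..}" "j \<ge> 1" "j \<notin> I"
    and [measurable]: "f \<in> borel_measurable borel" "g \<in> borel_measurable borel"
  shows "indep_var borel (\<lambda>\<omega>. f (X j \<omega>) :: real) borel (\<lambda>\<omega>. \<Sum>i\<in>I. g (X i \<omega>) :: real)"
proof -
  have "indep_var borel (\<lambda>\<omega>. (if j = j then f else g) (X j \<omega>)) borel
      (\<lambda>\<omega>. \<Sum>i\<in>I. (if i = j then f else g) (X i \<omega>))"
    by (rule indep_vars_sum[OF assms(1,4)], rule indep_vars_subset_compose) (use assms in auto)
  also have "(\<lambda>\<omega>. \<Sum>i\<in>I. (if i = j then f else g) (X i \<omega>)) = (\<lambda>\<omega>. \<Sum>i\<in>I. g (X i \<omega>))"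
    using assms by (intro ext sum.cong) auto
  finally show ?thesis by simp
qed

lemma prob_indep_rest:
  assumes "finite I" "I \<subseteq> {1..}" "j \<ge> 1" "j \<notin> I" and [measurable]: "A \<in> sets borel" "B \<in> sets borel"
  shows "prob {\<omega> \<in> space P. X j \<omega> \<in> A \<and> csum I m \<omega> \<in> B} =
    prob {\<omega> \<in> space P. X j \<omega> \<in> A} * prob {\<omega> \<in> space P. csum I m \<omega> \<in> B}"
proof -
  have "indep_var borel (\<lambda>\<omega>. X j \<omega>) borel (csum I m)"
    unfolding csum_def by (rule indep_var_rest) (use assms in auto)
  from indep_varD[OF this, of A B]
  have "prob ((\<lambda>\<omega>. (X j \<omega>, csum I m \<omega>)) -` (A \<times> B) \<inter> space P) =
     prob (X j -` A \<inter> space P) * prob (csum I m -` B \<inter> space P)" by simp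
  moreover have "(\<lambda>\<omega>. (X j \<omega>, csum I m \<omega>)) -` (A \<times> B) \<inter> space P = {\<omega> \<in> space P. X j \<omega> \<in> A \<and> csum I m \<omega> \<in> B}"
    "X j -` A \<inter> space P = {\<omega> \<in> space P. X j \<omega> \<in> A}"
    "csum I m -` B \<inter> space P = {\<omega> \<in> space P. csum I m \<omega> \<in> B}" by auto
  ultimately show ?thesis by simp
qed

lemma prob_two_large:
  assumes "i \<ge> 1" "j \<ge> 1" "i \<noteq> j"
  shows "prob {\<omega> \<in> space P. X i \<omega> > u \<and> X j \<omega> > u} = V u * V u"
proof -
  have "indep_var borel (\<lambda>\<omega>. X i \<omega>) borel (\<lambda>\<omega>. \<Sum>i\<in>{j}. X i \<omega>)"
    by (rule indep_var_rest) (use assms in auto)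
  from indep_varD[OF this, of "{u<..}" "{u<..}"]
  have "prob ((\<lambda>\<omega>. (X i \<omega>, X j \<omega>)) -` ({u<..} \<times> {u<..}) \<inter> space P) =
     prob (X i -` {u<..} \<inter> space P) * prob (X j -` {u<..} \<inter> space P)" by simp
  moreover have "(\<lambda>\<omega>. (X i \<omega>, X j \<omega>)) -` ({u<..} \<times> {u<..}) \<inter> space P = {\<omega> \<in> space P. X i \<omega> > u \<and> X j \<omega> > u}"
    "\<And>i. X i -` {u<..} \<inter> space P = {\<omega> \<in> space P. X i \<omega> > u}" by auto
  ultimately show ?thesis using assms by (simp add: prob_X_gt)
qed

lemma second_moment_sum:
  fixes g :: "real \<Rightarrow> real"
  assumes I: "finite I" "I \<subseteq> {1..}"
    and [measurable]: "g \<in> borel_measurable borel"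
    and g: "integrable D g" "(\<integral>v. g v \<partial>D) = 0" "integrable D (\<lambda>v. (g v)\<^sup>2)"
  shows "integrable P (\<lambda>\<omega>. (\<Sum>i\<in>I. g (X i \<omega>))\<^sup>2) \<and>
    (\<integral>\<omega>. (\<Sum>i\<in>I. g (X i \<omega>))\<^sup>2 \<partial>P) = real (card I) * (\<integral>v. (g v)\<^sup>2 \<partial>D)"
  using I
proof (induction I)
  case (insert j I)
  then have j: "j \<ge> 1" and I: "I \<subseteq> {1..}" by auto
  let ?S = "\<lambda>\<omega>. \<Sum>i\<in>I. g (X i \<omega>)" and ?Y = "\<lambda>\<omega>. g (X j \<omega>)"
  have ind: "indep_var borel ?Y borel ?S"
    by (rule indep_var_rest) (use insert j I in auto)
  have iY: "integrable P ?Y" "(\<integral>\<omega>. ?Y \<omega> \<partial>P) = 0"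
    using integrable_X[OF j _ g(1)] expectation_X[OF j] g by auto
  have iS: "integrable P ?S"
    using I by (intro Bochner_Integration.integrable_sum integrable_X g) auto
  have YS: "integrable P (\<lambda>\<omega>. ?Y \<omega> * ?S \<omega>)" "(\<integral>\<omega>. ?Y \<omega> * ?S \<omega> \<partial>P) = 0"
    using indep_var_integrable[OF ind iY(1) iS] indep_var_lebesgue_integral[OF ind iY(1) iS] iY by auto
  have Y2: "integrable P (\<lambda>\<omega>. (?Y \<omega>)\<^sup>2)" "(\<integral>\<omega>. (?Y \<omega>)\<^sup>2 \<partial>P) = (\<integral>v. (g v)\<^sup>2 \<partial>D)"
    using integrable_X[OF j _ g(3)] expectation_X[OF j, of "\<lambda>v. (g v)\<^sup>2"] by auto
  have IH: "integrable P (\<lambda>\<omega>. (?S \<omega>)\<^sup>2)" "(\<integral>\<omega>. (?S \<omega>)\<^sup>2 \<partial>P) = real (card I) * (\<integral>v. (g v)\<^sup>2 \<partial>D)"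
    using insert.IH[OF I] by auto
  have eq: "(\<lambda>\<omega>. (\<Sum>i\<in>insert j I. g (X i \<omega>))\<^sup>2) = (\<lambda>\<omega>. (?Y \<omega>)\<^sup>2 + 2 * (?Y \<omega> * ?S \<omega>) + (?S \<omega>)\<^sup>2)"
    using insert by (auto simp: power2_sum mult_ac)
  show ?case
    unfolding eq using YS Y2 IH insert by (auto simp: algebra_simps)
qed simp

lemma markov:
  assumes [measurable]: "Z \<in> borel_measurable P" and "integrable P Z" "\<And>\<omega>. 0 \<le> Z \<omega>" "0 < a"
    and "A \<subseteq> {\<omega> \<in> space P. a \<le> Z \<omega>}"
  shows "prob A \<le> (\<integral>\<omega>. Z \<omega> \<partial>P) / a"
proof -
  have "prob A \<le> prob {\<omega> \<in> space P. a \<le> Z \<omega>}"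
    using assms(5) by (intro finite_measure_mono) auto
  also have "\<dots> \<le> (\<integral>\<omega>. Z \<omega> \<partial>P) / a"
    using assms by (intro integral_Markov_inequality_measure[where A="{}"]) auto
  finally show ?thesis .
qed

lemma csum_deviation:
  assumes I: "finite I" "I \<subseteq> {1..}" and m: "0 < m" and a: "0 < a"
  shows "prob {\<omega> \<in> space P. a \<le> \<bar>csum I m \<omega> - card I * (\<integral>v. min v m \<partial>D)\<bar>} \<le> card I / a\<^sup>2"
proof -
  define \<mu> where "\<mu> = (\<integral>v. min v m \<partial>D)"
  define g where "g v = min v m - \<mu>" for v
  have [measurable]: "g \<in> borel_measurable borel" unfolding g_def by measurable
  have g: "integrable D g" "(\<integral>v. g v \<partial>D) = 0"
    unfolding g_def using integrable_min by (auto simp: \<mu>_def D_UNIV)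
  have sq: "(\<lambda>v. (g v)\<^sup>2) = (\<lambda>v. (min v m)\<^sup>2 - 2 * \<mu> * min v m + \<mu>\<^sup>2)"
    by (auto simp: g_def power2_diff)
  have g2: "integrable D (\<lambda>v. (g v)\<^sup>2)"
    unfolding sq using integrable_min integrable_min_square[OF m] by auto
  have "(\<integral>v. (g v)\<^sup>2 \<partial>D) = (\<integral>v. (min v m)\<^sup>2 \<partial>D) - \<mu>\<^sup>2"
    unfolding sq using integrable_min integrable_min_square[OF m]
    by (simp add: \<mu>_def[symmetric] D.prob_space power2_eq_square)
  then have g1: "(\<integral>v. (g v)\<^sup>2 \<partial>D) \<le> 1"
    using min_square_le_1[OF m] by (smt (verit) zero_le_power2)
  have dev: "(\<Sum>i\<in>I. g (X i \<omega>)) = csum I m \<omega> - card I * \<mu>" for \<omega>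
    by (simp add: g_def csum_def sum_subtractf)
  note S = second_moment_sum[OF I \<open>g \<in> _\<close> g g2]
  have "prob {\<omega> \<in> space P. a \<le> \<bar>csum I m \<omega> - card I * \<mu>\<bar>} \<le> (\<integral>\<omega>. (\<Sum>i\<in>I. g (X i \<omega>))\<^sup>2 \<partial>P) / a\<^sup>2"
  proof (rule markov)
    show "{\<omega> \<in> space P. a \<le> \<bar>csum I m \<omega> - card I * \<mu>\<bar>} \<subseteq> {\<omega> \<in> space P. a\<^sup>2 \<le> (\<Sum>i\<in>I. g (X i \<omega>))\<^sup>2}"
      unfolding dev using a by (auto intro!: abs_le_square_iff[THEN iffD1])
    show "(\<lambda>\<omega>. (\<Sum>i\<in>I. g (X i \<omega>))\<^sup>2) \<in> borel_measurable P"
      using borel_measurable_integrable S by blast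
  qed (use S a in auto)
  also have "\<dots> \<le> card I / a\<^sup>2"
    using S g1 by (auto intro!: divide_right_mono mult_left_le)
  finally show ?thesis unfolding \<mu>_def .
qed

lemma csum_upper_chebyshev:
  assumes "finite I" "I \<subseteq> {1..}" "0 < m" "0 < a"
  shows "prob (exceeds I m a) \<le> card I / a\<^sup>2"
proof (rule order_trans[OF finite_measure_mono csum_deviation[OF assms]])
  have "card I * (\<integral>v. min v m \<partial>D) \<le> 0"
    using mean_min_le by (intro mult_nonneg_nonpos) auto
  then show "exceeds I m a \<subseteq> {\<omega> \<in> space P. a \<le> \<bar>csum I m \<omega> - card I * (\<integral>v. min v m \<partial>D)\<bar>}"
    by auto
qed (use assms in measurable)

lemma csum_lower_chebyshev:
  assumes "finite I" "I \<subseteq> {1..}" "0 < m" "0 < a"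
  shows "prob {\<omega> \<in> space P. csum I m \<omega> \<le> - (a + card I / m)} \<le> card I / a\<^sup>2"
proof (rule order_trans[OF finite_measure_mono csum_deviation[OF assms]])
  have "card I * (- 1 / m) \<le> card I * (\<integral>v. min v m \<partial>D)"
    using mean_min_ge assms by (intro mult_left_mono) auto
  then show "{\<omega> \<in> space P. csum I m \<omega> \<le> - (a + card I / m)} \<subseteq> {\<omega> \<in> space P. a \<le> \<bar>csum I m \<omega> - card I * (\<integral>v. min v m \<partial>D)\<bar>}"
    by auto
qed (use assms in measurable)

section \<open>Exponential moments\<close>

lemma integrable_exp_min: 
  assumes "0 \<le> h" shows "integrable D (\<lambda>v. exp (h * min v m))"
  using assms by (intro D.integrable_const_bound[where B = "exp (h * m)"]) (auto intro!: mult_left_mono)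

text \<open>
  The sum may have fewer than \<open>n\<close> terms, so that the bound also covers sums with one index left out.
\<close>
lemma chernoff:
  assumes I: "finite I" "I \<subseteq> {1..}" "card I \<le> n" and h: "0 \<le> h"
    and mgf: "(\<integral>v. exp (h * min v m) \<partial>D) \<le> 1 + q" and q: "0 \<le> q"
  shows "prob (exceeds I m a) \<le> exp (- h * a + n * q)"
proof -
  let ?E = "\<lambda>i \<omega>. exp (h * min (X i \<omega>) m)"
  have ind: "indep_vars (\<lambda>_. borel) ?E I"
    using indep_vars_subset_compose[OF I(2), of "\<lambda>_ v. exp (h * min v m)"] by simp
  have int: "integrable P (?E i)" if "i \<in> I" for i
    using integrable_X[OF _ _ integrable_exp_min[OF h]] that I by auto
  have prod: "(\<lambda>\<omega>. exp (h * csum I m \<omega>)) = (\<lambda>\<omega>. \<Prod>i\<in>I. ?E i \<omega>)"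
    using I(1) by (simp add: csum_def sum_distrib_left exp_sum)
  have "prob (exceeds I m a) \<le> (\<integral>\<omega>. exp (h * csum I m \<omega>) \<partial>P) / exp (h * a)"
    using I h by (intro markov) (auto simp: prod intro!: indep_vars_integrable[OF I(1) ind int] mult_left_mono, auto simp: prod[symmetric])
  also have "(\<integral>\<omega>. exp (h * csum I m \<omega>) \<partial>P) = (\<Prod>i\<in>I. \<integral>\<omega>. ?E i \<omega> \<partial>P)"
    unfolding prod by (rule indep_vars_lebesgue_integral[OF I(1) ind int])
  also have "\<dots> = (\<integral>v. exp (h * min v m) \<partial>D) ^ card I"
    using I expectation_X[of _ "\<lambda>v. exp (h * min v m)"] by (subst prod_constant[symmetric], intro prod.cong) auto
  also have "\<dots> \<le> (1 + q) ^ card I"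
    using mgf by (intro power_mono) auto
  also have "\<dots> \<le> (1 + q) ^ n"
    using I q by (intro power_increasing) auto
  also have "\<dots> \<le> exp q ^ n"
    using q by (intro power_mono exp_ge_add_one_self) auto
  also have "\<dots> = exp (n * q)" by (simp add: exp_of_nat_mult)
  finally show ?thesis by (simp add: divide_right_mono exp_diff exp_add exp_minus field_simps)
qed

lemma mgf_small:
  assumes "0 \<le> h" "0 < m" "h * m \<le> A"
  shows "(\<integral>v. exp (h * min v m) \<partial>D) \<le> 1 + h\<^sup>2 / 2 * exp A"
proof -
  have A: "0 \<le> A" using assms by (meson mult_nonneg_nonneg order_trans less_imp_le)
  have "(\<integral>v. exp (h * min v m) \<partial>D) \<le> (\<integral>v. 1 + h * min v m + h\<^sup>2 / 2 * exp A * v\<^sup>2 \<partial>D)"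
  proof (intro integral_mono integrable_exp_min assms)
    fix v :: real
    have "h * min v m \<le> A" using assms by (meson min.cobounded2 mult_left_mono order_trans)
    from exp_le_quadratic[OF this A]
    have "exp (h * min v m) \<le> 1 + h * min v m + h\<^sup>2 / 2 * exp A * (min v m)\<^sup>2"
      by (simp add: power_mult_distrib mult_ac)
    also have "h\<^sup>2 / 2 * exp A * (min v m)\<^sup>2 \<le> h\<^sup>2 / 2 * exp A * v\<^sup>2"
      using min_square_le[OF assms(2)] by (intro mult_left_mono) auto
    finally show "exp (h * min v m) \<le> 1 + h * min v m + h\<^sup>2 / 2 * exp A * v\<^sup>2" by simp
  qed (use integrable_min square_integrable in auto)
  also have "\<dots> = 1 + h * (\<integral>v. min v m \<partial>D) + h\<^sup>2 / 2 * exp A"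
    using integrable_min square_integrable second_moment by (simp add: D_UNIV)
  also have "\<dots> \<le> 1 + h\<^sup>2 / 2 * exp A"
    using mean_min_le[of m] assms by (simp add: mult_nonneg_nonpos)
  finally show ?thesis .
qed

text \<open>
  Below \<open>A / h\<close> the quadratic bound holds with a constant as close to \<open>1 / 2\<close> as desired, by the
  choice of \<open>A\<close>. Above it, splitting at \<open>m / 2\<close> is enough: on the lower part the exponential is
  only the square root of its maximal value, which leaves room for a crude bound on \<open>V (A / h)\<close>.
\<close>
lemma mgf_large:
  assumes h: "0 < h" and "0 < m" and A: "0 \<le> A"
  shows "(\<integral>v. exp (h * min v m) \<partial>D) \<le>
    1 + (h\<^sup>2 / 2 * exp A + exp (h * m / 2) * V (A / h) + exp (h * m) * V (m / 2))"
proof -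
  have "(\<integral>v. exp (h * min v m) \<partial>D) \<le> (\<integral>v. 1 + h * v + h\<^sup>2 / 2 * exp A * v\<^sup>2 +
      exp (h * m / 2) * indicator {A / h<..} v + exp (h * m) * indicator {m / 2<..} v \<partial>D)"
  proof (intro integral_mono integrable_exp_min)
    fix v :: real
    let ?i = "exp (h * m / 2) * indicator {A / h<..} v :: real" and ?j = "exp (h * m) * indicator {m / 2<..} v :: real"
    have nn: "0 \<le> ?i" "0 \<le> ?j" by auto
    show "exp (h * min v m) \<le> 1 + h * v + h\<^sup>2 / 2 * exp A * v\<^sup>2 + ?i + ?j"
    proof (cases "v \<le> A / h")
      case True
      then have "h * v \<le> A" using h by (simp add: field_simps)
      from exp_le_quadratic[OF this A]
      have "exp (h * v) \<le> 1 + h * v + h\<^sup>2 / 2 * exp A * v\<^sup>2"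
        by (simp add: power_mult_distrib mult_ac)
      moreover have "exp (h * min v m) \<le> exp (h * v)" using h by (auto intro!: mult_left_mono)
      ultimately show ?thesis using nn by linarith
    next
      case False
      then have v: "0 \<le> v" using A h by (smt (verit) divide_nonneg_pos)
      then have nn': "0 \<le> 1 + h * v + h\<^sup>2 / 2 * exp A * v\<^sup>2" using h by auto
      show ?thesis
      proof (cases "v \<le> m / 2")
        case True
        have "h * min v m \<le> h * (m / 2)"
          using h True assms by (intro mult_left_mono) auto
        then have "exp (h * min v m) \<le> ?i" using False by auto
        then show ?thesis using nn nn' by linarith
      next
        case ge: False
        have "exp (h * min v m) \<le> ?j" using ge h by (auto intro!: mult_left_mono)
        then show ?thesis using nn nn' by linarith
      qed
    qed
  qed (use h mean_integrable square_integrable indicator_D in auto)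
  also have "\<dots> = 1 + h\<^sup>2 / 2 * exp A + exp (h * m / 2) * V (A / h) + exp (h * m) * V (m / 2)"
    using mean_integrable square_integrable second_moment mean_zero indicator_D by (simp add: D_UNIV)
  finally show ?thesis by simp
qed

section \<open>One big jump\<close>

text \<open>
  The most likely way for the sum to exceed \<open>u - a\<close>: one summand beyond \<open>u\<close>, and the rest not
  below \<open>- a\<close>.
\<close>
definition jump_event :: "nat \<Rightarrow> real \<Rightarrow> real \<Rightarrow> real \<Rightarrow> 'a set" where
  "jump_event n m u a = {\<omega> \<in> space P. \<exists>j\<in>{1..n}. X j \<omega> > u \<and> csum ({1..n} - {j}) m \<omega> > - a}"

lemma jump_event_sets [measurable]: "jump_event n m u a \<in> events"
proof -
  have "jump_event n m u a = (\<Union>j\<in>{1..n}. {\<omega> \<in> space P. X j \<omega> > u \<and> csum ({1..n} - {j}) m \<omega> > - a})"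
    unfolding jump_event_def by auto
  also have "\<dots> \<in> events"
  proof (intro sets.finite_UN)
    fix j assume "j \<in> {1..n}"
    then have [measurable]: "X j \<in> borel_measurable P" "csum ({1..n} - {j}) m \<in> borel_measurable P"
      by (auto intro!: measurable_csum)
    show "{\<omega> \<in> space P. X j \<omega> > u \<and> csum ({1..n} - {j}) m \<omega> > - a} \<in> events" by measurable
  qed auto
  finally show ?thesis .
qed

lemma csum_remove:
  assumes "finite I" "j \<in> I" shows "csum I m \<omega> = min (X j \<omega>) m + csum (I - {j}) m \<omega>"
  unfolding csum_def using assms by (rule sum.remove)

lemma jump_event_subset:
  assumes "u \<le> m"
  shows "jump_event n m u a \<subseteq> exceeds {1..n} m (u - a)"
proof
  fix \<omega> assume "\<omega> \<in> jump_event n m u a"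
  then obtain j where j: "j \<in> {1..n}" "X j \<omega> > u" "csum ({1..n} - {j}) m \<omega> > - a" "\<omega> \<in> space P"
    unfolding jump_event_def by auto
  with csum_remove[of "{1..n}" j m \<omega>] assms show "\<omega> \<in> exceeds {1..n} m (u - a)"
    by auto
qed

text \<open>
  Discarding from the event with jump index \<open>j\<close> the event that another summand is beyond \<open>u\<close> too
  makes these events disjoint. Chebyshev controls the rest, whose mean is at least \<open>- b\<close>.
\<close>
lemma prob_jump_event:
  assumes m: "0 < m" and a: "0 < a" and n: "n / m \<le> b"
  shows "real n * V u * (1 - n / a\<^sup>2 - n * V u) \<le> prob (jump_event n m u (a + b))"
proof -
  let ?I = "{1..n}"
  define B where "B j = {\<omega> \<in> space P. X j \<omega> > u \<and> csum (?I - {j}) m \<omega> > - (a + b)}" for j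
  define C where "C j = (\<Union>i\<in>?I - {j}. {\<omega> \<in> space P. X i \<omega> > u \<and> X j \<omega> > u})" for j
  have two: "{\<omega> \<in> space P. X i \<omega> > u \<and> X j \<omega> > u} \<in> events" if "i \<in> ?I" "j \<in> ?I" for i j
  proof -
    from that have [measurable]: "X i \<in> borel_measurable P" "X j \<in> borel_measurable P" by auto
    show ?thesis by measurable
  qed
  have meas: "B j \<in> events" "C j \<in> events" if "j \<in> ?I" for j
  proof -
    have [measurable]: "X j \<in> borel_measurable P" "csum (?I - {j}) m \<in> borel_measurable P"
      using that by (auto intro!: measurable_csum)
    show "B j \<in> events" unfolding B_def by measurable
    show "C j \<in> events" unfolding C_def
      by (intro sets.finite_UN finite_Diff finite_atLeastAtMost two[OF _ that]) (rule DiffD1)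
  qed
  have single: "V u * (1 - n / a\<^sup>2 - n * V u) \<le> prob (B j - C j)" if j: "j \<in> ?I" for j
  proof -
    let ?R = "exceeds (?I - {j}) m (- (a + b))"
    let ?R' = "{\<omega> \<in> space P. csum (?I - {j}) m \<omega> \<le> - (a + b)}"
    have [measurable]: "csum (?I - {j}) m \<in> borel_measurable P"
      by (auto intro!: measurable_csum)
    have sub: "?I - {j} \<subseteq> {1..}" by auto
    have cI: "real (card (?I - {j})) \<le> n" using card_mono[of ?I "?I - {j}"] by simp
    have "prob ?R' \<le> prob {\<omega> \<in> space P. csum (?I - {j}) m \<omega> \<le> - (a + card (?I - {j}) / m)}"
    proof (intro finite_measure_mono subsetI)
      have "card (?I - {j}) / m \<le> b" using divide_right_mono[OF cI, of m] m n by linarith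
      then show "\<omega> \<in> {\<omega> \<in> space P. csum (?I - {j}) m \<omega> \<le> - (a + card (?I - {j}) / m)}" if "\<omega> \<in> ?R'" for \<omega>
        using that by auto
    qed measurable
    also have "\<dots> \<le> card (?I - {j}) / a\<^sup>2" using m a by (intro csum_lower_chebyshev) auto
    also have "\<dots> \<le> n / a\<^sup>2" using cI by (intro divide_right_mono) auto
    finally have R': "prob ?R' \<le> n / a\<^sup>2" .
    have "?R \<in> events" by measurable
    from prob_neg[OF this] have "prob ?R' = 1 - prob ?R" by (simp add: not_less)
    then have R: "prob ?R \<ge> 1 - n / a\<^sup>2" using R' by linarith
    have "prob (B j) = V u * prob ?R"
      unfolding B_def using prob_indep_rest[of "?I - {j}" j "{u<..}" "{- (a + b)<..}" m] sub j by (simp add: prob_X_gt del: One_nat_def)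
    then have Bj: "prob (B j) \<ge> V u * (1 - n / a\<^sup>2)" using R V_nonneg[of u] by (simp add: mult_left_mono)
    have "prob (C j) \<le> (\<Sum>i\<in>?I - {j}. prob {\<omega> \<in> space P. X i \<omega> > u \<and> X j \<omega> > u})"
      unfolding C_def using two[OF _ j]
      by (intro finite_measure_subadditive_finite finite_Diff finite_atLeastAtMost image_subsetI) (simp only: Diff_iff)
    also have "\<dots> = (\<Sum>i\<in>?I - {j}. V u * V u)"
      using j by (intro sum.cong refl prob_two_large) auto
    also have "\<dots> = card (?I - {j}) * (V u * V u)" by (rule sum_constant)
    also have "\<dots> \<le> n * (V u * V u)" using cI V_nonneg by (intro mult_right_mono) auto
    finally have Cj: "prob (C j) \<le> n * (V u * V u)" .
    have "prob (B j) \<le> prob ((B j - C j) \<union> C j)"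
      using meas[OF j] by (intro finite_measure_mono) auto
    also have "\<dots> \<le> prob (B j - C j) + prob (C j)"
      using meas[OF j] by (intro measure_Un_le) auto
    finally have "prob (B j) \<le> prob (B j - C j) + prob (C j)" .
    then show ?thesis using Bj Cj by (simp add: algebra_simps)
  qed
  have "disjoint_family_on (\<lambda>j. B j - C j) ?I"
    unfolding disjoint_family_on_def B_def C_def by auto
  then have "(\<Sum>j\<in>?I. prob (B j - C j)) = prob (\<Union>j\<in>?I. B j - C j)"
    using meas by (intro finite_measure_finite_Union[symmetric]) auto
  also have "\<dots> \<le> prob (jump_event n m u (a + b))"
  proof (rule finite_measure_mono[OF _ jump_event_sets])
    show "(\<Union>j\<in>?I. B j - C j) \<subseteq> jump_event n m u (a + b)"
      unfolding jump_event_def B_def by blast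
  qed
  finally have "(\<Sum>j\<in>?I. prob (B j - C j)) \<le> prob (jump_event n m u (a + b))" .
  moreover have "real n * (V u * (1 - n / a\<^sup>2 - n * V u)) \<le> (\<Sum>j\<in>?I. prob (B j - C j))"
    using sum_mono[of ?I "\<lambda>_. V u * (1 - n / a\<^sup>2 - n * V u)" "\<lambda>j. prob (B j - C j)"] single by simp
  ultimately show ?thesis by (simp add: mult.assoc)
qed

text \<open>
  If \<open>X j\<close> exceeds \<open>y\<close>, then either it alone contributes more than \<open>x - a\<close>, which is
  impossible when it is censored at or below \<open>x - a\<close>, or the rest, which is independent of it,
  contributes more than \<open>a\<close>.
\<close>
lemma prob_with_jump_le:
  assumes rest: "\<And>j. j \<in> {1..n} \<Longrightarrow> prob (exceeds ({1..n} - {j}) m a) \<le> p"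
  shows "prob {\<omega> \<in> space P. csum {1..n} m \<omega> > x \<and> (\<exists>j\<in>{1..n}. X j \<omega> > y)}
    \<le> n * ((if x - a < m then V (x - a) else 0) + V y * p)"
proof -
  let ?I = "{1..n}"
  let ?A = "\<lambda>j. {\<omega> \<in> space P. min (X j \<omega>) m > x - a}"
  let ?W = "if x - a < m then V (x - a) else 0"
  let ?B = "\<lambda>j. {\<omega> \<in> space P. X j \<omega> \<in> {y<..} \<and> csum (?I - {j}) m \<omega> \<in> {a<..}}"
  have meas: "?A j \<in> events" "?B j \<in> events" if "j \<in> ?I" for j
  proof -
    have [measurable]: "X j \<in> borel_measurable P" "csum (?I - {j}) m \<in> borel_measurable P"
      using that by (auto intro!: measurable_csum)
    show "?A j \<in> events" "?B j \<in> events" by measurable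
  qed
  have "prob {\<omega> \<in> space P. csum ?I m \<omega> > x \<and> (\<exists>j\<in>?I. X j \<omega> > y)} \<le> prob (\<Union>j\<in>?I. ?A j \<union> ?B j)"
  proof (intro finite_measure_mono)
    show "{\<omega> \<in> space P. csum ?I m \<omega> > x \<and> (\<exists>j\<in>?I. X j \<omega> > y)} \<subseteq> (\<Union>j\<in>?I. ?A j \<union> ?B j)"
    proof safe
      fix \<omega> j assume *: "\<omega> \<in> space P" "csum ?I m \<omega> > x" "j \<in> ?I" "X j \<omega> > y"
      then have "x < min (X j \<omega>) m + csum (?I - {j}) m \<omega>"
        using csum_remove[of ?I j m \<omega>] by auto
      then have "\<omega> \<in> ?A j \<union> ?B j" using * by (cases "min (X j \<omega>) m > x - a") auto
      with *(3) show "\<omega> \<in> (\<Union>j\<in>?I. ?A j \<union> ?B j)" by (rule UN_I)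
    qed
    show "(\<Union>j\<in>?I. ?A j \<union> ?B j) \<in> events"
      by (rule sets.finite_UN) (simp_all only: finite_atLeastAtMost sets.Un meas)
  qed
  also have "\<dots> \<le> (\<Sum>j\<in>?I. prob (?A j \<union> ?B j))"
    by (intro finite_measure_subadditive_finite finite_atLeastAtMost image_subsetI sets.Un meas)
  also have "\<dots> \<le> (\<Sum>j\<in>?I. ?W + V y * p)"
  proof (intro sum_mono)
    fix j assume j: "j \<in> ?I"
    have sub: "?I - {j} \<subseteq> {1..}" by auto
    have "prob (?A j \<union> ?B j) \<le> prob (?A j) + prob (?B j)"
      by (intro measure_Un_le meas[OF j])
    also have "prob (?A j) = ?W" using j by (auto simp: prob_X_gt)
    also have "prob (?B j) = V y * prob (exceeds (?I - {j}) m a)"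
      using prob_indep_rest[of "?I - {j}" j "{y<..}" "{a<..}" m] j sub by (simp add: prob_X_gt del: One_nat_def)
    also have "\<dots> \<le> V y * p" using rest[OF j] V_nonneg by (intro mult_left_mono) auto
    finally show "prob (?A j \<union> ?B j) \<le> ?W + V y * p" by simp
  qed
  finally show ?thesis by simp
qed

lemma csum_no_jump:
  assumes "\<And>j. j \<in> I \<Longrightarrow> X j \<omega> \<le> y" "y \<le> m"
  shows "csum I m \<omega> = csum I y \<omega>"
  unfolding csum_def by (intro sum.cong) (use assms in fastforce)+

lemma exists_large_sets:
  assumes "finite I" "I \<subseteq> {1..}" "J \<subseteq> {1..}"
  shows "{\<omega> \<in> space P. csum J m \<omega> > x \<and> (\<exists>j\<in>I. X j \<omega> > y)} \<in> events"
proof -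
  have [measurable]: "csum J m \<in> borel_measurable P" using assms(3) by (rule measurable_csum)
  have "{\<omega> \<in> space P. csum J m \<omega> > x \<and> (\<exists>j\<in>I. X j \<omega> > y)} = (\<Union>j\<in>I. {\<omega> \<in> space P. csum J m \<omega> > x \<and> X j \<omega> > y})"
    by auto
  also have "\<dots> \<in> events"
  proof (intro sets.finite_UN assms(1))
    fix j assume "j \<in> I"
    then have [measurable]: "X j \<in> borel_measurable P" using assms by auto
    show "{\<omega> \<in> space P. csum J m \<omega> > x \<and> X j \<omega> > y} \<in> events" by measurable
  qed
  finally show ?thesis .
qed

lemma prob_exists_large:
  assumes I: "finite I" "I \<subseteq> {1..}" "J \<subseteq> {1..}"
  shows "prob {\<omega> \<in> space P. csum J m \<omega> > x \<and> (\<exists>j\<in>I. X j \<omega> > y)} \<le> card I * V y"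
proof -
  have ev: "{\<omega> \<in> space P. X j \<omega> > y} \<in> events" if "j \<in> I" for j
  proof -
    have [measurable]: "X j \<in> borel_measurable P" using that I by auto
    show ?thesis by measurable
  qed
  have "prob {\<omega> \<in> space P. csum J m \<omega> > x \<and> (\<exists>j\<in>I. X j \<omega> > y)} \<le> prob (\<Union>j\<in>I. {\<omega> \<in> space P. X j \<omega> > y})"
    by (intro finite_measure_mono sets.finite_UN ev I) auto
  also have "\<dots> \<le> (\<Sum>j\<in>I. prob {\<omega> \<in> space P. X j \<omega> > y})"
    by (intro finite_measure_subadditive_finite image_subsetI ev I)
  also have "\<dots> = (\<Sum>j\<in>I. V y)" using I by (intro sum.cong prob_X_gt refl) auto
  finally show ?thesis by simp
qed

lemma prob_split_jump:
  assumes y: "y \<le> m" and I: "finite I" "I \<subseteq> {1..}"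
  shows "prob (exceeds I m x) \<le>
    prob {\<omega> \<in> space P. csum I m \<omega> > x \<and> (\<exists>j\<in>I. X j \<omega> > y)} + prob (exceeds I y x)"
proof -
  let ?A = "{\<omega> \<in> space P. csum I m \<omega> > x \<and> (\<exists>j\<in>I. X j \<omega> > y)}"
  let ?B = "exceeds I y x"
  have [measurable]: "csum I y \<in> borel_measurable P" using I by (intro measurable_csum)
  have A: "?A \<in> events" by (rule exists_large_sets[OF I I(2)])
  have B: "?B \<in> events" by measurable
  have "prob (exceeds I m x) \<le> prob (?A \<union> ?B)"
  proof (rule finite_measure_mono)
    show "exceeds I m x \<subseteq> ?A \<union> ?B"
    proof
      fix \<omega> assume "\<omega> \<in> exceeds I m x"
      then show "\<omega> \<in> ?A \<union> ?B"
        using csum_no_jump[of I \<omega> y m] y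
        by (cases "\<exists>j\<in>I. X j \<omega> > y") (simp, simp add: not_less)
    qed
    show "?A \<union> ?B \<in> events" using A B by (rule sets.Un)
  qed
  also have "\<dots> \<le> prob ?A + prob ?B" by (rule measure_Un_le[OF A B])
  finally show ?thesis .
qed

end

section \<open>Large deviations beyond the Gaussian range\<close>

lemma s_seq_ge:
  assumes "0 < c" "2 < \<alpha>"
  shows "\<forall>\<^sub>F n in sequentially. 1 \<le> n \<and> R * sqrt n \<le> c * s_seq \<alpha> n"
proof -
  have "filterlim (\<lambda>n. c * sqrt ((\<alpha> - 2) * ln (real n))) at_top sequentially"
    using assms by real_asymp
  then have "\<forall>\<^sub>F n in sequentially. R \<le> c * sqrt ((\<alpha> - 2) * ln (real n))"
    by (simp add: filterlim_at_top)
  then show ?thesis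
    using eventually_ge_at_top[of "1::nat"]
  proof eventually_elim
    case (elim n)
    have "R * sqrt n \<le> c * sqrt ((\<alpha> - 2) * ln (real n)) * sqrt n"
      using elim by (intro mult_right_mono) auto
    also have "\<dots> = c * s_seq \<alpha> n"
      unfolding s_seq_def by (simp add: real_sqrt_mult[symmetric] mult_ac)
    finally show ?case using elim by simp
  qed
qed

locale regvar_sample = standardized_sample +
  fixes \<alpha> :: real
  assumes \<alpha>: "2 < \<alpha>"
    and regvar: "\<And>y. 0 < y \<Longrightarrow> ((\<lambda>t. V (t * y) / V t) \<longlongrightarrow> y powr (-\<alpha>)) at_top"
begin

lemma V_pos: "0 < V t"
  by (rule regvar_pos[OF V_antimono V_nonneg regvar[of 2]]) auto

lemma V_potter_lower:
  assumes "\<alpha> < \<beta>"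
  obtains x0 where "0 < x0" "\<And>t s. x0 \<le> t \<Longrightarrow> 1 \<le> s \<Longrightarrow> V t \<le> (2 * s) powr \<beta> * V (t * s)"
  using potter_lower[OF V_antimono V_nonneg regvar[of 2] assms] assms \<alpha> by auto

lemma V_potter_upper:
  assumes "\<beta> < \<alpha>" "0 < \<beta>"
  obtains x0 where "0 < x0" "\<And>t s. x0 \<le> t \<Longrightarrow> 1 \<le> s \<Longrightarrow> V (t * s) \<le> (2 / s) powr \<beta> * V t"
  using potter_upper[OF V_antimono V_nonneg regvar[of 2] assms] by auto

lemma V_ge_power:
  assumes "\<alpha> < \<beta>"
  obtains c1 x0 where "0 < c1" "0 < x0" "\<And>x. x0 \<le> x \<Longrightarrow> c1 * x powr (-\<beta>) \<le> V x"
proof -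
  obtain x0 where x0: "0 < x0" "\<And>t s. x0 \<le> t \<Longrightarrow> 1 \<le> s \<Longrightarrow> V t \<le> (2 * s) powr \<beta> * V (t * s)"
    using V_potter_lower[OF assms] by blast
  define c1 where "c1 = V x0 * (x0 / 2) powr \<beta>"
  have "c1 * x powr (-\<beta>) \<le> V x" if "x0 \<le> x" for x
  proof -
    have "V x0 \<le> (2 * (x / x0)) powr \<beta> * V (x0 * (x / x0))"
      using x0(1) that by (intro x0(2)) auto
    then have "V x0 \<le> (2 * (x / x0)) powr \<beta> * V x" using x0 by simp
    then have "c1 * x powr (-\<beta>) \<le> (2 * (x / x0)) powr \<beta> * V x * (x0 / 2) powr \<beta> * x powr (-\<beta>)"
      unfolding c1_def by (intro mult_right_mono) auto
    also have "\<dots> = V x * ((2 * (x / x0)) powr \<beta> * (x0 / 2) powr \<beta>) * x powr (-\<beta>)" by simp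
    also have "(2 * (x / x0)) powr \<beta> * (x0 / 2) powr \<beta> = x powr \<beta>"
      using x0 that by (simp flip: powr_mult)
    also have "V x * x powr \<beta> * x powr (-\<beta>) = V x"
      using x0 that by (simp add: powr_minus)
    finally show ?thesis .
  qed
  then show ?thesis using x0 V_pos by (intro that[of c1 x0]) (auto simp: c1_def)
qed

text \<open>
  For a monotone tail these two bounds say that \<open>V\<close> varies by a factor close to 1 on all of
  \<open>[(1 - e) x, (1 + e) x]\<close>.
\<close>
lemma V_near_constant:
  assumes "0 < \<eta>"
  obtains e x0 where "0 < e" "e < 1" "\<forall>x\<ge>x0. V ((1 - e) * x) \<le> (1 + \<eta>) * V x"
    "\<forall>x\<ge>x0. (1 - \<eta>) * V x \<le> V ((1 + e) * x)"
proof -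
  have "((\<lambda>e. (1 - e) powr (-\<alpha>)) \<longlongrightarrow> (1 - 0) powr (-\<alpha>)) (at_right 0)"
    by (intro tendsto_intros) auto
  then have "\<forall>\<^sub>F e in at_right 0. (1 - e) powr (-\<alpha>) < 1 + \<eta>"
    using assms by (intro order_tendstoD(2)) auto
  moreover have "((\<lambda>e. (1 + e) powr (-\<alpha>)) \<longlongrightarrow> (1 + 0) powr (-\<alpha>)) (at_right 0)"
    by (intro tendsto_intros) auto
  then have "\<forall>\<^sub>F e in at_right 0. 1 - \<eta> < (1 + e) powr (-\<alpha>)"
    using assms by (intro order_tendstoD(1)) auto
  moreover have "\<forall>\<^sub>F e in at_right (0::real). e \<in> {0<..<1}"
    by (rule eventually_at_right_real) auto
  ultimately have "\<forall>\<^sub>F e in at_right (0::real). (1 - e) powr (-\<alpha>) < 1 + \<eta> \<and> 1 - \<eta> < (1 + e) powr (-\<alpha>) \<and> 0 < e \<and> e < 1"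
    by eventually_elim auto
  then obtain e where e: "(1 - e) powr (-\<alpha>) < 1 + \<eta>" "1 - \<eta> < (1 + e) powr (-\<alpha>)" "0 < e" "e < 1"
    using eventually_happens'[of "at_right (0::real)"] by auto
  have e': "0 < 1 - e" "0 < 1 + e" using e by auto
  have "\<forall>\<^sub>F x in at_top. V (x * (1 - e)) / V x < 1 + \<eta> \<and> 1 - \<eta> < V (x * (1 + e)) / V x"
    using order_tendstoD(2)[OF regvar[OF e'(1)] e(1)] order_tendstoD(1)[OF regvar[OF e'(2)] e(2)]
    by (rule eventually_conj)
  then obtain x0 where x0: "\<And>x. x0 \<le> x \<Longrightarrow> V (x * (1 - e)) / V x < 1 + \<eta>" "\<And>x. x0 \<le> x \<Longrightarrow> 1 - \<eta> < V (x * (1 + e)) / V x"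
    unfolding eventually_at_top_linorder by blast
  show ?thesis
  proof (rule that[OF e(3,4)]; intro allI impI)
    fix x assume x: "x0 \<le> x"
    show "V ((1 - e) * x) \<le> (1 + \<eta>) * V x" "(1 - \<eta>) * V x \<le> V ((1 + e) * x)"
      using x0[OF x] V_pos[of x] by (simp_all add: pos_divide_less_eq pos_less_divide_eq mult.commute)
  qed
qed

lemma nV_small:
  fixes n :: nat
  assumes "0 < n" "0 < R" "R * sqrt n \<le> x"
  shows "n * V x \<le> 1 / R\<^sup>2"
proof -
  have "0 < x" using assms by (smt (verit) mult_pos_pos of_nat_0_less_iff real_sqrt_gt_0_iff)
  then have "n * V x \<le> n * (1 / x\<^sup>2)"
    using V_le_inverse_square by (intro mult_left_mono) auto
  also have "\<dots> \<le> n * (1 / (R * sqrt n)\<^sup>2)"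
    using assms \<open>0 < x\<close> by (intro mult_left_mono divide_left_mono power_mono mult_pos_pos zero_less_power) auto
  also have "\<dots> = 1 / R\<^sup>2" using assms by (simp add: power_mult_distrib)
  finally show ?thesis .
qed

text \<open>
  On the scale \<open>z = x / sqrt n\<close> the logarithm of \<open>n V x\<close> is at least
  \<open>- (\<beta> / 2 - 1) ln n - \<beta> ln z\<close> up to a constant, for any \<open>\<beta> > \<alpha>\<close>. The condition
  \<open>x \<ge> c s_seq \<alpha> n\<close> says that \<open>ln n\<close> is at most \<open>z\<^sup>2 / (c\<^sup>2 (\<alpha> - 2))\<close>, so the leading
  term is \<open>- z\<^sup>2 / (2 c\<^sup>2)\<close> as \<open>\<beta>\<close> tends to \<open>\<alpha>\<close>; the slack in \<open>\<kappa>\<close> absorbs the logarithm.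
\<close>
lemma nV_ge_gaussian:
  assumes c: "0 < c" and \<kappa>: "1 / c\<^sup>2 < \<kappa>"
  shows "\<forall>\<^sub>F n in sequentially. \<forall>x\<ge>c * s_seq \<alpha> n. exp (- \<kappa> * x\<^sup>2 / (2 * n)) \<le> n * V x"
proof -
  define \<kappa>0 where "\<kappa>0 = 1 / c\<^sup>2"
  define \<kappa>1 where "\<kappa>1 = (\<kappa> + \<kappa>0) / 2"
  \<comment> \<open>The solution of \<open>(\<alpha> + \<delta> - 2) \<kappa>0 / (\<alpha> - 2) = \<kappa>1\<close>.\<close>
  define \<delta> where "\<delta> = (\<alpha> - 2) * (\<kappa> - \<kappa>0) / (2 * \<kappa>0)"
  define \<beta> where "\<beta> = \<alpha> + \<delta>"
  have \<kappa>0: "0 < \<kappa>0" "\<kappa>0 < \<kappa>" "\<kappa>1 < \<kappa>" using c \<kappa> by (auto simp: \<kappa>0_def \<kappa>1_def)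
  have \<delta>: "0 < \<delta>" using \<kappa>0 \<alpha> by (simp add: \<delta>_def)
  have \<beta>: "\<alpha> < \<beta>" "2 < \<beta>" using \<delta> \<alpha> by (auto simp: \<beta>_def)
  have \<beta>\<kappa>: "(\<beta> - 2) * \<kappa>0 / (\<alpha> - 2) = \<kappa>1"
  proof -
    have "(\<beta> - 2) / (\<alpha> - 2) = 1 + (\<kappa> - \<kappa>0) / (2 * \<kappa>0)"
      using \<alpha> by (simp add: \<beta>_def \<delta>_def field_simps)
    then have "(\<beta> - 2) / (\<alpha> - 2) * \<kappa>0 = (1 + (\<kappa> - \<kappa>0) / (2 * \<kappa>0)) * \<kappa>0" by simp
    also have "\<dots> = \<kappa>1" using \<kappa>0 by (simp add: \<kappa>1_def field_simps)
    finally show ?thesis by simp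
  qed
  obtain c1 x0 where c1: "0 < c1" "0 < x0" "\<And>x. x0 \<le> x \<Longrightarrow> c1 * x powr (-\<beta>) \<le> V x"
    using V_ge_power[OF \<beta>(1)] by blast
  have "\<forall>\<^sub>F z in at_top. \<beta> * ln z - ln c1 \<le> (\<kappa> - \<kappa>1) * z\<^sup>2 / 2"
    using \<kappa>0 \<beta> by real_asymp
  then obtain z0 where z0: "\<And>z. z0 \<le> z \<Longrightarrow> \<beta> * ln z - ln c1 \<le> (\<kappa> - \<kappa>1) * z\<^sup>2 / 2"
    unfolding eventually_at_top_linorder by blast
  define R where "R = max 1 (max x0 z0)"
  show ?thesis
    using s_seq_ge[OF c \<alpha>, of R] eventually_gt_at_top[of 1]
  proof (eventually_elim, intro allI impI)
    case (elim n)
    fix x assume x: "c * s_seq \<alpha> n \<le> x"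
    define z where "z = x / sqrt n"
    have n: "1 < n" "0 < ln (real n)" "1 \<le> sqrt n" using elim by auto
    have Rx: "R * sqrt n \<le> x" using elim x by linarith
    then have "R \<le> z" using n by (simp add: z_def pos_le_divide_eq)
    then have z: "R \<le> z" "1 \<le> z" "z0 \<le> z" by (auto simp: R_def)
    have "R * 1 \<le> R * sqrt n" using n by (intro mult_left_mono) (auto simp: R_def)
    with Rx have "R \<le> x" by linarith
    then have xR: "R \<le> x" "x0 \<le> x" "0 < x" by (auto simp: R_def)
    have xz: "x = z * sqrt n" using n by (simp add: z_def)
    have "c * s_seq \<alpha> n = c * sqrt ((\<alpha> - 2) * ln n) * sqrt n"
      unfolding s_seq_def by (simp add: real_sqrt_mult mult_ac)
    then have "c * sqrt ((\<alpha> - 2) * ln n) * sqrt n \<le> x" using x by linarith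
    then have "c * sqrt ((\<alpha> - 2) * ln n) \<le> z" using n by (simp add: z_def pos_le_divide_eq)
    then have "(c * sqrt ((\<alpha> - 2) * ln n))\<^sup>2 \<le> z\<^sup>2" using c \<alpha> n by (intro power_mono) auto
    then have "c\<^sup>2 * ((\<alpha> - 2) * ln n) \<le> z\<^sup>2" using \<alpha> n by (simp add: power_mult_distrib)
    then have lnn: "ln n \<le> \<kappa>0 / (\<alpha> - 2) * z\<^sup>2" using c \<alpha> by (simp add: \<kappa>0_def field_simps)
    have "(\<beta> - 2) / 2 * ln n \<le> (\<beta> - 2) / 2 * (\<kappa>0 / (\<alpha> - 2) * z\<^sup>2)"
      using lnn \<beta> by (intro mult_left_mono) auto
    also have "\<dots> = (\<beta> - 2) * \<kappa>0 / (\<alpha> - 2) * z\<^sup>2 / 2"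
      by (simp only: times_divide_eq_left times_divide_eq_right mult.assoc mult.commute mult.left_commute divide_divide_eq_left)
    finally have 1: "(\<beta> - 2) / 2 * ln n \<le> \<kappa>1 * z\<^sup>2 / 2" unfolding \<beta>\<kappa> .
    have "- \<kappa> * z\<^sup>2 / 2 \<le> ln n + ln c1 - \<beta> * (ln z + ln n / 2)"
      using 1 z0[OF z(3)] by (simp add: field_simps)
    also have "ln z + ln n / 2 = ln x" using z n by (simp add: xz ln_mult ln_sqrt)
    finally have "exp (- \<kappa> * z\<^sup>2 / 2) \<le> exp (ln n + ln c1 + (-\<beta>) * ln x)" by simp
    also have "\<dots> = n * (c1 * x powr (-\<beta>))"
      using n c1 xR by (simp add: exp_add exp_diff exp_minus powr_def field_simps)
    also have "\<dots> \<le> n * V x" using c1(3)[OF xR(2)] by (intro mult_left_mono) auto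
    also have "z\<^sup>2 = x\<^sup>2 / n" using n by (simp add: z_def power_divide)
    finally show "exp (- \<kappa> * x\<^sup>2 / (2 * n)) \<le> n * V x" by (simp add: mult_ac)
  qed
qed

lemma gaussian_negligible:
  assumes c: "1 < c" and \<epsilon>: "0 < \<epsilon>"
  shows "\<forall>\<^sub>F n in sequentially. \<forall>x\<ge>c * s_seq \<alpha> n. exp (- x\<^sup>2 / (2 * n)) \<le> \<epsilon> * (n * V x)"
proof -
  define \<kappa> where "\<kappa> = (1 + 1 / c\<^sup>2) / 2"
  have "1 / c\<^sup>2 < 1" using c by (simp add: one_less_power)
  then have \<kappa>: "1 / c\<^sup>2 < \<kappa>" "\<kappa> < 1" by (auto simp: \<kappa>_def)
  have "\<forall>\<^sub>F R in at_top. exp (- (1 - \<kappa>) * R\<^sup>2 / 2) < \<epsilon>"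
    using \<kappa> \<epsilon> by real_asymp
  then obtain R where "\<And>R'. R \<le> R' \<Longrightarrow> exp (- (1 - \<kappa>) * R'\<^sup>2 / 2) < \<epsilon>"
    unfolding eventually_at_top_linorder by blast
  then have R: "exp (- (1 - \<kappa>) * (max 0 R)\<^sup>2 / 2) < \<epsilon>" by simp
  have c0: "0 < c" using c by simp
  show ?thesis
    using nV_ge_gaussian[OF c0 \<kappa>(1)] s_seq_ge[OF c0 \<alpha>, of "max 0 R"]
  proof (eventually_elim, intro allI impI)
    case (elim n)
    fix x assume x: "c * s_seq \<alpha> n \<le> x"
    have n: "0 < real n" using elim by simp
    have "max 0 R * sqrt n \<le> x" using elim x by linarith
    then have "(max 0 R * sqrt n)\<^sup>2 \<le> x\<^sup>2" by (intro power_mono) auto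
    then have "(max 0 R)\<^sup>2 * n \<le> x\<^sup>2" by (simp add: power_mult_distrib)
    then have "(max 0 R)\<^sup>2 \<le> x\<^sup>2 / n" using n by (simp add: field_simps)
    then have "(1 - \<kappa>) * (max 0 R)\<^sup>2 \<le> (1 - \<kappa>) * (x\<^sup>2 / n)" using \<kappa> by (intro mult_left_mono) auto
    then have "- (1 - \<kappa>) * (x\<^sup>2 / n) / 2 \<le> - (1 - \<kappa>) * (max 0 R)\<^sup>2 / 2" by (simp only: minus_mult_left[symmetric]) simp
    then have e: "exp (- (1 - \<kappa>) * (x\<^sup>2 / n) / 2) \<le> \<epsilon>" using R by (smt (verit) exp_le_cancel_iff)
    have "exp (- x\<^sup>2 / (2 * n)) = exp (- (1 - \<kappa>) * (x\<^sup>2 / n) / 2) * exp (- \<kappa> * x\<^sup>2 / (2 * n))"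
      unfolding exp_add[symmetric] using n by (intro arg_cong[where f=exp]) (simp add: field_simps)
    also have "\<dots> \<le> \<epsilon> * (n * V x)"
      using e elim x \<epsilon> by (intro mult_mono) auto
    finally show "exp (- x\<^sup>2 / (2 * n)) \<le> \<epsilon> * (n * V x)" .
  qed
qed

text \<open>
  With \<open>l = - ln (n V x)\<close> the exponential parameter is \<open>h = 2 l / x\<close>, so that \<open>h x = 2 l\<close> and
  \<open>exp (h x / 2) = 1 / (n V x)\<close>. The contributions of large summands to \<open>n\<close> times the moment
  generating function then are bounded, and the quadratic part is at most
  \<open>2 l\<^sup>2 n exp A / x\<^sup>2 \<le> \<kappa> exp A l\<close> by \<open>nV_ge_gaussian\<close>. As \<open>\<kappa> exp A < 1\<close>, the total
  exponent \<open>- 2 l + \<kappa> exp A l\<close> lies below \<open>- l\<close> by a multiple of \<open>l\<close>, and \<open>l\<close> tends to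
  infinity.
\<close>
lemma fuk_nagaev:
  assumes c: "1 < c" and \<epsilon>: "0 < \<epsilon>"
  shows "\<forall>\<^sub>F n in sequentially. \<forall>x\<ge>c * s_seq \<alpha> n.
    prob (exceeds {1..n} (x / 2) x) \<le> \<epsilon> * (n * V x)"
proof -
  define \<kappa> where "\<kappa> = (1 + 1 / c\<^sup>2) / 2"
  have "1 / c\<^sup>2 < 1" using c by (simp add: one_less_power)
  then have \<kappa>: "1 / c\<^sup>2 < \<kappa>" "\<kappa> < 1" by (auto simp: \<kappa>_def)
  then have \<kappa>0: "0 < \<kappa>" by (meson less_trans zero_less_power zero_less_divide_1_iff c zero_less_one)
  define A where "A = ln ((1 + \<kappa>) / (2 * \<kappa>))"
  have "1 < (1 + \<kappa>) / (2 * \<kappa>)" using \<kappa> \<kappa>0 by (simp add: field_simps)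
  then have A: "0 < A" "\<kappa> * exp A = (1 + \<kappa>) / 2" using \<kappa>0 by (auto simp: A_def)
  define \<beta> where "\<beta> = \<alpha> + 1"
  have \<beta>: "\<alpha> < \<beta>" "0 < \<beta>" using \<alpha> by (auto simp: \<beta>_def)
  obtain c1 x1 where c1: "0 < c1" "0 < x1" "\<And>x. x1 \<le> x \<Longrightarrow> c1 * x powr (-\<beta>) \<le> V x"
    using V_ge_power[OF \<beta>(1)] by blast
  obtain x0 where x0: "0 < x0" "\<And>t s. x0 \<le> t \<Longrightarrow> 1 \<le> s \<Longrightarrow> V t \<le> (2 * s) powr \<beta> * V (t * s)"
    using V_potter_lower[OF \<beta>(1)] by blast
  have "\<forall>\<^sub>F x in at_top. 2 * x0 * (\<beta> * ln x - ln c1) \<le> A * x"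
    using A by real_asymp
  then obtain x2 where x2: "\<And>x. x2 \<le> x \<Longrightarrow> 2 * x0 * (\<beta> * ln x - ln c1) \<le> A * x"
    unfolding eventually_at_top_linorder by blast
  have "\<forall>\<^sub>F l in at_top. (4 * l / A) powr \<beta> * exp (- l / 2) \<le> 1"
    using A by real_asymp
  moreover have "\<forall>\<^sub>F l in at_top. exp (- ((1 - \<kappa>) / 2) * l + (1 + 8 powr \<beta>)) \<le> \<epsilon>"
    using \<kappa> \<epsilon> by real_asymp
  ultimately have "\<forall>\<^sub>F l in at_top. (4 * l / A) powr \<beta> * exp (- l / 2) \<le> 1 \<and>
     exp (- ((1 - \<kappa>) / 2) * l + (1 + 8 powr \<beta>)) \<le> \<epsilon> \<and> A \<le> 2 * l \<and> 0 < l"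
    using eventually_ge_at_top[of "A / 2"] eventually_gt_at_top[of 0] by eventually_elim auto
  then obtain l0 where l0: "\<And>l. l0 \<le> l \<Longrightarrow> (4 * l / A) powr \<beta> * exp (- l / 2) \<le> 1 \<and>
     exp (- ((1 - \<kappa>) / 2) * l + (1 + 8 powr \<beta>)) \<le> \<epsilon> \<and> A \<le> 2 * l \<and> 0 < l"
    unfolding eventually_at_top_linorder by blast
  define R where "R = max 1 (max (exp (l0 / 2)) (max (4 * x0) (max x1 x2)))"
  have R: "1 \<le> R" "exp (l0 / 2) \<le> R" "4 * x0 \<le> R" "x1 \<le> R" "x2 \<le> R" by (auto simp: R_def)
  have c0: "0 < c" using c by simp
  show ?thesis
    using nV_ge_gaussian[OF c0 \<kappa>(1)] s_seq_ge[OF c0 \<alpha>, of R]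
  proof (eventually_elim, intro allI impI)
    case (elim n)
    fix x assume x: "c * s_seq \<alpha> n \<le> x"
    have n: "1 \<le> real n" "0 < real n" "1 \<le> sqrt n" using elim by auto
    have Rx: "R * sqrt n \<le> x" using elim x by linarith
    have "R * 1 \<le> R * sqrt n" using n R by (intro mult_left_mono) auto
    with Rx R x0(1) have xR: "4 * x0 \<le> x" "x1 \<le> x" "x2 \<le> x" "0 < x" by linarith+
    define l where "l = - ln (n * V x)"
    have nV: "0 < n * V x" using n V_pos by auto
    then have el: "exp (-l) = n * V x" "exp l = 1 / (n * V x)"
      by (auto simp: l_def exp_minus field_simps)
    have "exp (- \<kappa> * x\<^sup>2 / (2 * n)) \<le> exp (-l)" unfolding el using elim x by auto
    then have lam_up: "l * n / x\<^sup>2 \<le> \<kappa> / 2" using n xR by (simp add: field_simps)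
    have "n * V x \<le> 1 / R\<^sup>2" using n R Rx by (intro nV_small) auto
    also have "\<dots> \<le> 1 / (exp (l0 / 2))\<^sup>2" using R by (intro divide_left_mono power_mono) auto
    also have "\<dots> = exp (- l0)" by (simp add: exp_minus inverse_eq_divide flip: exp_of_nat_mult)
    finally have "l0 \<le> l" unfolding el(1)[symmetric] by simp
    from l0[OF this] have l: "(4 * l / A) powr \<beta> * exp (- l / 2) \<le> 1"
      "exp (- ((1 - \<kappa>) / 2) * l + (1 + 8 powr \<beta>)) \<le> \<epsilon>" "A \<le> 2 * l" "0 < l" by auto
    have "c1 * x powr (-\<beta>) \<le> exp (-l)"
      using c1(3)[OF xR(2)] mult_right_mono[of 1 "real n" "V x"] n V_nonneg[of x] unfolding el by simp
    then have "ln (c1 * x powr (-\<beta>)) \<le> -l"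
      using c1(1) xR(4) by (subst ln_exp[symmetric], subst ln_le_cancel_iff) auto
    then have "l \<le> \<beta> * ln x - ln c1" using c1 xR by (simp add: ln_mult ln_powr)
    then have "2 * x0 * l \<le> 2 * x0 * (\<beta> * ln x - ln c1)" using x0 by (intro mult_left_mono) auto
    then have ratio: "x0 \<le> A * x / (2 * l)" using x2[OF xR(3)] l by (simp add: field_simps)
    define h where "h = 2 * l / x"
    have h: "0 < h" "h * (x / 2) = l" "A / h = A * x / (2 * l)" using l xR by (auto simp: h_def)
    define q where "q = h\<^sup>2 / 2 * exp A + exp (h * (x / 2) / 2) * V (A / h) + exp (h * (x / 2)) * V (x / 2 / 2)"
    have q0: "0 \<le> q" unfolding q_def using V_nonneg by auto
    have "prob (exceeds {1..n} (x / 2) x) \<le> exp (- h * x + n * q)"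
      using mgf_large[of h "x / 2" A] h xR A q0 by (intro chernoff) (auto simp: q_def)
    also have "\<dots> \<le> exp (- 2 * l + ((1 + \<kappa>) / 2 * l + 1 + 8 powr \<beta>))"
    proof -
      have "n * (h\<^sup>2 / 2 * exp A) = 2 * (l * n / x\<^sup>2) * (l * exp A)"
        by (simp add: h_def power2_eq_square)
      also have "\<dots> \<le> 2 * (\<kappa> / 2) * (l * exp A)"
        using lam_up l by (intro mult_right_mono mult_left_mono) auto
      also have "\<dots> = (1 + \<kappa>) / 2 * l" unfolding A(2)[symmetric] by simp
      finally have 1: "n * (h\<^sup>2 / 2 * exp A) \<le> (1 + \<kappa>) / 2 * l" .
      have "V (A * x / (2 * l)) \<le> (2 * (2 * l / A)) powr \<beta> * V (A * x / (2 * l) * (2 * l / A))"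
        using ratio l A by (intro x0(2)) auto
      also have "A * x / (2 * l) * (2 * l / A) = x" using l A by simp
      finally have "n * (exp (l / 2) * V (A / h)) \<le> n * (exp (l / 2) * ((4 * l / A) powr \<beta> * V x))"
        unfolding h by (intro mult_left_mono) auto
      also have "\<dots> = exp (l / 2) * exp (-l) * (4 * l / A) powr \<beta>" unfolding el(1) by simp
      also have "exp (l / 2) * exp (-l) = exp (- l / 2)" by (simp add: exp_add[symmetric])
      finally have 2: "n * (exp (l / 2) * V (A / h)) \<le> 1" using l(1) by (simp add: mult.commute)
      have "V (x / 4) \<le> (2 * 4) powr \<beta> * V (x / 4 * 4)"
        using xR by (intro x0(2)) auto
      then have "n * (exp l * V (x / 4)) \<le> n * (exp l * (8 powr \<beta> * V x))"
        by (intro mult_left_mono) auto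
      also have "\<dots> = 8 powr \<beta>" using n(2) V_pos[of x] by (simp add: el)
      finally have 3: "n * (exp l * V (x / 4)) \<le> 8 powr \<beta>" .
      have "n * q = n * (h\<^sup>2 / 2 * exp A) + n * (exp (l / 2) * V (A / h)) + n * (exp l * V (x / 4))"
        unfolding q_def h(2) by (simp add: distrib_left)
      moreover have "- h * x = - 2 * l" using xR by (simp add: h_def)
      ultimately show ?thesis using 1 2 3 by simp
    qed
    also have "\<dots> = exp (- ((1 - \<kappa>) / 2) * l + (1 + 8 powr \<beta>)) * exp (-l)"
      unfolding exp_add[symmetric] by (intro arg_cong[where f=exp]) (simp add: field_simps)
    also have "\<dots> \<le> \<epsilon> * (n * V x)" using l(2) unfolding el(1) using nV by (intro mult_right_mono) auto
    finally show "prob (exceeds {1..n} (x / 2) x) \<le> \<epsilon> * (n * V x)" .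
  qed
qed

text \<open>
  Either some summand exceeds \<open>x / 2\<close>, and \<open>prob_with_jump_le\<close> applies with \<open>a = e x\<close>, or the sum
  equals the one censored at \<open>x / 2\<close>. The bound covers every censoring level at once.
\<close>
lemma large_deviation_upper:
  assumes c: "1 < c" and \<epsilon>: "0 < \<epsilon>"
  shows "\<forall>\<^sub>F n in sequentially. \<forall>x\<ge>c * s_seq \<alpha> n. \<forall>m\<ge>x.
    prob (exceeds {1..n} m x) \<le> (1 + \<epsilon>) * (n * V x)"
proof -
  define \<eta> where "\<eta> = \<epsilon> / 3"
  have \<eta>: "0 < \<eta>" using \<epsilon> by (simp add: \<eta>_def)
  obtain e x1 where e: "0 < e" "e < 1"
    "\<forall>x\<ge>x1. V ((1 - e) * x) \<le> (1 + \<eta>) * V x"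
    "\<forall>x\<ge>x1. (1 - \<eta>) * V x \<le> V ((1 + e) * x)"
    using V_near_constant[OF \<eta>] by blast
  define \<beta> where "\<beta> = \<alpha> + 1"
  have \<beta>: "\<alpha> < \<beta>" "0 < \<beta>" using \<alpha> by (auto simp: \<beta>_def)
  obtain x0 where x0: "0 < x0" "\<And>t s. x0 \<le> t \<Longrightarrow> 1 \<le> s \<Longrightarrow> V t \<le> (2 * s) powr \<beta> * V (t * s)"
    using V_potter_lower[OF \<beta>(1)] by blast
  have "\<forall>\<^sub>F R in at_top. 4 powr \<beta> / (e * R)\<^sup>2 \<le> \<eta>" using e \<eta> by real_asymp
  then obtain R0 where R0: "\<And>R. R0 \<le> R \<Longrightarrow> 4 powr \<beta> / (e * R)\<^sup>2 \<le> \<eta>"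
    unfolding eventually_at_top_linorder by blast
  define R where "R = max 1 (max R0 (max (2 * x0) x1))"
  have R: "1 \<le> R" "R0 \<le> R" "2 * x0 \<le> R" "x1 \<le> R" by (auto simp: R_def)
  have c0: "0 < c" using c by simp
  show ?thesis
    using fuk_nagaev[OF c \<eta>] s_seq_ge[OF c0 \<alpha>, of R]
  proof (eventually_elim, intro allI impI)
    case (elim n)
    fix x m assume x: "c * s_seq \<alpha> n \<le> x" and m: "x \<le> m"
    have n: "1 \<le> real n" "0 < real n" "1 \<le> sqrt n" using elim by auto
    have Rx: "R * sqrt n \<le> x" using elim x by linarith
    have "R * 1 \<le> R * sqrt n" using n R by (intro mult_left_mono) auto
    with Rx R x0(1) have xR: "2 * x0 \<le> x" "x1 \<le> x" "0 < x" by linarith+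
    define p where "p = n / (e * x)\<^sup>2"
    have "prob {\<omega> \<in> space P. csum {1..n} m \<omega> > x \<and> (\<exists>j\<in>{1..n}. X j \<omega> > x / 2)}
      \<le> n * ((if x - e * x < m then V (x - e * x) else 0) + V (x / 2) * p)"
    proof (rule prob_with_jump_le)
      fix j assume "j \<in> {1..n}"
      have "prob (exceeds ({1..n} - {j}) m (e * x)) \<le> card ({1..n} - {j}) / (e * x)\<^sup>2"
        using e xR m by (intro csum_upper_chebyshev) auto
      also have "\<dots> \<le> p" unfolding p_def using card_mono[of "{1..n}" "{1..n} - {j}"]
        by (intro divide_right_mono) auto
      finally show "prob (exceeds ({1..n} - {j}) m (e * x)) \<le> p" .
    qed
    also have "\<dots> \<le> n * ((1 + \<eta>) * V x + \<eta> * V x)"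
    proof (intro mult_left_mono add_mono)
      show "(if x - e * x < m then V (x - e * x) else 0) \<le> (1 + \<eta>) * V x"
        using e(3)[rule_format, OF xR(2)] V_nonneg[of x] \<eta> by (simp add: algebra_simps)
      have "V (x / 2) \<le> (2 * 2) powr \<beta> * V (x / 2 * 2)" using xR by (intro x0(2)) auto
      then have "V (x / 2) * p \<le> 4 powr \<beta> * V x * p" unfolding p_def by (intro mult_right_mono) auto
      also have "\<dots> \<le> 4 powr \<beta> * V x * (n / (e * (R * sqrt n))\<^sup>2)"
        unfolding p_def using Rx e R n V_nonneg xR
        by (intro mult_left_mono divide_left_mono power_mono mult_nonneg_nonneg) auto
      also have "\<dots> = 4 powr \<beta> / (e * R)\<^sup>2 * V x" using n by (simp add: power_mult_distrib)
      also have "\<dots> \<le> \<eta> * V x" using R0[OF R(2)] V_nonneg by (intro mult_right_mono) auto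
      finally show "V (x / 2) * p \<le> \<eta> * V x" .
    qed auto
    finally have "prob {\<omega> \<in> space P. csum {1..n} m \<omega> > x \<and> (\<exists>j\<in>{1..n}. X j \<omega> > x / 2)} \<le> n * ((1 + \<eta>) * V x + \<eta> * V x)" .
    moreover have "prob (exceeds {1..n} (x / 2) x) \<le> \<eta> * (n * V x)" using elim x by auto
    ultimately have "prob (exceeds {1..n} m x) \<le> n * ((1 + \<eta>) * V x + \<eta> * V x) + \<eta> * (n * V x)"
      using prob_split_jump[of "x / 2" m "{1..n}" x] m xR by auto
    also have "\<dots> = (1 + \<epsilon>) * (n * V x)" by (simp add: \<eta>_def algebra_simps)
    finally show "prob (exceeds {1..n} m x) \<le> (1 + \<epsilon>) * (n * V x)" .
  qed
qed

text \<open>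
  The jump overshoots \<open>x\<close> by \<open>K sqrt n\<close>, which the rest does not undo except with a probability of
  order \<open>1 / K\<^sup>2\<close>. Since \<open>x\<close> is a large multiple of \<open>sqrt n\<close>, the overshoot hardly changes
  \<open>V\<close>.
\<close>
lemma jump_event_lower:
  assumes \<epsilon>: "0 < \<epsilon>"
  obtains K R where "0 < K" "0 < R"
    "\<And>(n::nat) x m. 1 \<le> n \<Longrightarrow> R * sqrt n \<le> x \<Longrightarrow> x + K * sqrt n \<le> m \<Longrightarrow>
      (1 - \<epsilon>) * (n * V x) \<le> prob (jump_event n m (x + K * sqrt n) (K * sqrt n))"
proof -
  define \<eta> where "\<eta> = min (1 / 3) (\<epsilon> / 3)"
  have \<eta>: "0 < \<eta>" "\<eta> \<le> 1 / 3" "3 * \<eta> \<le> \<epsilon>" using \<epsilon> by (auto simp: \<eta>_def)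
  obtain e x1 where e: "0 < e" "e < 1"
    "\<forall>x\<ge>x1. V ((1 - e) * x) \<le> (1 + \<eta>) * V x"
    "\<forall>x\<ge>x1. (1 - \<eta>) * V x \<le> V ((1 + e) * x)"
    using V_near_constant[OF \<eta>(1)] by blast
  define k where "k = 1 / sqrt \<eta>"
  have k: "0 < k" "1 / k\<^sup>2 = \<eta>" using \<eta> by (auto simp: k_def power_divide)
  define K where "K = k + 1"
  define R where "R = max (max 1 k) (max x1 (K / e))"
  have R: "1 \<le> R" "k \<le> R" "x1 \<le> R" "K / e \<le> R" by (auto simp: R_def)
  have "(1 - \<epsilon>) * (n * V x) \<le> prob (jump_event n m (x + K * sqrt n) (K * sqrt n))"
    if n1: "1 \<le> n" and Rx: "R * sqrt n \<le> x" and m: "x + K * sqrt n \<le> m" for n :: nat and x m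
  proof -
    have n: "1 \<le> real n" "0 < real n" "1 \<le> sqrt n" using n1 by auto
    have "R * 1 \<le> R * sqrt n" using n R by (intro mult_left_mono) auto
    with Rx R have xR: "x1 \<le> x" "0 < x" by linarith+
    have "sqrt n \<le> R * sqrt n" using R n by simp
    then have mn: "sqrt n \<le> m" using m Rx k n by (smt (verit) K_def mult_nonneg_nonneg)
    then have m0: "0 < m" using n by linarith
    have nm: "n / m \<le> sqrt n"
    proof -
      have "sqrt n * sqrt n \<le> sqrt n * m" using mn n by (intro mult_left_mono) auto
      then show ?thesis using m0 by (simp add: field_simps)
    qed
    let ?u = "x + K * sqrt n"
    have "K * sqrt n \<le> e * x"
    proof -
      have "K / e * sqrt n \<le> R * sqrt n" using R n by (intro mult_right_mono) auto
      then have "K / e * sqrt n \<le> x" using Rx by linarith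
      then show ?thesis using e by (simp add: field_simps)
    qed
    then have "V ((1 + e) * x) \<le> V ?u" by (intro V_antimono) (simp add: algebra_simps)
    then have Vu: "(1 - \<eta>) * V x \<le> V ?u" using e(4)[rule_format, OF xR(1)] by linarith
    have "n * V ?u \<le> 1 / k\<^sup>2"
    proof (rule nV_small)
      have "k * sqrt n \<le> R * sqrt n" using R n by (intro mult_right_mono) auto
      moreover have "0 \<le> K * sqrt n" using k by (simp add: K_def)
      ultimately show "k * sqrt n \<le> ?u" using Rx by linarith
    qed (use n1 k in auto)
    then have nVu: "n * V ?u \<le> \<eta>" using k by simp
    have na: "n / (k * sqrt n)\<^sup>2 = \<eta>" using n k by (simp add: power_mult_distrib)
    have "(1 - \<epsilon>) * (n * V x) \<le> ((1 - \<eta>) * (1 - 2 * \<eta>)) * (n * V x)"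
    proof (intro mult_right_mono)
      have "(1 - \<eta>) * (1 - 2 * \<eta>) = 1 - 3 * \<eta> + 2 * (\<eta> * \<eta>)" by (simp add: algebra_simps)
      then show "1 - \<epsilon> \<le> (1 - \<eta>) * (1 - 2 * \<eta>)" using \<eta> by (smt (verit) mult_nonneg_nonneg)
    qed (use V_nonneg in auto)
    also have "\<dots> = n * ((1 - \<eta>) * V x) * (1 - 2 * \<eta>)" by simp
    also have "\<dots> \<le> n * V ?u * (1 - n / (k * sqrt n)\<^sup>2 - n * V ?u)"
      using Vu nVu \<eta> V_nonneg n unfolding na by (intro mult_mono mult_left_mono) auto
    also have "\<dots> \<le> prob (jump_event n m ?u (k * sqrt n + sqrt n))"
      using m0 k n nm by (intro prob_jump_event) auto
    also have "k * sqrt n + sqrt n = K * sqrt n" by (simp add: K_def algebra_simps)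
    finally show ?thesis .
  qed
  then show ?thesis using k R by (intro that[of K R]) (auto simp: K_def)
qed

lemma prob_csum_ge_jump_event:
  assumes "x + k \<le> m"
  shows "prob (jump_event n m (x + k) k) \<le> prob (exceeds {1..n} m x)"
proof (rule finite_measure_mono)
  show "jump_event n m (x + k) k \<subseteq> exceeds {1..n} m x"
    using jump_event_subset[OF assms, of n k] by simp
  have [measurable]: "csum {1..n} m \<in> borel_measurable P" by (intro measurable_csum) auto
  show "exceeds {1..n} m x \<in> events" by measurable
qed

end

section \<open>The standard normal tail\<close>

text \<open>
  The constant of the Mills-type inequality \<open>mills_lower\<close>, which results from
  integrating the density over an interval of length \<open>1 / (1 + z)\<close> to the right of \<open>z\<close>.
\<close>
abbreviation mills_const :: real where "mills_const \<equiv> exp (3 / 2)"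

lemma std_normal_tail_eq_integral:
  "std_normal_tail z = (\<integral>t. std_normal_density t * indicator {z<..} t \<partial>lborel)"
proof -
  interpret N: prob_space std_normal_distribution by (rule real_distribution.axioms(1)) (rule real_dist_normal_dist)
  have "cdf std_normal_distribution z = measure std_normal_distribution {..z}" by (simp add: cdf_def)
  also have "\<dots> = 1 - measure std_normal_distribution {z<..}"
    using N.prob_compl[of "{z<..}"] by (simp add: Compl_eq_Diff_UNIV[symmetric])
  finally have "std_normal_tail z = measure std_normal_distribution {z<..}"
    by (simp add: std_normal_tail_def)
  also have "\<dots> = (\<integral>t. indicator {z<..} t \<partial>std_normal_distribution)" by simp
  also have "\<dots> = (\<integral>t. std_normal_density t * indicator {z<..} t \<partial>lborel)"
    by (subst integral_density) auto
  finally show ?thesis .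
qed

lemma integrable_std_normal_indicator [simp]:
  "A \<in> sets borel \<Longrightarrow> integrable lborel (\<lambda>t. std_normal_density t * indicator A t)"
  using integrable_normal_density[of 1 0] by (intro integrable_real_mult_indicator) auto

lemma std_normal_tail_mono: "z \<le> z' \<Longrightarrow> std_normal_tail z' \<le> std_normal_tail z"
  unfolding std_normal_tail_eq_integral
  by (intro integral_mono integrable_std_normal_indicator) (auto simp: indicator_def)

lemma std_normal_density_shift:
  "std_normal_density (z + s) = std_normal_density z * exp (- z * s - s\<^sup>2 / 2)"
proof -
  have "- (z + s)\<^sup>2 / 2 = - z\<^sup>2 / 2 + (- z * s - s\<^sup>2 / 2)"
    by (simp add: power2_eq_square field_simps)
  then show ?thesis by (simp add: std_normal_density_def exp_add[symmetric])
qed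

lemma std_normal_tail_le_exp:
  assumes "0 \<le> z" shows "std_normal_tail z \<le> exp (- z\<^sup>2 / 2)"
proof -
  have "std_normal_tail z \<le> (\<integral>t. exp (- z\<^sup>2 / 2) * normal_density z 1 t \<partial>lborel)"
    unfolding std_normal_tail_eq_integral
  proof (intro integral_mono)
    fix t :: real
    show "std_normal_density t * indicator {z<..} t \<le> exp (- z\<^sup>2 / 2) * normal_density z 1 t"
    proof (cases "z < t")
      case True
      have "0 \<le> z * (t - z)" using assms True by simp
      then have "- t\<^sup>2 / 2 \<le> - z\<^sup>2 / 2 + - (t - z)\<^sup>2 / 2" by (simp add: power2_eq_square field_simps)
      then have "exp (- t\<^sup>2 / 2) \<le> exp (- z\<^sup>2 / 2) * exp (- (t - z)\<^sup>2 / 2)"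
        unfolding exp_add[symmetric] by simp
      then show ?thesis using True by (simp add: normal_density_def field_simps)
    qed simp
  qed auto
  then show ?thesis by simp
qed

lemma mills_lower:
  assumes "0 \<le> z" shows "std_normal_density z \<le> mills_const * (1 + z) * std_normal_tail z"
proof -
  define s where "s = 1 / (1 + z)"
  have s: "0 < s" "s \<le> 1" "z * s \<le> 1" using assms by (auto simp: s_def field_simps)
  have "std_normal_density z * exp (- 3 / 2) \<le> std_normal_density (z + s)"
    unfolding std_normal_density_shift
  proof (intro mult_left_mono)
    have "s\<^sup>2 \<le> 1" using s by (simp add: power_le_one)
    then show "exp (- 3 / 2) \<le> exp (- z * s - s\<^sup>2 / 2)" using s by simp
  qed auto
  then have "s * (std_normal_density z * exp (- 3 / 2)) \<le> s * std_normal_density (z + s)"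
    using s by (intro mult_left_mono) auto
  also have "\<dots> = (\<integral>t. std_normal_density (z + s) * indicator {z<..z + s} t \<partial>lborel)"
    using s by simp
  also have "\<dots> \<le> std_normal_tail z"
    unfolding std_normal_tail_eq_integral
  proof (intro integral_mono)
    fix t :: real
    show "std_normal_density (z + s) * indicator {z<..z + s} t \<le> std_normal_density t * indicator {z<..} t"
    proof (cases "t \<in> {z<..z + s}")
      case True
      then have "t\<^sup>2 \<le> (z + s)\<^sup>2" using assms by (intro power_mono) auto
      then show ?thesis using True by (simp add: std_normal_density_def divide_right_mono)
    qed (auto simp: indicator_def)
  qed (use s in \<open>auto intro!: integrable_mult_right\<close>)
  finally have "s * std_normal_density z * exp (- 3 / 2) \<le> std_normal_tail z" by simp
  then have "(1 + z) * mills_const * (s * std_normal_density z * exp (- 3 / 2)) \<le> (1 + z) * mills_const * std_normal_tail z"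
    using assms by (intro mult_left_mono) auto
  also have "(1 + z) * mills_const * (s * std_normal_density z * exp (- 3 / 2)) = std_normal_density z"
    using assms by (simp add: s_def field_simps flip: exp_add)
  finally show ?thesis by (simp add: mult_ac)
qed

lemma std_normal_tail_pos: "0 < std_normal_tail z"
proof -
  have "0 < std_normal_density (max 0 z)" by (rule normal_density_pos) simp
  also have "\<dots> \<le> mills_const * (1 + max 0 z) * std_normal_tail (max 0 z)" by (rule mills_lower) simp
  finally have "0 < mills_const * (1 + max 0 z) * std_normal_tail (max 0 z)" .
  moreover have "0 < mills_const * (1 + max 0 z)" by (intro mult_pos_pos add_pos_nonneg) auto
  ultimately have "0 < std_normal_tail (max 0 z)" by (rule zero_less_mult_pos)
  also have "\<dots> \<le> std_normal_tail z" by (rule std_normal_tail_mono) simp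
  finally show ?thesis .
qed

lemma std_normal_tail_shift:
  assumes "0 \<le> z" "0 \<le> s"
  shows "(1 - mills_const * s * (1 + z)) * std_normal_tail z \<le> std_normal_tail (z + s)"
proof -
  have integrable_shift: "integrable lborel (\<lambda>t. std_normal_density t * indicator {z + s<..} t)"
    "integrable lborel (\<lambda>t. std_normal_density z * indicator {z<..z + s} t)"
    "integrable lborel (\<lambda>t. std_normal_density t * indicator {z<..} t)"
    using assms by (simp_all del: indicator_simps)
  have "std_normal_tail z \<le> (\<integral>t. std_normal_density t * indicator {z + s<..} t + std_normal_density z * indicator {z<..z + s} t \<partial>lborel)"
    unfolding std_normal_tail_eq_integral
  proof (intro integral_mono)
    fix t :: real
    show "std_normal_density t * indicator {z<..} t \<le> std_normal_density t * indicator {z + s<..} t + std_normal_density z * indicator {z<..z + s} t"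
    proof (cases "t \<in> {z<..z + s}")
      case True
      then have "z\<^sup>2 \<le> t\<^sup>2" using assms by (intro power_mono) auto
      then show ?thesis using True by (simp add: std_normal_density_def divide_right_mono)
    qed (use assms in \<open>auto simp: indicator_def\<close>)
  qed (use integrable_shift in auto)
  also have "\<dots> = std_normal_tail (z + s) + std_normal_density z * s"
    unfolding std_normal_tail_eq_integral using assms
    by (subst Bochner_Integration.integral_add[OF integrable_shift(1,2)]) simp
  also have "\<dots> \<le> std_normal_tail (z + s) + mills_const * (1 + z) * std_normal_tail z * s"
    using mills_lower assms by (intro add_left_mono mult_right_mono) auto
  finally show ?thesis by (simp add: algebra_simps)
qed

lemma integral_exp_left_half_line:
  assumes "0 < (r::real)"
  shows "integrable lborel (\<lambda>t. exp ((t - z) / r) * indicator {..z} t)"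
    and "(\<integral>t. exp ((t - z) / r) * indicator {..z} t \<partial>lborel) = r"
proof -
  have *: "has_bochner_integral lborel (\<lambda>t. exp (- t / r) * indicator {0..} t) (0 - - r)"
  proof (intro has_bochner_integral_nn_integral)
    have "(\<integral>\<^sup>+t. ennreal (exp (- t / r)) * indicator {0..} t \<partial>lborel) = ennreal (0 - (- r * exp (- 0 / r)))"
    proof (rule nn_integral_FTC_atLeast[where F = "\<lambda>t. - r * exp (- t / r)"])
      show "((\<lambda>t. - r * exp (- t / r)) \<longlongrightarrow> 0) at_top" using assms by real_asymp
    qed (use assms in \<open>auto intro!: derivative_eq_intros\<close>)
    then show "(\<integral>\<^sup>+t. ennreal (exp (- t / r) * indicator {0..} t) \<partial>lborel) = ennreal (0 - - r)"
      by (simp add: ennreal_mult ennreal_indicator)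
  qed (use assms in auto)
  have eq: "(\<lambda>t. exp (- (z + - 1 * t) / r) * indicator {0..} (z + - 1 * t)) = (\<lambda>t. exp ((t - z) / r) * indicator {..z} t :: real)"
    by (auto simp: indicator_def fun_eq_iff)
  show "integrable lborel (\<lambda>t. exp ((t - z) / r) * indicator {..z} t)"
    using lborel_integrable_real_affine[OF integrable.intros[OF *], of "-1" z] unfolding eq by simp
  show "(\<integral>t. exp ((t - z) / r) * indicator {..z} t \<partial>lborel) = r"
    using lborel_integral_real_affine[of "-1" "\<lambda>t. exp (- t / r) * indicator {0..} t" z]
      has_bochner_integral_integral_eq[OF *] unfolding eq by simp
qed

text \<open>
  To the left of \<open>z\<close> the density grows at most at the exponential rate \<open>z\<close>, which the weight with
  rate \<open>1 / r \<ge> 2 z\<close> beats.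
\<close>
lemma gaussian_exp_left:
  assumes z: "0 \<le> z" and r: "0 < r" "(1 + z) * r \<le> 1 / 2"
  shows "integrable lborel (\<lambda>t. std_normal_density t * (exp ((t - z) / r) * indicator {..z} t))"
    and "(\<integral>t. std_normal_density t * (exp ((t - z) / r) * indicator {..z} t) \<partial>lborel)
      \<le> 2 * mills_const * ((1 + z) * r) * std_normal_tail z"
proof -
  have bound: "std_normal_density t * (exp ((t - z) / r) * indicator {..z} t)
    \<le> std_normal_density z * (exp ((t - z) / (2 * r)) * indicator {..z} t)" for t
  proof (cases "t \<le> z")
    case True
    have "std_normal_density t = std_normal_density z * exp (- z * (t - z) - (t - z)\<^sup>2 / 2)"
      using std_normal_density_shift[of z "t - z"] by simp
    then have "std_normal_density t * exp ((t - z) / r) =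
        std_normal_density z * exp (- z * (t - z) - (t - z)\<^sup>2 / 2 + (t - z) / r)"
      by (simp only: exp_add mult.assoc)
    also have "\<dots> \<le> std_normal_density z * exp ((t - z) / (2 * r))"
    proof (intro mult_left_mono)
      define q y where "q = 1 / (2 * r)" and "y = z - t"
      have "z * r \<le> 1 / 2" using r by (simp add: distrib_right)
      then have "z \<le> q" using r by (simp add: q_def field_simps)
      then have 1: "z * y \<le> q * y" using True by (intro mult_right_mono) (auto simp: y_def)
      have 2: "- z * (t - z) = z * y" "(t - z)\<^sup>2 / 2 = y\<^sup>2 / 2"
        by (simp_all add: y_def algebra_simps power2_eq_square)
      have 3: "(t - z) / r = - (2 * (q * y))" "(t - z) / (2 * r) = - (q * y)"
        using r by (simp_all add: y_def q_def field_simps)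
      have "0 \<le> y\<^sup>2 / 2" by simp
      with 1 have "- z * (t - z) - (t - z)\<^sup>2 / 2 + (t - z) / r \<le> (t - z) / (2 * r)"
        unfolding 2 3 by linarith
      then show "exp (- z * (t - z) - (t - z)\<^sup>2 / 2 + (t - z) / r) \<le> exp ((t - z) / (2 * r))" by simp
    qed auto
    finally show ?thesis using True by simp
  qed simp
  have int: "integrable lborel (\<lambda>t. std_normal_density z * (exp ((t - z) / (2 * r)) * indicator {..z} t))"
    using integral_exp_left_half_line(1)[of "2 * r" z] r by (intro integrable_mult_right) auto
  show 1: "integrable lborel (\<lambda>t. std_normal_density t * (exp ((t - z) / r) * indicator {..z} t))"
    by (rule Bochner_Integration.integrable_bound[OF int])
       (auto intro!: AE_I2 order_trans[OF _ bound] simp: abs_mult)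
  have "(\<integral>t. std_normal_density t * (exp ((t - z) / r) * indicator {..z} t) \<partial>lborel) \<le> std_normal_density z * (2 * r)"
    using integral_mono[OF 1 int bound] integral_exp_left_half_line(2)[of "2 * r" z] r by simp
  also have "\<dots> \<le> mills_const * (1 + z) * std_normal_tail z * (2 * r)"
    using mills_lower[OF z] r by (intro mult_right_mono) auto
  finally show "(\<integral>t. std_normal_density t * (exp ((t - z) / r) * indicator {..z} t) \<partial>lborel)
      \<le> 2 * mills_const * ((1 + z) * r) * std_normal_tail z" by (simp add: mult_ac)
qed

section \<open>The logistic function\<close>

text \<open>
  The smooth substitute for the indicator of the positive half-line. It is chosen for two
  properties: its derivatives are bounded by the function itself, and it decays exponentially
  rather than faster, so that a shift changes it by a bounded factor. Both are needed to control
  \<^emph>\<open>relative\<close> errors.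
\<close>
definition logistic :: "real \<Rightarrow> real" where
  "logistic t = 1 / (1 + exp (- t))"

lemma logistic_pos: "0 < logistic t" and logistic_le_1: "logistic t \<le> 1"
  by (auto simp: logistic_def add_pos_pos field_simps)

lemma measurable_logistic [measurable]: "logistic \<in> borel_measurable borel"
  unfolding logistic_def by measurable

lemma logistic_mono: "s \<le> t \<Longrightarrow> logistic s \<le> logistic t"
  unfolding logistic_def by (intro divide_left_mono) (auto intro!: mult_pos_pos add_pos_pos)

lemma logistic_le_exp: "logistic t \<le> exp t"
proof -
  have "1 \<le> exp t * (1 + exp (-t))" by (simp add: distrib_left flip: exp_add)
  then show ?thesis unfolding logistic_def by (subst pos_divide_le_eq) (auto simp: add_pos_pos)
qed

lemma logistic_shift_le: "logistic (u + v) \<le> exp (max 0 v) * logistic u"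
proof -
  have "1 + exp (- u) \<le> exp (max 0 v) * (1 + exp (- (u + v)))"
  proof -
    have "exp (- u) \<le> exp (max 0 v + - (u + v))" by simp
    moreover have "1 \<le> exp (max 0 v)" by simp
    ultimately have "1 + exp (- u) \<le> exp (max 0 v) + exp (max 0 v + - (u + v))" by linarith
    then show ?thesis by (simp only: exp_add distrib_left mult_1_right)
  qed
  then show ?thesis unfolding logistic_def by (simp add: field_simps add_pos_pos)
qed

definition logistic' :: "real \<Rightarrow> real" where "logistic' t = logistic t * (1 - logistic t)"
definition logistic'' :: "real \<Rightarrow> real" where "logistic'' t = logistic t * (1 - logistic t) * (1 - 2 * logistic t)"
definition logistic''' :: "real \<Rightarrow> real" where
  "logistic''' t = logistic t * (1 - logistic t) * (1 - 6 * logistic t + 6 * (logistic t)\<^sup>2)"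

lemma logistic_deriv: "(logistic has_real_derivative logistic' t) (at t)"
proof -
  have "1 + exp (- t) \<noteq> 0" using add_pos_pos[of 1 "exp (-t)"] by simp
  then have "((\<lambda>t. 1 / (1 + exp (- t))) has_real_derivative exp (- t) / (1 + exp (- t))\<^sup>2) (at t)"
    by (auto intro!: derivative_eq_intros simp: power2_eq_square)
  moreover have "exp (- t) / (1 + exp (- t))\<^sup>2 = logistic' t"
    using \<open>1 + exp (- t) \<noteq> 0\<close> by (simp add: logistic'_def logistic_def field_simps power2_eq_square)
  ultimately show ?thesis unfolding logistic_def[abs_def] by simp
qed

lemma logistic'_deriv: "(logistic' has_real_derivative logistic'' t) (at t)"
  unfolding logistic'_def[abs_def]
  by (auto intro!: derivative_eq_intros logistic_deriv simp: logistic'_def logistic''_def algebra_simps)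

lemma logistic''_deriv: "(logistic'' has_real_derivative logistic''' t) (at t)"
  unfolding logistic''_def[abs_def]
  by (auto intro!: derivative_eq_intros logistic_deriv
      simp: logistic'_def logistic'''_def power2_eq_square algebra_simps)

lemma abs_logistic_derivs:
  "\<bar>logistic' t\<bar> \<le> logistic t" "\<bar>logistic'' t\<bar> \<le> logistic t" "\<bar>logistic''' t\<bar> \<le> logistic t"
proof -
  let ?s = "logistic t"
  have s: "0 < ?s" "?s \<le> 1" by (rule logistic_pos logistic_le_1)+
  have 1: "\<bar>1 - ?s\<bar> \<le> 1" using s by auto
  have 2: "\<bar>(1 - ?s) * (1 - 2 * ?s)\<bar> \<le> 1"
    using mult_mono[OF 1, of "\<bar>1 - 2 * ?s\<bar>" 1] s by (simp add: abs_mult)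
  have sq: "(?s)\<^sup>2 \<le> ?s" using s by (simp add: power2_eq_square mult_left_le)
  have "0 \<le> (2 * ?s - 1)\<^sup>2" by simp
  then have "\<bar>1 - 6 * ?s + 6 * ?s\<^sup>2\<bar> \<le> 1" using sq by (simp add: power2_eq_square algebra_simps abs_le_iff)
  then have 3: "\<bar>(1 - ?s) * (1 - 6 * ?s + 6 * ?s\<^sup>2)\<bar> \<le> 1"
    using mult_mono[OF 1, of "\<bar>1 - 6 * ?s + 6 * ?s\<^sup>2\<bar>" 1] s by (simp add: abs_mult)
  have m: "\<bar>?s * y\<bar> \<le> ?s" if "\<bar>y\<bar> \<le> 1" for y
    using mult_left_mono[OF that, of ?s] s by (simp add: abs_mult)
  show "\<bar>logistic' t\<bar> \<le> ?s" "\<bar>logistic'' t\<bar> \<le> ?s" "\<bar>logistic''' t\<bar> \<le> ?s"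
    unfolding logistic'_def logistic''_def logistic'''_def mult.assoc
    by (rule m[OF 1] m[OF 2] m[OF 3])+
qed

definition taylor_remainder :: "real \<Rightarrow> real" where
  "taylor_remainder v = exp (max 0 v) * (v\<^sup>2 * min 1 \<bar>v\<bar>)"

lemma measurable_taylor_remainder [measurable]: "taylor_remainder \<in> borel_measurable borel"
  unfolding taylor_remainder_def by measurable

lemma taylor_remainder_nonneg: "0 \<le> taylor_remainder v"
  unfolding taylor_remainder_def by simp

text \<open>
  The Lagrange remainders of second and third order give the two terms of the minimum. Intermediate
  points exceed \<open>u\<close> by at most the positive part of \<open>v\<close>, hence the exponential factor, and none
  for negative \<open>v\<close>, so that the summands have to be truncated from above only.
\<close>
lemma logistic_taylor:
  "\<bar>logistic (u + v) - (logistic u + logistic' u * v + logistic'' u * v\<^sup>2 / 2)\<bar>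
    \<le> logistic u * taylor_remainder v"
proof (cases "v = 0")
  case True
  then show ?thesis using logistic_pos[of u] by (simp add: taylor_remainder_def)
next
  case False
  define F where "F m = (if m = 0 then logistic else if m = 1 then logistic' else if m = 2 then logistic'' else logistic''')" for m :: nat
  have F: "(F m has_real_derivative F (Suc m) t) (at t)" if "m < 3" for m t
  proof -
    from that consider "m = 0" | "m = 1" | "m = 2" by linarith
    then show ?thesis
      by cases (auto simp: F_def logistic_deriv logistic'_deriv logistic''_deriv)
  qed
  have mid: "logistic s \<le> exp (max 0 v) * logistic u" if "if v < 0 then u + v < s \<and> s < u else u < s \<and> s < u + v" for s
  proof -
    have "s \<le> u + max 0 v" using that by (auto split: if_splits)
    then have "logistic s \<le> logistic (u + max 0 v)" by (rule logistic_mono)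
    also have "\<dots> \<le> exp (max 0 (max 0 v)) * logistic u" by (rule logistic_shift_le)
    finally show ?thesis by simp
  qed
  have su: "logistic u \<le> exp (max 0 v) * logistic u" using logistic_pos[of u] by simp
  have le2: "u + min 0 v \<le> u" "u \<le> u + max 0 v" "u + min 0 v \<le> u + v" "u + v \<le> u + max 0 v" by auto
  have diff2: "\<forall>m t. m < 2 \<and> u + min 0 v \<le> t \<and> t \<le> u + max 0 v \<longrightarrow> DERIV (F m) t :> F (Suc m) t"
    using F by auto
  have diff3: "\<forall>m t. m < 3 \<and> u + min 0 v \<le> t \<and> t \<le> u + max 0 v \<longrightarrow> DERIV (F m) t :> F (Suc m) t"
    using F by auto
  have F0: "F 0 = logistic" by (simp add: F_def)
  have ne: "u + v \<noteq> u" using False by simp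
  obtain s2 where s2: "if u + v < u then u + v < s2 \<and> s2 < u else u < s2 \<and> s2 < u + v"
    "logistic (u + v) = (\<Sum>m<2. F m u / fact m * (u + v - u) ^ m) + F 2 s2 / fact 2 * (u + v - u) ^ 2"
    using Taylor[of 2 F logistic, OF _ F0 diff2 le2 ne] by auto
  obtain s3 where s3: "if u + v < u then u + v < s3 \<and> s3 < u else u < s3 \<and> s3 < u + v"
    "logistic (u + v) = (\<Sum>m<3. F m u / fact m * (u + v - u) ^ m) + F 3 s3 / fact 3 * (u + v - u) ^ 3"
    using Taylor[of 3 F logistic, OF _ F0 diff3 le2 ne] by auto
  let ?D = "logistic (u + v) - (logistic u + logistic' u * v + logistic'' u * v\<^sup>2 / 2)"
  let ?E = "exp (max 0 v) * logistic u"
  have e2: "?D = (logistic'' s2 - logistic'' u) * (v\<^sup>2 / 2)"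
    using s2(2) by (simp add: F_def eval_nat_numeral field_simps)
  have e3: "?D = logistic''' s3 * (v ^ 3 / 6)"
    using s3(2) by (simp add: F_def eval_nat_numeral field_simps)
  have "\<bar>logistic'' s2 - logistic'' u\<bar> \<le> logistic s2 + logistic u"
    using abs_logistic_derivs(2)[of s2] abs_logistic_derivs(2)[of u] by linarith
  also have "\<dots> \<le> 2 * ?E" using mid[of s2] s2(1) su by (auto split: if_splits)
  finally have "\<bar>?D\<bar> \<le> 2 * ?E * (v\<^sup>2 / 2)"
    unfolding e2 abs_mult by (intro mult_mono) auto
  then have 2: "\<bar>?D\<bar> \<le> ?E * v\<^sup>2" by simp
  have "\<bar>logistic''' s3\<bar> \<le> ?E" using abs_logistic_derivs(3)[of s3] mid[of s3] s3(1) by (auto split: if_splits)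
  then have "\<bar>?D\<bar> \<le> ?E * (\<bar>v\<bar> ^ 3 / 6)"
    unfolding e3 abs_mult by (intro mult_mono) (auto simp: power_abs)
  also have "\<dots> \<le> ?E * \<bar>v\<bar> ^ 3" using logistic_pos[of u] by (intro mult_left_mono) auto
  also have "\<bar>v\<bar> ^ 3 = v\<^sup>2 * \<bar>v\<bar>" by (simp add: eval_nat_numeral abs_mult[symmetric])
  finally have 3: "\<bar>?D\<bar> \<le> ?E * (v\<^sup>2 * \<bar>v\<bar>)" .
  have "\<bar>?D\<bar> \<le> ?E * (v\<^sup>2 * min 1 \<bar>v\<bar>)"
    using 2 3 by (auto simp: min_def)
  then show ?thesis by (simp add: taylor_remainder_def mult_ac)
qed

lemma logistic_expansion:
  assumes "prob_space \<mu>" and [measurable_cong]: "sets \<mu> = sets borel"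
    and int: "integrable \<mu> (\<lambda>v. v)" "integrable \<mu> (\<lambda>v. v\<^sup>2)" "integrable \<mu> (\<lambda>v. taylor_remainder (v / w))"
  shows "\<bar>(\<integral>v. logistic (u + v / w) \<partial>\<mu>) -
     (logistic u + logistic' u * ((\<integral>v. v \<partial>\<mu>) / w) + logistic'' u * ((\<integral>v. v\<^sup>2 \<partial>\<mu>) / (2 * w\<^sup>2)))\<bar>
    \<le> logistic u * (\<integral>v. taylor_remainder (v / w) \<partial>\<mu>)"
proof -
  interpret prob_space \<mu> by fact
  let ?p = "\<lambda>v. logistic u + logistic' u * (v / w) + logistic'' u * (v / w)\<^sup>2 / 2"
  have intl: "integrable \<mu> (\<lambda>v. logistic (u + v / w))"
    using logistic_le_1 logistic_pos by (intro integrable_const_bound[where B = 1]) (auto simp: abs_of_pos)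
  have intp: "integrable \<mu> ?p"
    using int by (auto simp: power_divide)
  have m: "measure \<mu> (space \<mu>) = 1" by (rule prob_space)
  have p: "(\<integral>v. ?p v \<partial>\<mu>) = logistic u + logistic' u * ((\<integral>v. v \<partial>\<mu>) / w) + logistic'' u * ((\<integral>v. v\<^sup>2 \<partial>\<mu>) / (2 * w\<^sup>2))"
    using int by (simp add: power_divide m mult.commute)
  have "\<bar>(\<integral>v. logistic (u + v / w) \<partial>\<mu>) - (\<integral>v. ?p v \<partial>\<mu>)\<bar> = \<bar>\<integral>v. logistic (u + v / w) - ?p v \<partial>\<mu>\<bar>"
    using intl intp by simp
  also have "\<dots> \<le> (\<integral>v. \<bar>logistic (u + v / w) - ?p v\<bar> \<partial>\<mu>)"
    by (rule integral_abs_bound)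
  also have "\<dots> \<le> (\<integral>v. logistic u * taylor_remainder (v / w) \<partial>\<mu>)"
    using intl intp int by (intro integral_mono logistic_taylor integrable_abs) auto
  finally show ?thesis unfolding p by simp
qed

lemma integrable_gaussian_remainder:
  obtains C where "0 \<le> C" "\<And>w. 1 \<le> w \<Longrightarrow> integrable std_normal_distribution (\<lambda>v. taylor_remainder (v / w))"
    "\<And>w. 1 \<le> w \<Longrightarrow> (\<integral>v. taylor_remainder (v / w) \<partial>std_normal_distribution) \<le> C / w ^ 3"
proof -
  define g where "g v = exp v * \<bar>v\<bar> ^ 3 + \<bar>v\<bar> ^ 3" for v :: real
  have [measurable]: "g \<in> borel_measurable borel" unfolding g_def by measurable
  have "integrable lborel (\<lambda>v. normal_density 1 1 v * \<bar>v\<bar> ^ 3)"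
  proof -
    have "integrable lborel (\<lambda>v. normal_density 1 1 v * \<bar>v - 1\<bar> ^ 3)" "integrable lborel (normal_density 1 1)"
      using integrable_normal_moment_abs[of 1 1 3] by auto
    then have i: "integrable lborel (\<lambda>v. 8 * (normal_density 1 1 v * \<bar>v - 1\<bar> ^ 3) + 8 * normal_density 1 1 v)"
      by auto
    have le: "\<bar>v\<bar> ^ 3 \<le> 8 * \<bar>v - 1\<bar> ^ 3 + 8" for v :: real
    proof -
      have "\<bar>v\<bar> \<le> 2 * max \<bar>v - 1\<bar> 1" by (auto simp: max_def abs_if)
      then have "\<bar>v\<bar> ^ 3 \<le> (2 * max \<bar>v - 1\<bar> 1) ^ 3" by (intro power_mono) auto
      also have "\<dots> = 8 * max \<bar>v - 1\<bar> 1 ^ 3" by (simp add: power_mult_distrib)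
      also have "max \<bar>v - 1\<bar> 1 ^ 3 \<le> \<bar>v - 1\<bar> ^ 3 + 1" by (simp add: max_def)
      finally show ?thesis by simp
    qed
    have le': "normal_density 1 1 v * \<bar>v\<bar> ^ 3 \<le> 8 * (normal_density 1 1 v * \<bar>v - 1\<bar> ^ 3) + 8 * normal_density 1 1 v" for v
      using mult_left_mono[OF le normal_density_nonneg[of 1 1 v]] by (simp add: distrib_left mult_ac)
    show ?thesis
      by (rule Bochner_Integration.integrable_bound[OF i]) (auto intro!: AE_I2 order_trans[OF le'])
  qed
  then have "integrable lborel (\<lambda>v. normal_density 1 1 v * \<bar>v\<bar> ^ 3 * exp (1 / 2))"
    by (rule integrable_mult_left)
  moreover have "integrable lborel (\<lambda>v. std_normal_density v * \<bar>v\<bar> ^ 3)"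
    by (rule integrable_std_normal_moment_abs)
  ultimately have "integrable lborel (\<lambda>v. normal_density 1 1 v * \<bar>v\<bar> ^ 3 * exp (1 / 2) + std_normal_density v * \<bar>v\<bar> ^ 3)"
    by auto
  also have "(\<lambda>v. normal_density 1 1 v * \<bar>v\<bar> ^ 3 * exp (1 / 2) + std_normal_density v * \<bar>v\<bar> ^ 3) = (\<lambda>v. std_normal_density v * g v)"
  proof
    fix v :: real
    have "- (v - 1)\<^sup>2 / 2 + 1 / 2 = - v\<^sup>2 / 2 + v" by (simp add: power2_eq_square field_simps)
    then have "exp (- (v - 1)\<^sup>2 / 2) * exp (1 / 2) = exp (- v\<^sup>2 / 2) * exp v" unfolding exp_add[symmetric] by simp
    then have "normal_density 1 1 v * exp (1 / 2) = std_normal_density v * exp v"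
      by (simp add: normal_density_def field_simps)
    then show "normal_density 1 1 v * \<bar>v\<bar> ^ 3 * exp (1 / 2) + std_normal_density v * \<bar>v\<bar> ^ 3 = std_normal_density v * g v"
      by (simp add: g_def distrib_left mult_ac)
  qed
  finally have ig: "integrable std_normal_distribution g"
    by (subst integrable_density) auto
  have g0: "0 \<le> g v" for v by (simp add: g_def)
  have le: "taylor_remainder (v / w) \<le> g v / w ^ 3" if "1 \<le> w" for v w
  proof -
    have "exp (max 0 (v / w)) \<le> exp v + 1"
    proof (cases "0 \<le> v")
      case True
      then have "v / w \<le> v" using that mult_left_mono[of 1 w v] by (simp add: divide_le_eq)
      then have "max 0 (v / w) \<le> v" using True by simp
      then have "exp (max 0 (v / w)) \<le> exp v" by simp
      then show ?thesis by linarith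
    next
      case False
      then have "v / w \<le> 0" using that by (simp add: divide_nonpos_pos)
      then have "max 0 (v / w) = 0" by simp
      then show ?thesis by simp
    qed
    moreover have "(v / w)\<^sup>2 * min 1 \<bar>v / w\<bar> \<le> (v / w)\<^sup>2 * \<bar>v / w\<bar>"
      by (intro mult_left_mono) auto
    ultimately have "taylor_remainder (v / w) \<le> (exp v + 1) * ((v / w)\<^sup>2 * \<bar>v / w\<bar>)"
      unfolding taylor_remainder_def by (intro mult_mono) (auto intro: add_nonneg_nonneg)
    also have "(v / w)\<^sup>2 * \<bar>v / w\<bar> = \<bar>v\<bar> ^ 3 / w ^ 3"
      using that by (simp add: eval_nat_numeral abs_mult[symmetric] power_divide)
    finally show ?thesis using that by (simp add: g_def field_simps)
  qed
  have int: "integrable std_normal_distribution (\<lambda>v. taylor_remainder (v / w))" if "1 \<le> w" for w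
  proof (rule Bochner_Integration.integrable_bound)
    show "integrable std_normal_distribution (\<lambda>v. g v / w ^ 3)" using ig by auto
  qed (use le[OF that] g0 that taylor_remainder_nonneg in \<open>auto intro!: AE_I2\<close>)
  show ?thesis
  proof (rule that[of "\<integral>v. g v \<partial>std_normal_distribution"])
    show "0 \<le> (\<integral>v. g v \<partial>std_normal_distribution)" using g0 by (intro Bochner_Integration.integral_nonneg) auto
    show "(\<integral>v. taylor_remainder (v / w) \<partial>std_normal_distribution) \<le> (\<integral>v. g v \<partial>std_normal_distribution) / w ^ 3" if "1 \<le> w" for w
      using integral_mono[OF int[OF that] _ le[OF that]] ig by simp
  qed (rule int)
qed

section \<open>Convolution powers\<close>

text \<open>
  Lindeberg's replacement in multiplicative form. A one-step comparison that holds for every shift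
  \<open>a\<close> can be applied inside the integral over the remaining summands; commutativity of convolution
  moves the replaced factor out of the way, so that no mixed sums need to be examined.
\<close>
lemma convolution_power_compare:
  fixes A B :: "nat \<Rightarrow> real measure" and f :: "real \<Rightarrow> ennreal"
  assumes fin: "\<And>n. 1 \<le> n \<Longrightarrow> finite_measure (A n)" "\<And>n. 1 \<le> n \<Longrightarrow> finite_measure (B n)"
    and sets: "\<And>n. sets (A n) = sets borel" "\<And>n. sets (B n) = sets borel"
    and rec: "\<And>n. 1 \<le> n \<Longrightarrow> A (Suc n) = (A n \<star> A 1)" "\<And>n. 1 \<le> n \<Longrightarrow> B (Suc n) = (B n \<star> B 1)"
    and f [measurable]: "f \<in> borel_measurable borel"
    and one: "\<And>a. (\<integral>\<^sup>+v. f (a + v) \<partial>A 1) \<le> \<kappa> * (\<integral>\<^sup>+v. f (a + v) \<partial>B 1)"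
    and n: "1 \<le> n"
  shows "(\<integral>\<^sup>+v. f (a + v) \<partial>A n) \<le> \<kappa> ^ n * (\<integral>\<^sup>+v. f (a + v) \<partial>B n)"
  using n
proof (induction n arbitrary: a rule: nat_induct_at_least)
  case base
  then show ?case using one by simp
next
  case (Suc n)
  note [measurable_cong] = sets
  note [simp] = fin[OF Suc(1)] fin[OF order_refl] sets and [simp del] = One_nat_def
  have conv: "(\<integral>\<^sup>+v. f (a + v) \<partial>(M \<star> N)) = (\<integral>\<^sup>+x. \<integral>\<^sup>+y. f (a + x + y) \<partial>N \<partial>M)"
    if "finite_measure M" "finite_measure N" and [measurable_cong]: "sets N = sets borel" "sets M = sets borel" for M N
    using that by (subst nn_integral_convolution) (auto simp: add.assoc)
  have "(\<integral>\<^sup>+v. f (a + v) \<partial>A (Suc n)) = (\<integral>\<^sup>+x. \<integral>\<^sup>+y. f (a + x + y) \<partial>A 1 \<partial>A n)"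
    unfolding rec(1)[OF Suc(1)] by (rule conv) auto
  also have "\<dots> \<le> (\<integral>\<^sup>+x. \<kappa> * (\<integral>\<^sup>+y. f (a + x + y) \<partial>B 1) \<partial>A n)"
    by (intro nn_integral_mono one)
  also have "\<dots> = \<kappa> * (\<integral>\<^sup>+x. (\<integral>\<^sup>+y. f (a + x + y) \<partial>B 1) \<partial>A n)"
  proof (rule nn_integral_cmult)
    interpret finite_measure "B 1" by simp
    show "(\<lambda>x. \<integral>\<^sup>+y. f (a + x + y) \<partial>B 1) \<in> borel_measurable (A n)" by measurable
  qed
  also have "(\<integral>\<^sup>+x. (\<integral>\<^sup>+y. f (a + x + y) \<partial>B 1) \<partial>A n) = (\<integral>\<^sup>+v. f (a + v) \<partial>(A n \<star> B 1))"
    by (rule conv[symmetric]) auto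
  also have "(A n \<star> B 1) = (B 1 \<star> A n)" by (rule convolution_commutative) auto
  also have "(\<integral>\<^sup>+v. f (a + v) \<partial>(B 1 \<star> A n)) = (\<integral>\<^sup>+x. (\<integral>\<^sup>+y. f (a + x + y) \<partial>A n) \<partial>B 1)"
    by (rule conv) auto
  also have "\<kappa> * \<dots> \<le> \<kappa> * (\<integral>\<^sup>+x. \<kappa> ^ n * (\<integral>\<^sup>+y. f (a + x + y) \<partial>B n) \<partial>B 1)"
    by (intro mult_left_mono nn_integral_mono Suc.IH) auto
  also have "(\<integral>\<^sup>+x. \<kappa> ^ n * (\<integral>\<^sup>+y. f (a + x + y) \<partial>B n) \<partial>B 1) = \<kappa> ^ n * (\<integral>\<^sup>+x. (\<integral>\<^sup>+y. f (a + x + y) \<partial>B n) \<partial>B 1)"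
  proof (rule nn_integral_cmult)
    interpret finite_measure "B n" by simp
    show "(\<lambda>x. \<integral>\<^sup>+y. f (a + x + y) \<partial>B n) \<in> borel_measurable (B 1)" by measurable
  qed
  also have "(\<integral>\<^sup>+x. (\<integral>\<^sup>+y. f (a + x + y) \<partial>B n) \<partial>B 1) = (\<integral>\<^sup>+v. f (a + v) \<partial>(B 1 \<star> B n))"
    by (rule conv[symmetric]) auto
  also have "(B 1 \<star> B n) = (B n \<star> B 1)" by (rule convolution_commutative) auto
  also have "\<dots> = B (Suc n)" by (rule rec(2)[OF Suc(1), symmetric])
  finally show ?case by (simp add: mult_ac)
qed

definition normal_law :: "nat \<Rightarrow> real measure" where
  "normal_law n = density lborel (normal_density 0 (sqrt n))"

lemma normal_law_1: "normal_law 1 = std_normal_distribution"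
  by (simp add: normal_law_def)

lemma sets_normal_law [simp, measurable_cong]: "sets (normal_law n) = sets borel"
  by (simp add: normal_law_def)

lemma prob_space_normal_law: "1 \<le> n \<Longrightarrow> prob_space (normal_law n)"
  unfolding normal_law_def by (intro prob_space_normal_density) auto

lemma normal_law_Suc:
  assumes "1 \<le> n" shows "normal_law (Suc n) = (normal_law n \<star> normal_law 1)"
proof -
  have p: "finite_measure (density lborel (normal_density 0 (sqrt n)))"
    "finite_measure (density lborel (normal_density 0 (sqrt 1)))"
    using prob_space_normal_law[OF assms] prob_space_normal_law[of 1]
    by (simp_all add: normal_law_def prob_space_def)
  have "normal_law n \<star> normal_law 1 = density lborel (\<lambda>x. \<integral>\<^sup>+y. ennreal (normal_density 0 (sqrt n) (x - y)) * ennreal (normal_density 0 (sqrt 1) y) \<partial>lborel)"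
    unfolding normal_law_def using p by (subst convolution_density) auto
  also have "(\<lambda>x. \<integral>\<^sup>+y. ennreal (normal_density 0 (sqrt n) (x - y)) * ennreal (normal_density 0 (sqrt 1) y) \<partial>lborel)
      = normal_density 0 (sqrt ((sqrt n)\<^sup>2 + (sqrt 1)\<^sup>2))"
    using conv_normal_density_zero_mean[of "sqrt n" "sqrt 1"] assms by (simp add: ennreal_mult fun_eq_iff)
  finally show ?thesis by (simp add: normal_law_def add.commute)
qed

lemma integral_normal_law:
  fixes f :: "real \<Rightarrow> real"
  assumes [measurable]: "f \<in> borel_measurable borel" and n: "1 \<le> n"
  shows "(\<integral>v. f v \<partial>normal_law n) = (\<integral>t. std_normal_density t * f (sqrt n * t) \<partial>lborel)"
proof -
  have "(\<integral>v. f v \<partial>normal_law n) = (\<integral>v. normal_density 0 (sqrt n) v * f v \<partial>lborel)"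
    unfolding normal_law_def by (subst integral_density) auto
  also have "\<dots> = (\<integral>t. sqrt n * (normal_density 0 (sqrt n) (sqrt n * t) * f (sqrt n * t)) \<partial>lborel)"
    using lborel_integral_real_affine[of "sqrt n" "\<lambda>v. normal_density 0 (sqrt n) v * f v" 0] n by simp
  also have "\<dots> = (\<integral>t. std_normal_density t * f (sqrt n * t) \<partial>lborel)"
    using n by (intro Bochner_Integration.integral_cong) (auto simp: normal_density_def real_sqrt_mult power_mult_distrib)
  finally show ?thesis .
qed

section \<open>Smoothing the Gaussian tail\<close>

lemma integrable_gaussian_logistic:
  assumes [measurable]: "g \<in> borel_measurable borel"
  shows "integrable lborel (\<lambda>t. std_normal_density t * logistic (g t))"
  by (rule Bochner_Integration.integrable_bound[OF integrable_normal_density[of 1 0]])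
     (use logistic_le_1 logistic_pos in \<open>auto intro!: AE_I2 mult_left_le simp: abs_mult abs_of_pos\<close>)

text \<open>
  Right of \<open>z\<close> the logistic function is at most 1, left of it at most exponential; the latter part is
  small because on the scale \<open>r\<close> the Gaussian density is nearly constant.
\<close>
lemma gaussian_logistic_upper:
  assumes z: "0 \<le> z" and r: "0 < r" "(1 + z) * r \<le> 1 / 2"
  shows "(\<integral>t. std_normal_density t * logistic ((t - z) / r + K) \<partial>lborel)
    \<le> (1 + 2 * mills_const * exp K * ((1 + z) * r)) * std_normal_tail z"
proof -
  let ?e = "\<lambda>t. std_normal_density t * (exp ((t - z) / r) * indicator {..z} t)"
  note e = gaussian_exp_left[OF z r]
  have int: "integrable lborel (\<lambda>t. std_normal_density t * indicator {z<..} t)" by simp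
  have "(\<integral>t. std_normal_density t * logistic ((t - z) / r + K) \<partial>lborel)
    \<le> (\<integral>t. std_normal_density t * indicator {z<..} t + exp K * ?e t \<partial>lborel)"
  proof (rule integral_mono)
    show "integrable lborel (\<lambda>t. std_normal_density t * logistic ((t - z) / r + K))"
      by (rule integrable_gaussian_logistic) measurable
    show "integrable lborel (\<lambda>t. std_normal_density t * indicator {z<..} t + exp K * ?e t)"
      using e(1) int by (intro Bochner_Integration.integrable_add integrable_mult_right) auto
    fix t :: real
    show "std_normal_density t * logistic ((t - z) / r + K) \<le> std_normal_density t * indicator {z<..} t + exp K * ?e t"
    proof (cases "z < t")
      case True
      then show ?thesis using logistic_le_1 by (auto intro!: mult_left_le)
    next
      case False
      have "logistic ((t - z) / r + K) \<le> exp K * exp ((t - z) / r)"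
        using logistic_le_exp[of "(t - z) / r + K"] by (simp add: exp_add mult.commute)
      then have "std_normal_density t * logistic ((t - z) / r + K) \<le> std_normal_density t * (exp K * exp ((t - z) / r))"
        by (intro mult_left_mono) auto
      then show ?thesis using False by (simp add: mult_ac)
    qed
  qed
  also have "\<dots> = std_normal_tail z + exp K * (\<integral>t. ?e t \<partial>lborel)"
    unfolding std_normal_tail_eq_integral using e(1) int
    by (subst Bochner_Integration.integral_add) (auto intro!: integrable_mult_right)
  also have "\<dots> \<le> std_normal_tail z + exp K * (2 * mills_const * ((1 + z) * r) * std_normal_tail z)"
    using e(2) by (intro add_left_mono mult_left_mono) auto
  finally show ?thesis by (simp add: algebra_simps)
qed

lemma indicator_le_logistic:
  assumes "K \<le> t" shows "1 \<le> (1 + exp (- K)) * logistic t"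
proof -
  have "1 = (1 + exp (- K)) * logistic K" by (simp add: logistic_def add_pos_pos less_imp_neq[symmetric])
  also have "\<dots> \<le> (1 + exp (- K)) * logistic t"
    using assms by (intro mult_left_mono logistic_mono) (auto intro: add_nonneg_nonneg)
  finally show ?thesis .
qed

text \<open>
  The smooth function cannot stay below the indicator, but its excess on the negative half-line is a
  small multiple of the logistic function itself, whose mean is under control as well.
\<close>
lemma logistic_minus_le_indicator:
  assumes "0 \<le> K" shows "logistic (t - K) \<le> indicator {0<..} t + 2 * exp (- K) * logistic t"
proof (cases "0 < t")
  case True
  then show ?thesis using logistic_le_1[of "t - K"] logistic_pos[of t] by (simp add: add_increasing2)
next
  case False
  have "exp t \<le> 2 * logistic t"
  proof -
    have "exp t * (1 + exp (- t)) \<le> 2" using False by (simp add: distrib_left flip: exp_add)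
    then show ?thesis unfolding logistic_def by (simp add: pos_le_divide_eq add_pos_pos)
  qed
  then have "exp (- K) * exp t \<le> exp (- K) * (2 * logistic t)" by (intro mult_left_mono) auto
  then show ?thesis using logistic_le_exp[of "t - K"] False by (simp add: exp_diff exp_minus field_simps)
qed

lemma gaussian_logistic_lower:
  assumes z: "0 \<le> z" and r: "0 < r" and K: "0 \<le> K"
  shows "(1 - 2 * mills_const * K * ((1 + z) * r)) * std_normal_tail z
    \<le> (1 + exp (- K)) * (\<integral>t. std_normal_density t * logistic ((t - z) / r - K) \<partial>lborel)"
proof -
  have "(1 - 2 * mills_const * K * ((1 + z) * r)) * std_normal_tail z =
      (1 - mills_const * (2 * K * r) * (1 + z)) * std_normal_tail z" by simp
  also have "\<dots> \<le> std_normal_tail (z + 2 * K * r)"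
    using z r K by (intro std_normal_tail_shift) auto
  also have "\<dots> \<le> (\<integral>t. (1 + exp (- K)) * (std_normal_density t * logistic ((t - z) / r - K)) \<partial>lborel)"
    unfolding std_normal_tail_eq_integral
  proof (rule integral_mono)
    show "integrable lborel (\<lambda>t. (1 + exp (- K)) * (std_normal_density t * logistic ((t - z) / r - K)))"
      by (intro integrable_mult_right integrable_gaussian_logistic) measurable
    fix t :: real
    show "std_normal_density t * indicator {z + 2 * K * r<..} t \<le> (1 + exp (- K)) * (std_normal_density t * logistic ((t - z) / r - K))"
    proof (cases "z + 2 * K * r < t")
      case True
      then have "2 * K \<le> (t - z) / r" using r by (simp add: pos_le_divide_eq)
      then have "1 \<le> (1 + exp (- K)) * logistic ((t - z) / r - K)" by (intro indicator_le_logistic) auto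
      then have "std_normal_density t * 1 \<le> std_normal_density t * ((1 + exp (- K)) * logistic ((t - z) / r - K))"
        by (intro mult_left_mono) auto
      then show ?thesis using True by (simp add: mult_ac)
    next
      case False
      then show ?thesis using logistic_pos[of "(t - z) / r - K"] by (auto intro!: mult_nonneg_nonneg add_nonneg_nonneg)
    qed
  qed simp
  finally show ?thesis by simp
qed

text \<open>
  Undoing the smoothing. The shift \<open>K\<close> trades the accuracy of the logistic approximation to the
  indicator against the displacement \<open>K w\<close> of the threshold. The displacement is harmless because
  \<open>\<theta>\<close> bounds \<open>w\<close> measured in units on which the Gaussian tail at \<open>x / sqrt n\<close> changes by a
  constant factor.
\<close>
lemma normal_tail_sandwich:
  assumes T: "prob_space T" and [measurable_cong]: "sets T = sets borel" and n: "1 \<le> (n::nat)" and w: "0 < w"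
    and up: "\<And>a. (\<integral>v. logistic (v / w + a) \<partial>T) \<le> \<kappa> * (\<integral>v. logistic (v / w + a) \<partial>normal_law n)"
    and lo: "\<And>a. (\<integral>v. logistic (v / w + a) \<partial>normal_law n) \<le> \<kappa> * (\<integral>v. logistic (v / w + a) \<partial>T)"
    and \<kappa>: "1 \<le> \<kappa>" and K: "0 \<le> K" and x: "0 \<le> x"
    and \<theta>: "(1 + x / sqrt n) * (w / sqrt n) \<le> \<theta>" "\<theta> \<le> 1 / 2" "2 * mills_const * K * \<theta> \<le> 1"
  shows "measure T {x<..} \<le> (1 + exp (- K)) * \<kappa> * (1 + 2 * mills_const * exp K * \<theta>) * std_normal_tail (x / sqrt n)"
    and "((1 - 2 * mills_const * K * \<theta>) / ((1 + exp (- K)) * \<kappa>) - 2 * exp (- K) * \<kappa> * (1 + 2 * mills_const * \<theta>))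
       * std_normal_tail (x / sqrt n) \<le> measure T {x<..}"
proof -
  interpret T: prob_space T by fact
  define z r where "z = x / sqrt n" and "r = w / sqrt n"
  have z: "0 \<le> z" and r: "0 < r" using n w x by (auto simp: z_def r_def)
  have \<theta>'1: "(1 + z) * r \<le> \<theta>" using \<theta>(1) unfolding z_def r_def .
  have \<theta>': "(1 + z) * r \<le> \<theta>" "(1 + z) * r \<le> 1 / 2" using \<theta>'1 \<theta>(2) by linarith+
  have sT: "space T = UNIV" using sets_eq_imp_space_eq[OF assms(2)] by simp
  have N: "(\<integral>v. logistic (v / w + (- x / w + a)) \<partial>normal_law n) = (\<integral>t. std_normal_density t * logistic ((t - z) / r + a) \<partial>lborel)" for a
  proof -
    have eq: "sqrt n * t / w + (- x / w + a) = (t - z) / r + a" for t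
      using n w by (simp add: z_def r_def field_simps)
    have "(\<integral>v. logistic (v / w + (- x / w + a)) \<partial>normal_law n) =
        (\<integral>t. std_normal_density t * logistic (sqrt n * t / w + (- x / w + a)) \<partial>lborel)"
      by (rule integral_normal_law[OF _ n]) measurable
    then show ?thesis unfolding eq .
  qed
  have int: "integrable T (\<lambda>v. logistic (v / w + a))" for a
    using logistic_le_1 logistic_pos by (intro T.integrable_const_bound[where B = 1]) (auto simp: abs_of_pos)
  have ind: "integrable T (\<lambda>v. indicator {x<..} v :: real)" "(\<integral>v. indicator {x<..} v \<partial>T) = measure T {x<..}"
    using sT assms(2) by (auto simp: T.emeasure_eq_measure)
  define tl where "tl = std_normal_tail z"
  have tl: "0 \<le> tl" unfolding tl_def using std_normal_tail_pos[of z] by simp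
  have upper: "(\<integral>v. logistic (v / w + (- x / w + a)) \<partial>T) \<le> \<kappa> * ((1 + 2 * mills_const * exp a * \<theta>) * tl)" for a
  proof -
    have "(\<integral>v. logistic (v / w + (- x / w + a)) \<partial>T) \<le> \<kappa> * (\<integral>v. logistic (v / w + (- x / w + a)) \<partial>normal_law n)"
      by (rule up)
    also have "\<dots> \<le> \<kappa> * ((1 + 2 * mills_const * exp a * ((1 + z) * r)) * tl)"
      unfolding N tl_def using gaussian_logistic_upper[OF z r \<theta>'(2), of a] \<kappa> by (intro mult_left_mono) auto
    also have "\<dots> \<le> \<kappa> * ((1 + 2 * mills_const * exp a * \<theta>) * tl)"
      using \<theta>' \<kappa> tl by (intro mult_left_mono mult_right_mono add_left_mono) auto
    finally show ?thesis .
  qed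
  have "measure T {x<..} \<le> (\<integral>v. (1 + exp (- K)) * logistic (v / w + (- x / w + K)) \<partial>T)"
    unfolding ind(2)[symmetric]
  proof (rule integral_mono)
    show "indicator {x<..} v \<le> (1 + exp (- K)) * logistic (v / w + (- x / w + K))" for v
    proof (cases "x < v")
      case True
      then have "x / w \<le> v / w" using w by (intro divide_right_mono) auto
      then show ?thesis using True indicator_le_logistic[of K "v / w + (- x / w + K)"] by simp
    qed (use logistic_pos in \<open>auto intro!: mult_nonneg_nonneg add_nonneg_nonneg simp: less_imp_le\<close>)
  qed (use ind int in auto)
  also have "\<dots> = (1 + exp (- K)) * (\<integral>v. logistic (v / w + (- x / w + K)) \<partial>T)" by simp
  also have "\<dots> \<le> (1 + exp (- K)) * (\<kappa> * ((1 + 2 * mills_const * exp K * \<theta>) * tl))"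
    by (intro mult_left_mono upper) (auto intro: add_nonneg_nonneg)
  finally show "measure T {x<..} \<le> (1 + exp (- K)) * \<kappa> * (1 + 2 * mills_const * exp K * \<theta>) * std_normal_tail (x / sqrt n)"
    by (simp add: tl_def z_def mult.assoc)
  have pK: "0 < 1 + exp (- K)" by (intro add_pos_pos) auto
  have "(1 - 2 * mills_const * K * \<theta>) * tl \<le> (1 - 2 * mills_const * K * ((1 + z) * r)) * tl"
    using \<theta>' K tl by (intro mult_right_mono diff_left_mono mult_left_mono) auto
  also have "\<dots> \<le> (1 + exp (- K)) * (\<integral>t. std_normal_density t * logistic ((t - z) / r + - K) \<partial>lborel)"
    using gaussian_logistic_lower[OF z r K] by (simp add: tl_def)
  also have "\<dots> \<le> (1 + exp (- K)) * (\<kappa> * (\<integral>v. logistic (v / w + (- x / w + - K)) \<partial>T))"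
    unfolding N[symmetric] using pK by (intro mult_left_mono lo) auto
  finally have "(1 - 2 * mills_const * K * \<theta>) * tl / ((1 + exp (- K)) * \<kappa>) \<le> (\<integral>v. logistic (v / w + (- x / w + - K)) \<partial>T)"
    using pK \<kappa> by (subst pos_divide_le_eq) (auto simp: mult_ac)
  also have "\<dots> \<le> (\<integral>v. indicator {x<..} v + 2 * exp (- K) * logistic (v / w + (- x / w + 0)) \<partial>T)"
  proof (rule integral_mono)
    show "logistic (v / w + (- x / w + - K)) \<le> indicator {x<..} v + 2 * exp (- K) * logistic (v / w + (- x / w + 0))" for v
    proof -
      have "indicator {0<..} (v / w - x / w) = (indicator {x<..} v :: real)"
        using w by (auto simp: indicator_def divide_less_cancel)
      moreover have "v / w + (- x / w + - K) = v / w - x / w - K" "v / w + (- x / w + 0) = v / w - x / w"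
        by simp_all
      ultimately show ?thesis using logistic_minus_le_indicator[OF K, of "v / w - x / w"] by (simp only:)
    qed
    show "integrable T (\<lambda>v. indicator {x<..} v + 2 * exp (- K) * logistic (v / w + (- x / w + 0)))"
      by (intro Bochner_Integration.integrable_add integrable_mult_right ind int)
  qed (rule int)
  also have "\<dots> = measure T {x<..} + 2 * exp (- K) * (\<integral>v. logistic (v / w + (- x / w + 0)) \<partial>T)"
    unfolding Bochner_Integration.integral_add[OF ind(1) integrable_mult_right[OF int]] ind(2)
    by (simp only: integral_mult_right_zero)
  also have "\<dots> \<le> measure T {x<..} + 2 * exp (- K) * (\<kappa> * ((1 + 2 * mills_const * exp 0 * \<theta>) * tl))"
    by (intro add_left_mono mult_left_mono upper) auto
  finally show "((1 - 2 * mills_const * K * \<theta>) / ((1 + exp (- K)) * \<kappa>) - 2 * exp (- K) * \<kappa> * (1 + 2 * mills_const * \<theta>))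
       * std_normal_tail (x / sqrt n) \<le> measure T {x<..}"
    by (simp add: tl_def z_def algebra_simps)
qed

lemma gaussian_logistic_ge:
  "std_normal_tail 0 * logistic u \<le> (\<integral>v. logistic (u + v / w) \<partial>std_normal_distribution)" if w: "0 < w"
proof -
  interpret N: prob_space std_normal_distribution using prob_space_normal_law[of 1] by (simp add: normal_law_def)
  have "std_normal_tail 0 * logistic u = (\<integral>v. std_normal_density v * indicator {0<..} v * logistic u \<partial>lborel)"
    unfolding std_normal_tail_eq_integral by simp
  also have "\<dots> \<le> (\<integral>v. std_normal_density v * logistic (u + v / w) \<partial>lborel)"
  proof (rule integral_mono)
    show "integrable lborel (\<lambda>v. std_normal_density v * logistic (u + v / w))"
      by (rule integrable_gaussian_logistic) measurable
    fix v :: real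
    show "std_normal_density v * indicator {0<..} v * logistic u \<le> std_normal_density v * logistic (u + v / w)"
    proof (cases "0 < v")
      case True
      then have "logistic u \<le> logistic (u + v / w)" using w by (intro logistic_mono) auto
      then show ?thesis using True by (auto intro: mult_left_mono)
    qed (use logistic_pos in \<open>auto simp: less_imp_le\<close>)
  qed (simp add: mult.commute)
  also have "\<dots> = (\<integral>v. logistic (u + v / w) \<partial>std_normal_distribution)"
    by (subst integral_density) auto
  finally show ?thesis .
qed

text \<open>
  The one-step error relative to \<open>logistic u\<close> becomes an error relative to the Gaussian mean, since
  a centred normal variable is positive with the positive probability \<open>std_normal_tail 0\<close> and the
  logistic function is increasing.
\<close>
lemma logistic_power_compare:
  fixes A :: "nat \<Rightarrow> real measure"
  assumes prob: "\<And>n. 1 \<le> n \<Longrightarrow> prob_space (A n)" and sets: "\<And>n. sets (A n) = sets borel"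
    and rec: "\<And>n. 1 \<le> n \<Longrightarrow> A (Suc n) = (A n \<star> A 1)"
    and w: "0 < w" and \<delta>: "0 \<le> \<delta>" "\<delta> \<le> std_normal_tail 0 / 2"
    and one: "\<And>u. \<bar>(\<integral>v. logistic (u + v / w) \<partial>A 1) - (\<integral>v. logistic (u + v / w) \<partial>std_normal_distribution)\<bar> \<le> \<delta> * logistic u"
    and n: "1 \<le> n"
  shows "(\<integral>v. logistic (v / w + a) \<partial>A n) \<le> exp (2 * n * \<delta> / std_normal_tail 0) * (\<integral>v. logistic (v / w + a) \<partial>normal_law n)" (is ?up)
    and "(\<integral>v. logistic (v / w + a) \<partial>normal_law n) \<le> exp (2 * n * \<delta> / std_normal_tail 0) * (\<integral>v. logistic (v / w + a) \<partial>A n)" (is ?lo)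
proof -
  define q where "q = std_normal_tail 0"
  have q: "0 < q" unfolding q_def by (rule std_normal_tail_pos)
  define \<kappa> where "\<kappa> = 1 + 2 * \<delta> / q"
  have \<kappa>: "1 \<le> \<kappa>" using \<delta> q by (simp add: \<kappa>_def)
  let ?N = std_normal_distribution
  let ?I = "\<lambda>M u. \<integral>v. logistic (u + v / w) \<partial>M"
  have le_up: "?I (A 1) u \<le> \<kappa> * ?I ?N u" for u
  proof -
    have "\<delta> * logistic u = \<delta> / q * (q * logistic u)" using q by simp
    also have "\<dots> \<le> \<delta> / q * ?I ?N u"
      using gaussian_logistic_ge[OF w, of u] \<delta> q by (intro mult_left_mono) (auto simp: q_def)
    finally have "\<delta> * logistic u \<le> \<delta> / q * ?I ?N u" .
    moreover have "0 \<le> \<delta> / q * ?I ?N u" using \<delta> q logistic_pos by (intro mult_nonneg_nonneg Bochner_Integration.integral_nonneg) (auto simp: less_imp_le)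
    ultimately have "?I (A 1) u \<le> ?I ?N u + 2 * (\<delta> / q * ?I ?N u)" using one[of u] by linarith
    then show ?thesis by (simp add: \<kappa>_def algebra_simps)
  qed
  have le_lo: "?I ?N u \<le> \<kappa> * ?I (A 1) u" for u
  proof -
    have "\<delta> * logistic u \<le> q / 2 * logistic u" using \<delta> logistic_pos[of u] by (intro mult_right_mono) (auto simp: q_def)
    then have "q / 2 * logistic u \<le> ?I (A 1) u"
      using one[of u] gaussian_logistic_ge[OF w, of u] by (simp add: q_def)
    then have "2 * \<delta> / q * (q / 2 * logistic u) \<le> 2 * \<delta> / q * ?I (A 1) u"
      using \<delta> q by (intro mult_left_mono) auto
    then have "\<delta> * logistic u \<le> 2 * \<delta> / q * ?I (A 1) u" using q by simp
    then show ?thesis using one[of u] by (simp add: \<kappa>_def algebra_simps)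
  qed
  have power: "\<kappa> ^ n \<le> exp (2 * n * \<delta> / q)"
  proof -
    have "\<kappa> ^ n \<le> exp (2 * \<delta> / q) ^ n" using \<kappa> unfolding \<kappa>_def by (intro power_mono exp_ge_add_one_self) auto
    also have "\<dots> = exp (2 * n * \<delta> / q)" by (simp add: field_simps flip: exp_of_nat_mult)
    finally show ?thesis .
  qed
  define f where "f v = ennreal (logistic (v / w))" for v
  have [measurable]: "f \<in> borel_measurable borel" unfolding f_def by measurable
  have conv: "(\<integral>\<^sup>+v. f (c + v) \<partial>M) = ennreal (?I M (c / w))"
    if "prob_space M" and [measurable_cong]: "sets M = sets borel" for M c
  proof -
    interpret prob_space M by fact
    have "integrable M (\<lambda>v. logistic (c / w + v / w))"
      using logistic_le_1 logistic_pos by (intro integrable_const_bound[where B = 1]) (auto simp: abs_of_pos)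
    then show ?thesis unfolding f_def add_divide_distrib
      using logistic_pos by (intro nn_integral_eq_integral) (auto simp: less_imp_le)
  qed
  have pN: "prob_space ?N" using prob_space_normal_law[of 1] normal_law_1 by simp
  have nonneg: "0 \<le> ?I M u" for M u using logistic_pos by (intro Bochner_Integration.integral_nonneg) (auto simp: less_imp_le)
  have fin: "finite_measure (A m)" "finite_measure (normal_law m)" if "1 \<le> m" for m
    using prob[OF that] prob_space_normal_law[OF that] by (auto simp: prob_space_def)
  have final: "?I M u \<le> exp (2 * n * \<delta> / q) * ?I M' u" 
    if "(\<integral>\<^sup>+v. f (u * w + v) \<partial>M) \<le> ennreal \<kappa> ^ n * (\<integral>\<^sup>+v. f (u * w + v) \<partial>M')"
      and "prob_space M" "prob_space M'" "sets M = sets borel" "sets M' = sets borel" for M M' u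
  proof -
    have "ennreal (?I M u) \<le> ennreal (\<kappa> ^ n * ?I M' u)"
      using that(1) w \<kappa> nonneg by (simp add: conv that ennreal_power ennreal_mult)
    then have "?I M u \<le> \<kappa> ^ n * ?I M' u" using \<kappa> nonneg by (subst (asm) ennreal_le_iff) auto
    also have "\<dots> \<le> exp (2 * n * \<delta> / q) * ?I M' u" by (intro mult_right_mono power nonneg)
    finally show ?thesis .
  qed
  have "?I (A n) a \<le> exp (2 * n * \<delta> / q) * ?I (normal_law n) a"
  proof (rule final)
    show "(\<integral>\<^sup>+v. f (a * w + v) \<partial>A n) \<le> ennreal \<kappa> ^ n * (\<integral>\<^sup>+v. f (a * w + v) \<partial>normal_law n)"
    proof (rule convolution_power_compare[OF fin sets sets_normal_law rec normal_law_Suc _ _ n])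
      fix c
      have "(\<integral>\<^sup>+v. f (c + v) \<partial>A 1) \<le> ennreal (\<kappa> * ?I ?N (c / w))"
        using le_up[of "c / w"] by (simp add: conv[OF prob sets] ennreal_leI del: One_nat_def)
      also have "\<dots> = ennreal \<kappa> * (\<integral>\<^sup>+v. f (c + v) \<partial>normal_law 1)"
        unfolding normal_law_1 using \<kappa> nonneg by (subst conv[OF pN]) (auto simp: ennreal_mult)
      finally show "(\<integral>\<^sup>+v. f (c + v) \<partial>A 1) \<le> ennreal \<kappa> * (\<integral>\<^sup>+v. f (c + v) \<partial>normal_law 1)" .
    qed auto
  qed (use prob prob_space_normal_law n sets in auto)
  then show ?up by (simp add: q_def add.commute)
  have "?I (normal_law n) a \<le> exp (2 * n * \<delta> / q) * ?I (A n) a"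
  proof (rule final)
    show "(\<integral>\<^sup>+v. f (a * w + v) \<partial>normal_law n) \<le> ennreal \<kappa> ^ n * (\<integral>\<^sup>+v. f (a * w + v) \<partial>A n)"
    proof (rule convolution_power_compare[OF fin(2) fin(1) sets_normal_law sets normal_law_Suc rec _ _ n])
      fix c
      have "(\<integral>\<^sup>+v. f (c + v) \<partial>normal_law 1) \<le> ennreal (\<kappa> * ?I (A 1) (c / w))"
        unfolding normal_law_1 using le_lo[of "c / w"] by (subst conv[OF pN]) (auto simp: ennreal_leI)
      also have "\<dots> = ennreal \<kappa> * (\<integral>\<^sup>+v. f (c + v) \<partial>A 1)"
        using \<kappa> nonneg by (simp add: conv[OF prob sets] ennreal_mult del: One_nat_def)
      finally show "(\<integral>\<^sup>+v. f (c + v) \<partial>normal_law 1) \<le> ennreal \<kappa> * (\<integral>\<^sup>+v. f (c + v) \<partial>A 1)" .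
    qed auto
  qed (use prob prob_space_normal_law n sets in auto)
  then show ?lo by (simp add: q_def add.commute)
qed

section \<open>Normal approximation at a low censoring level\<close>

context standardized_sample
begin

definition square_tail :: "real \<Rightarrow> real" where
  "square_tail t = (\<integral>v. v\<^sup>2 * indicator {v. t < \<bar>v\<bar>} v \<partial>D)"

lemma integrable_square_tail: "integrable D (\<lambda>v. v\<^sup>2 * indicator {v. t < \<bar>v\<bar>} v)"
  using square_integrable by (intro integrable_real_mult_indicator) auto

lemma square_tail_nonneg: "0 \<le> square_tail t"
  unfolding square_tail_def by (intro Bochner_Integration.integral_nonneg) auto

lemma square_tail_antimono: "s \<le> t \<Longrightarrow> square_tail t \<le> square_tail s"
  unfolding square_tail_def
  by (intro integral_mono integrable_square_tail) (auto simp: indicator_def)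

lemma censoring_first_moment:
  assumes "0 < b" shows "\<bar>\<integral>v. min v b \<partial>D\<bar> \<le> square_tail b / b"
proof -
  have "(\<integral>v. v - min v b \<partial>D) \<le> (\<integral>v. v\<^sup>2 * indicator {v. b < \<bar>v\<bar>} v / b \<partial>D)"
  proof (intro integral_mono Bochner_Integration.integrable_diff mean_integrable integrable_min integrable_divide integrable_square_tail)
    fix v :: real
    show "v - min v b \<le> v\<^sup>2 * indicator {v. b < \<bar>v\<bar>} v / b"
    proof (cases "b < v")
      case True
      then have "b * v \<le> v * v" using assms by (intro mult_right_mono) auto
      then have "v \<le> v\<^sup>2 / b" using assms by (simp add: power2_eq_square pos_le_divide_eq mult.commute)
      then show ?thesis using True assms by (simp add: indicator_def)
    qed (use assms in auto)
  qed
  then have "- (\<integral>v. min v b \<partial>D) \<le> square_tail b / b"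
    using mean_integrable integrable_min mean_zero by (simp add: square_tail_def)
  then show ?thesis using mean_min_le[of b] by linarith
qed

lemma censoring_second_moment:
  assumes "0 < b" shows "\<bar>(\<integral>v. (min v b)\<^sup>2 \<partial>D) - 1\<bar> \<le> square_tail b"
proof -
  have "(\<integral>v. v\<^sup>2 - (min v b)\<^sup>2 \<partial>D) \<le> (\<integral>v. v\<^sup>2 * indicator {v. b < \<bar>v\<bar>} v \<partial>D)"
    by (intro integral_mono Bochner_Integration.integrable_diff square_integrable integrable_min_square[OF assms] integrable_square_tail)
       (use assms in \<open>auto simp: indicator_def min_def\<close>)
  then have "1 - (\<integral>v. (min v b)\<^sup>2 \<partial>D) \<le> square_tail b"
    using square_integrable integrable_min_square[OF assms] second_moment by (simp add: square_tail_def)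
  then show ?thesis using min_square_le_1[OF assms] by linarith
qed

text \<open>
  The minimum in the remainder is bounded by 1 where \<open>v\<close> exceeds \<open>t\<close> in absolute value, and by
  \<open>t / w\<close> elsewhere. The two parts are governed by the truncated second moment and by the smallness
  of \<open>t\<close> relative to \<open>w\<close>, respectively.
\<close>
lemma censoring_remainder:
  assumes t: "0 < t" and b: "0 < b" and w: "0 < w" "b \<le> B * w"
  shows "integrable D (\<lambda>v. taylor_remainder (min v b / w))"
    and "(\<integral>v. taylor_remainder (min v b / w) \<partial>D) \<le> exp B * (square_tail t / w\<^sup>2 + t / w ^ 3)"
proof -
  have B: "0 < B" using b w by (metis less_le_trans zero_less_mult_pos2)
  let ?g = "\<lambda>v. exp B * (v\<^sup>2 * indicator {v. t < \<bar>v\<bar>} v / w\<^sup>2 + t / w ^ 3 * v\<^sup>2)"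
  have int: "integrable D ?g"
    by (intro integrable_mult_right Bochner_Integration.integrable_add integrable_divide integrable_square_tail square_integrable)
  have le: "taylor_remainder (min v b / w) \<le> ?g v" for v
  proof -
    define u where "u = min v b"
    have "u / w \<le> B" using w b by (simp add: u_def divide_le_eq)
    then have e: "exp (max 0 (u / w)) \<le> exp B" using B by simp
    have uv: "\<bar>u\<bar> \<le> \<bar>v\<bar>" "u\<^sup>2 \<le> v\<^sup>2" using b min_square_le[OF b, of v] by (auto simp: u_def)
    have "min 1 \<bar>u / w\<bar> \<le> indicator {v. t < \<bar>v\<bar>} v + t / w"
    proof (cases "t < \<bar>v\<bar>")
      case True
      moreover have "0 \<le> t / w" "min 1 \<bar>u / w\<bar> \<le> 1" using t w by auto
      ultimately show ?thesis by simp
    next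
      case False
      then have "\<bar>u\<bar> / w \<le> t / w" using uv w by (intro divide_right_mono) auto
      then show ?thesis using False w by (simp add: abs_divide)
    qed
    then have prod: "(u / w)\<^sup>2 * min 1 \<bar>u / w\<bar> \<le> (v\<^sup>2 / w\<^sup>2) * (indicator {v. t < \<bar>v\<bar>} v + t / w)"
      using uv by (intro mult_mono) (auto simp: power_divide divide_right_mono)
    have "taylor_remainder (u / w) \<le> exp B * ((v\<^sup>2 / w\<^sup>2) * (indicator {v. t < \<bar>v\<bar>} v + t / w))"
      unfolding taylor_remainder_def by (intro mult_mono[OF e prod]) auto
    also have "\<dots> = ?g v" using w by (simp add: field_simps eval_nat_numeral)
    finally show ?thesis by (simp add: u_def)
  qed
  show 1: "integrable D (\<lambda>v. taylor_remainder (min v b / w))"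
  proof (rule Bochner_Integration.integrable_bound[OF int])
    show "AE v in D. norm (taylor_remainder (min v b / w)) \<le> norm (?g v)"
      unfolding real_norm_def abs_of_nonneg[OF taylor_remainder_nonneg]
      by (intro AE_I2 order_trans[OF le abs_ge_self])
  qed measurable
  have "(\<integral>v. ?g v \<partial>D) = exp B * (square_tail t / w\<^sup>2 + t / w ^ 3 * 1)"
    using integrable_square_tail square_integrable
    by (simp add: square_tail_def second_moment)
  then show "(\<integral>v. taylor_remainder (min v b / w) \<partial>D) \<le> exp B * (square_tail t / w\<^sup>2 + t / w ^ 3)"
    using integral_mono[OF 1 int le] by simp
qed

definition sum_law :: "real \<Rightarrow> nat \<Rightarrow> real measure" where
  "sum_law b n = distr P borel (csum {1..n} b)"

lemma sets_sum_law [simp, measurable_cong]: "sets (sum_law b n) = sets borel"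
  by (simp add: sum_law_def)

lemma measurable_csum_upto [measurable]: "csum {1..n} b \<in> borel_measurable P"
  by (intro measurable_csum) auto

lemma prob_space_sum_law: "prob_space (sum_law b n)"
  unfolding sum_law_def by (intro prob_space_distr) measurable

lemma measure_sum_law: "measure (sum_law b n) {x<..} = prob (exceeds {1..n} b x)"
  unfolding sum_law_def by (subst measure_distr) (auto intro!: arg_cong[where f=prob])

lemma distr_min_X:
  assumes "j \<ge> 1" shows "distr P borel (\<lambda>\<omega>. min (X j \<omega>) b) = distr D borel (\<lambda>v. min v b)"
proof -
  have [measurable]: "X j \<in> borel_measurable P" using assms by (rule measurable_X)
  show ?thesis unfolding law[OF assms, symmetric]
    by (subst distr_distr) (auto simp: comp_def)
qed

lemma sum_law_1: "sum_law b 1 = distr D borel (\<lambda>v. min v b)"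
  using distr_min_X[of 1 b] by (simp add: sum_law_def csum_def[abs_def])

lemma sum_law_Suc: "sum_law b (Suc n) = (sum_law b n \<star> sum_law b 1)"
proof -
  have [measurable]: "X (Suc n) \<in> borel_measurable P" by (rule measurable_X) simp
  have "indep_var borel (\<lambda>\<omega>. min (X (Suc n) \<omega>) b) borel (\<lambda>\<omega>. \<Sum>i\<in>{1..n}. min (X i \<omega>) b)"
    by (rule indep_var_rest) auto
  then have ind: "indep_var borel (\<lambda>\<omega>. min (X (Suc n) \<omega>) b) borel (csum {1..n} b)"
    by (simp add: csum_def[abs_def])
  have "csum {1..Suc n} b = (\<lambda>\<omega>. min (X (Suc n) \<omega>) b + csum {1..n} b \<omega>)"
    by (auto simp: csum_def fun_eq_iff)
  then have "sum_law b (Suc n) = (distr P borel (\<lambda>\<omega>. min (X (Suc n) \<omega>) b) \<star> sum_law b n)"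
    unfolding sum_law_def by (simp only:) (rule sum_indep_random_variable[OF ind]; measurable)
  also have "distr P borel (\<lambda>\<omega>. min (X (Suc n) \<omega>) b) = sum_law b 1"
    unfolding sum_law_1 by (rule distr_min_X) simp
  also have "(sum_law b 1 \<star> sum_law b n) = (sum_law b n \<star> sum_law b 1)"
    using prob_space_sum_law by (intro convolution_commutative) (auto simp: prob_space_def)
  finally show ?thesis .
qed

text \<open>
  Second-order expansions under both laws. The moments of the censored variable differ from 0 and 1
  by quantities that the truncated second moment controls.
\<close>
lemma one_step_compare:
  obtains C where "0 \<le> C"
    "\<And>t b w B u. 0 < t \<Longrightarrow> t \<le> b \<Longrightarrow> 1 \<le> w \<Longrightarrow> b \<le> B * w \<Longrightarrow>
      \<bar>(\<integral>v. logistic (u + v / w) \<partial>sum_law b 1) - (\<integral>v. logistic (u + v / w) \<partial>std_normal_distribution)\<bar>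
      \<le> (square_tail t / (b * w) + square_tail t / (2 * w\<^sup>2) + exp B * (square_tail t / w\<^sup>2 + t / w ^ 3) + C / w ^ 3) * logistic u"
proof -
  obtain C where C: "0 \<le> C" "\<And>w. 1 \<le> w \<Longrightarrow> integrable std_normal_distribution (\<lambda>v. taylor_remainder (v / w))"
    "\<And>w. 1 \<le> w \<Longrightarrow> (\<integral>v. taylor_remainder (v / w) \<partial>std_normal_distribution) \<le> C / w ^ 3"
    using integrable_gaussian_remainder by blast
  let ?N = std_normal_distribution
  show ?thesis
  proof (rule that[OF C(1)])
    fix t b w B u :: real
    assume t: "0 < t" "t \<le> b" and w1: "1 \<le> w" and bB: "b \<le> B * w"
    have b: "0 < b" and w: "0 < w" using t w1 by auto
    let ?L = "logistic u" and ?L1 = "logistic' u" and ?L2 = "logistic'' u"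
    note rem = censoring_remainder[OF t(1) b w bB]
    let ?m1 = "\<integral>v. min v b \<partial>D" and ?m2 = "\<integral>v. (min v b)\<^sup>2 \<partial>D"
    let ?R = "\<integral>v. taylor_remainder (min v b / w) \<partial>D" and ?RN = "\<integral>v. taylor_remainder (v / w) \<partial>?N"
    have A: "\<bar>(\<integral>v. logistic (u + v / w) \<partial>sum_law b 1) - (?L + ?L1 * (?m1 / w) + ?L2 * (?m2 / (2 * w\<^sup>2)))\<bar> \<le> ?L * ?R"
    proof -
      have "integrable (sum_law b 1) (\<lambda>v. v)" "integrable (sum_law b 1) (\<lambda>v. v\<^sup>2)"
        "integrable (sum_law b 1) (\<lambda>v. taylor_remainder (v / w))"
        unfolding sum_law_1 using integrable_min integrable_min_square[OF b] rem(1)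
        by (subst integrable_distr_eq; simp)+
      from logistic_expansion[OF prob_space_sum_law sets_sum_law this, of u]
      show ?thesis unfolding sum_law_1 by (simp add: integral_distr)
    qed
    have N: "\<bar>(\<integral>v. logistic (u + v / w) \<partial>?N) - (?L + ?L1 * (0 / w) + ?L2 * (1 / (2 * w\<^sup>2)))\<bar> \<le> ?L * ?RN"
    proof -
      have p: "prob_space ?N" using prob_space_normal_law[of 1] normal_law_1 by simp
      have "integrable ?N (\<lambda>v. v)" "integrable ?N (\<lambda>v. v\<^sup>2)"
        using integrable_std_normal_moment[of 1] integrable_std_normal_moment[of 2]
        by (simp_all add: integrable_density)
      moreover have "(\<integral>v. v \<partial>?N) = 0" "(\<integral>v. v\<^sup>2 \<partial>?N) = 1"
        using integral_std_normal_moment_odd[of 0] integral_std_normal_moment_even[of 1]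
        by (simp_all add: integral_density)
      ultimately show ?thesis using logistic_expansion[OF p _ _ _ C(2)[OF w1], of u] by simp
    qed
    have L: "0 < ?L" by (rule logistic_pos)
    have st: "square_tail b \<le> square_tail t" using t by (intro square_tail_antimono)
    have "\<bar>?m1 / w\<bar> \<le> square_tail t / (b * w)"
    proof -
      have "\<bar>?m1\<bar> \<le> square_tail t / b"
        using censoring_first_moment[OF b] divide_right_mono[OF st, of b] b by linarith
      then have "\<bar>?m1\<bar> / w \<le> square_tail t / b / w" using w by (intro divide_right_mono) auto
      then show ?thesis using w by (simp add: abs_divide)
    qed
    then have 1: "\<bar>?L1 * (?m1 / w)\<bar> \<le> ?L * (square_tail t / (b * w))"
      unfolding abs_mult using abs_logistic_derivs(1)[of u] L by (intro mult_mono) auto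
    have "\<bar>(?m2 - 1) / (2 * w\<^sup>2)\<bar> \<le> square_tail t / (2 * w\<^sup>2)"
    proof -
      have "\<bar>?m2 - 1\<bar> / (2 * w\<^sup>2) \<le> square_tail t / (2 * w\<^sup>2)"
        using censoring_second_moment[OF b] st by (intro divide_right_mono) auto
      then show ?thesis by (simp add: abs_divide)
    qed
    then have 2: "\<bar>?L2 * ((?m2 - 1) / (2 * w\<^sup>2))\<bar> \<le> ?L * (square_tail t / (2 * w\<^sup>2))"
      unfolding abs_mult using abs_logistic_derivs(2)[of u] L by (intro mult_mono) auto
    have 3: "?L * ?R \<le> ?L * (exp B * (square_tail t / w\<^sup>2 + t / w ^ 3))"
      using rem(2) L by (intro mult_left_mono) auto
    have 4: "?L * ?RN \<le> ?L * (C / w ^ 3)" using C(3)[OF w1] L by (intro mult_left_mono) auto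
    have 5: "?L2 * ((?m2 - 1) / (2 * w\<^sup>2)) = ?L2 * (?m2 / (2 * w\<^sup>2)) - ?L2 * (1 / (2 * w\<^sup>2))"
      by (simp add: diff_divide_distrib right_diff_distrib)
    have "\<bar>(\<integral>v. logistic (u + v / w) \<partial>sum_law b 1) - (\<integral>v. logistic (u + v / w) \<partial>?N)\<bar>
      \<le> ?L * (square_tail t / (b * w)) + ?L * (square_tail t / (2 * w\<^sup>2)) + ?L * (exp B * (square_tail t / w\<^sup>2 + t / w ^ 3)) + ?L * (C / w ^ 3)"
      using A N 1 2 3 4 unfolding 5 by linarith
    then show "\<bar>(\<integral>v. logistic (u + v / w) \<partial>sum_law b 1) - (\<integral>v. logistic (u + v / w) \<partial>?N)\<bar>
      \<le> (square_tail t / (b * w) + square_tail t / (2 * w\<^sup>2) + exp B * (square_tail t / w\<^sup>2 + t / w ^ 3) + C / w ^ 3) * ?L"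
      by (simp only: distrib_left[symmetric] mult.commute)
  qed
qed

text \<open>
  A censoring level low enough for the exponential weight \<open>exp (x level / n)\<close> to stay bounded for
  \<open>x\<close> up to the order of \<open>sqrt (n ln n)\<close>, and so high that an exceedance of it is only
  \<open>ln n\<close> to some power times as likely as one of \<open>x\<close>.
\<close>
definition level :: "nat \<Rightarrow> real" where
  "level n = sqrt (n / ln n)"

text \<open>
  The order of choice matters: first \<open>K\<close> large, then \<open>\<theta>\<close> small depending on \<open>K\<close>, then \<open>\<kappa>\<close>
  close to 1.
\<close>
lemma normal_approximation_params:
  fixes \<epsilon> m :: real
  assumes "0 < \<epsilon>"
  obtains K \<theta> \<kappa> :: real where "0 \<le> K" "0 < \<theta>" "\<theta> \<le> 1 / 2" "2 * m * K * \<theta> \<le> 1" "1 < \<kappa>"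
    "(1 + exp (- K)) * \<kappa> * (1 + 2 * m * exp K * \<theta>) \<le> 1 + \<epsilon>"
    "1 - \<epsilon> \<le> (1 - 2 * m * K * \<theta>) / ((1 + exp (- K)) * \<kappa>) - 2 * exp (- K) * \<kappa> * (1 + 2 * m * \<theta>)"
proof -
  have "((\<lambda>K::real. 1 + exp (- K)) \<longlongrightarrow> 1) at_top" by real_asymp
  then have "\<forall>\<^sub>F K::real in at_top. 1 + exp (- K) < 1 + \<epsilon>" using assms by (intro order_tendstoD(2)) auto
  moreover have "((\<lambda>K::real. 1 / (1 + exp (- K)) - 2 * exp (- K)) \<longlongrightarrow> 1) at_top" by real_asymp
  then have "\<forall>\<^sub>F K::real in at_top. 1 - \<epsilon> < 1 / (1 + exp (- K)) - 2 * exp (- K)"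
    using assms by (intro order_tendstoD(1)) auto
  ultimately have "\<forall>\<^sub>F K::real in at_top. 1 + exp (- K) < 1 + \<epsilon> \<and> 1 - \<epsilon> < 1 / (1 + exp (- K)) - 2 * exp (- K) \<and> 0 \<le> K"
    using eventually_ge_at_top[of 0] by eventually_elim auto
  then obtain K :: real where K: "1 + exp (- K) < 1 + \<epsilon>" "1 - \<epsilon> < 1 / (1 + exp (- K)) - 2 * exp (- K)" "0 \<le> K"
    using eventually_happens'[OF trivial_limit_at_top_linorder] by blast
  have pK: "1 + exp (- K) \<noteq> 0" using add_pos_pos[of 1 "exp (- K)"] by simp
  have "((\<lambda>\<theta>::real. (1 + exp (- K)) * (1 + 2 * m * exp K * \<theta>)) \<longlongrightarrow> (1 + exp (- K)) * (1 + 2 * m * exp K * 0)) (at_right 0)"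
    by (intro tendsto_intros)
  then have "\<forall>\<^sub>F \<theta>::real in at_right 0. (1 + exp (- K)) * (1 + 2 * m * exp K * \<theta>) < 1 + \<epsilon>"
    using K by (intro order_tendstoD(2)) auto
  moreover have "((\<lambda>\<theta>::real. (1 - 2 * m * K * \<theta>) / (1 + exp (- K)) - 2 * exp (- K) * (1 + 2 * m * \<theta>)) \<longlongrightarrow>
      (1 - 2 * m * K * 0) / (1 + exp (- K)) - 2 * exp (- K) * (1 + 2 * m * 0)) (at_right 0)"
    using pK by (intro tendsto_intros)
  then have "\<forall>\<^sub>F \<theta>::real in at_right 0. 1 - \<epsilon> < (1 - 2 * m * K * \<theta>) / (1 + exp (- K)) - 2 * exp (- K) * (1 + 2 * m * \<theta>)"
    using K by (intro order_tendstoD(1)) auto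
  moreover have "((\<lambda>\<theta>::real. 2 * m * K * \<theta>) \<longlongrightarrow> 2 * m * K * 0) (at_right 0)" by (intro tendsto_intros)
  then have "\<forall>\<^sub>F \<theta>::real in at_right 0. 2 * m * K * \<theta> < 1" by (intro order_tendstoD(2)) auto
  moreover have "\<forall>\<^sub>F \<theta>::real in at_right 0. \<theta> \<in> {0<..<1 / 2}" by (rule eventually_at_right_real) simp
  ultimately have "\<forall>\<^sub>F \<theta>::real in at_right 0. (1 + exp (- K)) * (1 + 2 * m * exp K * \<theta>) < 1 + \<epsilon> \<and>
     1 - \<epsilon> < (1 - 2 * m * K * \<theta>) / (1 + exp (- K)) - 2 * exp (- K) * (1 + 2 * m * \<theta>) \<and> 2 * m * K * \<theta> < 1 \<and> 0 < \<theta> \<and> \<theta> < 1 / 2"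
    by eventually_elim auto
  then obtain \<theta> :: real where \<theta>: "(1 + exp (- K)) * (1 + 2 * m * exp K * \<theta>) < 1 + \<epsilon>"
     "1 - \<epsilon> < (1 - 2 * m * K * \<theta>) / (1 + exp (- K)) - 2 * exp (- K) * (1 + 2 * m * \<theta>)" "2 * m * K * \<theta> < 1" "0 < \<theta>" "\<theta> < 1 / 2"
    using eventually_happens'[OF trivial_limit_at_right_real] by blast
  have "((\<lambda>\<kappa>::real. (1 + exp (- K)) * \<kappa> * (1 + 2 * m * exp K * \<theta>)) \<longlongrightarrow> (1 + exp (- K)) * 1 * (1 + 2 * m * exp K * \<theta>)) (at_right 1)"
    by (intro tendsto_intros)
  then have "\<forall>\<^sub>F \<kappa>::real in at_right 1. (1 + exp (- K)) * \<kappa> * (1 + 2 * m * exp K * \<theta>) < 1 + \<epsilon>"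
    using \<theta> by (intro order_tendstoD(2)) auto
  moreover have "((\<lambda>\<kappa>::real. (1 - 2 * m * K * \<theta>) / ((1 + exp (- K)) * \<kappa>) - 2 * exp (- K) * \<kappa> * (1 + 2 * m * \<theta>)) \<longlongrightarrow>
      (1 - 2 * m * K * \<theta>) / ((1 + exp (- K)) * 1) - 2 * exp (- K) * 1 * (1 + 2 * m * \<theta>)) (at_right 1)"
    using pK by (intro tendsto_intros) auto
  then have "\<forall>\<^sub>F \<kappa>::real in at_right 1. 1 - \<epsilon> < (1 - 2 * m * K * \<theta>) / ((1 + exp (- K)) * \<kappa>) - 2 * exp (- K) * \<kappa> * (1 + 2 * m * \<theta>)"
    using \<theta> by (intro order_tendstoD(1)) auto
  moreover have "\<forall>\<^sub>F \<kappa>::real in at_right 1. \<kappa> \<in> {1<..<2}" by (rule eventually_at_right_real) simp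
  ultimately have "\<forall>\<^sub>F \<kappa>::real in at_right 1. (1 + exp (- K)) * \<kappa> * (1 + 2 * m * exp K * \<theta>) < 1 + \<epsilon> \<and>
    1 - \<epsilon> < (1 - 2 * m * K * \<theta>) / ((1 + exp (- K)) * \<kappa>) - 2 * exp (- K) * \<kappa> * (1 + 2 * m * \<theta>) \<and> 1 < \<kappa>"
    by eventually_elim auto
  then obtain \<kappa> :: real where \<kappa>: "(1 + exp (- K)) * \<kappa> * (1 + 2 * m * exp K * \<theta>) < 1 + \<epsilon>"
    "1 - \<epsilon> < (1 - 2 * m * K * \<theta>) / ((1 + exp (- K)) * \<kappa>) - 2 * exp (- K) * \<kappa> * (1 + 2 * m * \<theta>)" "1 < \<kappa>"
    using eventually_happens'[OF trivial_limit_at_right_real] by blast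
  show ?thesis by (rule that[of K \<theta> \<kappa>]) (use K \<theta> \<kappa> in auto)
qed

text \<open>
  With width \<open>w\<close> a multiple of \<open>level n\<close>, \<open>n / w\<^sup>2\<close> is of order \<open>ln n\<close>. So \<open>n\<close> times the
  one-step error is of order \<open>ln n\<close> times the truncated second moment, plus a term of the order of a
  negative power of \<open>n\<close>, up to logarithms.
\<close>
lemma normal_approximation:
  assumes tau: "((\<lambda>t. ln t * square_tail t) \<longlongrightarrow> 0) at_top" and C0: "0 < C0" and \<epsilon>: "0 < \<epsilon>"
  shows "\<forall>\<^sub>F n in sequentially. \<forall>x. 0 \<le> x \<longrightarrow> x \<le> C0 * sqrt (n * ln n) \<longrightarrow>
    (1 - \<epsilon>) * std_normal_tail (x / sqrt n) \<le> prob (exceeds {1..n} (level n) x) \<and>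
    prob (exceeds {1..n} (level n) x) \<le> (1 + \<epsilon>) * std_normal_tail (x / sqrt n)"
proof -
  obtain K \<theta> \<kappa> where K: "0 \<le> K" and \<theta>: "0 < \<theta>" "\<theta> \<le> 1 / 2" "2 * mills_const * K * \<theta> \<le> 1" and \<kappa>: "1 < \<kappa>"
    and up: "(1 + exp (- K)) * \<kappa> * (1 + 2 * mills_const * exp K * \<theta>) \<le> 1 + \<epsilon>"
    and lo: "1 - \<epsilon> \<le> (1 - 2 * mills_const * K * \<theta>) / ((1 + exp (- K)) * \<kappa>) - 2 * exp (- K) * \<kappa> * (1 + 2 * mills_const * \<theta>)"
    using normal_approximation_params[OF \<epsilon>, of mills_const] by blast
  define \<eta> where "\<eta> = \<theta> / (1 + C0)"
  have \<eta>: "0 < \<eta>" using \<theta> C0 by (simp add: \<eta>_def)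
  define B where "B = 1 / \<eta>"
  define q where "q = std_normal_tail 0"
  have q: "0 < q" unfolding q_def by (rule std_normal_tail_pos)
  obtain C where C: "0 \<le> C"
    "\<And>t b w B u. 0 < t \<Longrightarrow> t \<le> b \<Longrightarrow> 1 \<le> w \<Longrightarrow> b \<le> B * w \<Longrightarrow>
      \<bar>(\<integral>v. logistic (u + v / w) \<partial>sum_law b 1) - (\<integral>v. logistic (u + v / w) \<partial>std_normal_distribution)\<bar>
      \<le> (square_tail t / (b * w) + square_tail t / (2 * w\<^sup>2) + exp B * (square_tail t / w\<^sup>2 + t / w ^ 3) + C / w ^ 3) * logistic u"
    using one_step_compare by blast
  \<comment> \<open>Any power of \<open>n\<close> below the square root works as truncation point: \<open>t\<close> is negligible
    against \<open>w\<close>, but \<open>ln t\<close> is comparable to \<open>ln n\<close>.\<close>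
  define t where "t n = real n powr (1 / 4)" for n :: nat
  define w where "w n = \<eta> * level n" for n :: nat
  define \<delta> where "\<delta> n = square_tail (t n) / (level n * w n) + square_tail (t n) / (2 * (w n)\<^sup>2) +
     exp B * (square_tail (t n) / (w n)\<^sup>2 + t n / (w n) ^ 3) + C / (w n) ^ 3" for n
  have n\<delta>: "(\<lambda>n. n * \<delta> n) \<longlonglongrightarrow> 0"
  proof -
    have "filterlim t at_top sequentially" unfolding t_def by real_asymp
    then have "(\<lambda>n. ln (t n) * square_tail (t n)) \<longlonglongrightarrow> 0"
      by (rule filterlim_compose[OF tau])
    then have "(\<lambda>n. (4 * (1 / \<eta> + 1 / (2 * \<eta>\<^sup>2) + exp B / \<eta>\<^sup>2)) * (ln (t n) * square_tail (t n))) \<longlonglongrightarrow> 0"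
      by (rule tendsto_mult_right_zero)
    moreover have "(\<lambda>n. exp B / \<eta> ^ 3 * (n * t n / (sqrt (n / ln n)) ^ 3)) \<longlonglongrightarrow> 0"
      unfolding t_def by (rule tendsto_mult_right_zero) real_asymp
    moreover have "(\<lambda>n. C / \<eta> ^ 3 * (n / (sqrt (n / ln n)) ^ 3)) \<longlonglongrightarrow> 0"
      by (rule tendsto_mult_right_zero) real_asymp
    ultimately have lim: "(\<lambda>n. (4 * (1 / \<eta> + 1 / (2 * \<eta>\<^sup>2) + exp B / \<eta>\<^sup>2)) * (ln (t n) * square_tail (t n)) +
       exp B / \<eta> ^ 3 * (n * t n / (sqrt (n / ln n)) ^ 3) + C / \<eta> ^ 3 * (n / (sqrt (n / ln n)) ^ 3)) \<longlonglongrightarrow> 0 + 0 + 0"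
      by (intro tendsto_add)
    have "\<forall>\<^sub>F n in sequentially. (4 * (1 / \<eta> + 1 / (2 * \<eta>\<^sup>2) + exp B / \<eta>\<^sup>2)) * (ln (t n) * square_tail (t n)) +
       exp B / \<eta> ^ 3 * (n * t n / (sqrt (n / ln n)) ^ 3) + C / \<eta> ^ 3 * (n / (sqrt (n / ln n)) ^ 3) = n * \<delta> n"
      using eventually_gt_at_top[of 1]
    proof eventually_elim
      case (elim n)
      let ?l = "ln (real n)" and ?b = "sqrt (n / ln n)" and ?s = "square_tail (t n)"
      have l: "0 < ?l" "0 < real n" using elim by auto
      then have b: "0 < ?b" "?b * ?b = n / ?l" "?b\<^sup>2 = n / ?l" by auto
      have lt: "ln (t n) = ?l / 4" using l by (simp add: t_def ln_powr)
      have a1: "n * (?s / (?b * (\<eta> * ?b))) = ?l * ?s / \<eta>"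
      proof -
        have "?b * (\<eta> * ?b) = \<eta> * (n / ?l)" using b(2) by (metis mult.left_commute)
        then show ?thesis using l \<eta> by (simp add: field_simps)
      qed
      have a2: "n * (?s / (2 * (\<eta> * ?b)\<^sup>2)) = ?l * ?s / (2 * \<eta>\<^sup>2)"
        unfolding power_mult_distrib b(3) using l \<eta> by (simp add: field_simps)
      have a3: "n * (exp B * (?s / (\<eta> * ?b)\<^sup>2 + t n / (\<eta> * ?b) ^ 3)) = exp B / \<eta>\<^sup>2 * (?l * ?s) + exp B / \<eta> ^ 3 * (n * t n / ?b ^ 3)"
      proof -
        have "n * (exp B * (?s / (\<eta> * ?b)\<^sup>2)) = exp B / \<eta>\<^sup>2 * (?l * ?s)"
          unfolding power_mult_distrib b(3) using l \<eta> by (simp add: field_simps)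
        moreover have "n * (exp B * (t n / (\<eta> * ?b) ^ 3)) = exp B / \<eta> ^ 3 * (n * t n / ?b ^ 3)"
          unfolding power_mult_distrib by simp
        ultimately show ?thesis by (simp only: distrib_left)
      qed
      have a4: "n * (C / (\<eta> * ?b) ^ 3) = C / \<eta> ^ 3 * (n / ?b ^ 3)"
        unfolding power_mult_distrib by simp
      have "n * \<delta> n = ?l * ?s / \<eta> + ?l * ?s / (2 * \<eta>\<^sup>2) + (exp B / \<eta>\<^sup>2 * (?l * ?s) + exp B / \<eta> ^ 3 * (n * t n / ?b ^ 3)) + C / \<eta> ^ 3 * (n / ?b ^ 3)"
        unfolding \<delta>_def w_def level_def distrib_left[of "real n"] a1 a2 a3 a4 ..
      then show ?case unfolding lt by (simp add: algebra_simps)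
    qed
    with lim show ?thesis by (simp add: tendsto_cong)
  qed
  have "(\<lambda>n. exp (2 * (n * \<delta> n) / q)) \<longlonglongrightarrow> exp (2 * 0 / q)"
    using q by (intro tendsto_intros n\<delta>) auto
  then have ev1: "\<forall>\<^sub>F n in sequentially. exp (2 * (n * \<delta> n) / q) < \<kappa>"
    using \<kappa> by (intro order_tendstoD(2)) auto
  have ev2: "\<forall>\<^sub>F n in sequentially. n * \<delta> n < q / 2"
    using n\<delta> q by (intro order_tendstoD(2)) auto
  have "filterlim (\<lambda>n. w n) at_top sequentially"
    unfolding w_def level_def using \<eta> by real_asymp
  then have ev3: "\<forall>\<^sub>F n in sequentially. 1 \<le> w n" by (simp add: filterlim_at_top)
  have ev4: "\<forall>\<^sub>F n in sequentially. t n \<le> level n" unfolding t_def level_def by real_asymp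
  have ev5: "\<forall>\<^sub>F n in sequentially. 1 \<le> ln (real n)" by real_asymp
  show ?thesis
    using ev1 ev2 ev3 ev4 ev5 eventually_gt_at_top[of 1]
  proof (eventually_elim, intro allI impI)
    case (elim n)
    fix x assume x: "0 \<le> x" "x \<le> C0 * sqrt (n * ln n)"
    have n: "1 \<le> n" "0 < real n" using elim by auto
    have tpos: "0 < t n" using n by (simp add: t_def)
    have w0: "0 < w n" using elim by simp
    have lpos: "0 < level n" using tpos elim by linarith
    have \<delta>0: "0 \<le> \<delta> n"
      unfolding \<delta>_def using square_tail_nonneg[of "t n"] w0 lpos C(1) tpos
      by (intro add_nonneg_nonneg mult_nonneg_nonneg divide_nonneg_nonneg) auto
    have "\<delta> n \<le> n * \<delta> n" using \<delta>0 n mult_right_mono[of 1 "real n" "\<delta> n"] by simp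
    then have \<delta>q: "\<delta> n \<le> std_normal_tail 0 / 2" using elim by (simp add: q_def)
    have bB: "level n \<le> B * w n" using \<eta> by (simp add: B_def w_def)
    have one: "\<bar>(\<integral>v. logistic (u + v / w n) \<partial>sum_law (level n) 1) - (\<integral>v. logistic (u + v / w n) \<partial>std_normal_distribution)\<bar> \<le> \<delta> n * logistic u" for u
      unfolding \<delta>_def using elim tpos bB by (intro C(2)) auto
    note cmp = logistic_power_compare[of "sum_law (level n)", OF prob_space_sum_law sets_sum_law sum_law_Suc w0 \<delta>0 \<delta>q one n(1)]
    have \<kappa>': "exp (2 * real n * \<delta> n / std_normal_tail 0) \<le> \<kappa>" using elim by (simp add: q_def mult.assoc)
    have nonneg: "0 \<le> (\<integral>v. logistic (v / w n + a) \<partial>M)" for a M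
      using logistic_pos by (intro Bochner_Integration.integral_nonneg) (auto simp: less_imp_le)
    have r: "w n / sqrt n = \<eta> / sqrt (ln n)"
      using n by (simp add: w_def level_def real_sqrt_divide)
    have z: "x / sqrt n \<le> C0 * sqrt (ln n)" using x n by (simp add: divide_le_eq real_sqrt_mult mult_ac)
    have "(1 + x / sqrt n) * (w n / sqrt n) \<le> ((1 + C0) * sqrt (ln n)) * (\<eta> / sqrt (ln n))"
    proof -
      have "1 + x / sqrt n \<le> (1 + C0) * sqrt (ln n)" using z real_sqrt_ge_one[OF elim(5)] unfolding distrib_right by linarith
      then show ?thesis unfolding r using \<eta> elim by (intro mult_right_mono) auto
    qed
    also have "\<dots> = (1 + C0) * \<eta>" using elim(6) by simp
    also have "\<dots> = \<theta>" using C0 by (simp add: \<eta>_def)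
    finally have \<theta>x: "(1 + x / sqrt n) * (w n / sqrt n) \<le> \<theta>" .
    have tp: "0 \<le> std_normal_tail (x / sqrt n)" using std_normal_tail_pos[of "x / sqrt n"] by simp
    note S = normal_tail_sandwich[OF prob_space_sum_law sets_sum_law n(1) w0
        order_trans[OF cmp(1) mult_right_mono[OF \<kappa>' nonneg]] order_trans[OF cmp(2) mult_right_mono[OF \<kappa>' nonneg]]
        _ K x(1) \<theta>x \<theta>(2,3)]
    show "(1 - \<epsilon>) * std_normal_tail (x / sqrt n) \<le> prob (exceeds {1..n} (level n) x) \<and>
    prob (exceeds {1..n} (level n) x) \<le> (1 + \<epsilon>) * std_normal_tail (x / sqrt n)"
      using S[folded measure_sum_law] \<kappa> mult_right_mono[OF up tp] mult_right_mono[OF lo tp]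
      unfolding measure_sum_law by auto
  qed
qed

end

section \<open>Moderate deviations\<close>

context regvar_sample
begin

lemma s_seq_eq:
  "s_seq \<alpha> n = sqrt (\<alpha> - 2) * sqrt (n * ln n)"
  unfolding s_seq_def by (simp add: real_sqrt_mult mult.assoc)

lemma level_mult_ln:
  assumes "1 < n" shows "sqrt (n * ln n) = level n * ln n"
proof -
  have "level n * ln n = sqrt (n / ln n) * sqrt ((ln n)\<^sup>2)" using assms by (simp add: level_def)
  also have "\<dots> = sqrt (n / ln n * (ln n)\<^sup>2)" by (simp only: real_sqrt_mult)
  also have "n / ln n * (ln n)\<^sup>2 = n * ln n" using assms by (simp add: power2_eq_square)
  finally show ?thesis ..
qed

lemma nV_level_bound:
  obtains C \<beta> where "0 < C" "\<beta> = 1 + \<alpha> / 2"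
    "\<forall>\<^sub>F n in sequentially. n * V (level n) \<le> C * (n powr (- (\<alpha> - 2) / 4) * ln n powr (\<beta> / 2))"
proof -
  define \<beta> where "\<beta> = 1 + \<alpha> / 2"
  have \<beta>: "\<beta> < \<alpha>" "0 < \<beta>" using \<alpha> unfolding \<beta>_def by linarith+
  obtain x0 where x0: "0 < x0" "\<And>t s. x0 \<le> t \<Longrightarrow> 1 \<le> s \<Longrightarrow> V (t * s) \<le> (2 / s) powr \<beta> * V t"
    using V_potter_upper[OF \<beta>] by blast
  define C where "C = (2 * x0) powr \<beta> * V x0"
  have "filterlim level at_top sequentially" unfolding level_def by real_asymp
  then have "\<forall>\<^sub>F n in sequentially. x0 \<le> level n" by (simp add: filterlim_at_top)
  then have "\<forall>\<^sub>F n in sequentially. n * V (level n) \<le> C * (n powr (- (\<alpha> - 2) / 4) * ln n powr (\<beta> / 2))"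
    using eventually_gt_at_top[of 1]
  proof eventually_elim
    case (elim n)
    have n: "0 < real n" "0 < ln (real n)" using elim by auto
    have b: "0 < level n" using elim x0 by linarith
    have "V (x0 * (level n / x0)) \<le> (2 / (level n / x0)) powr \<beta> * V x0"
      using elim x0 by (intro x0(2)) auto
    then have "V (level n) \<le> (2 * x0 / level n) powr \<beta> * V x0" using x0 by simp
    also have "(2 * x0 / level n) powr \<beta> = (2 * x0) powr \<beta> / level n powr \<beta>"
      using x0 b by (simp add: powr_divide)
    also have "level n powr \<beta> = n powr (\<beta> / 2) / ln n powr (\<beta> / 2)"
      using n by (simp add: level_def powr_half_sqrt[symmetric] powr_powr powr_divide)
    finally have "n * V (level n) \<le> n * ((2 * x0) powr \<beta> / (n powr (\<beta> / 2) / ln n powr (\<beta> / 2)) * V x0)"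
      by (intro mult_left_mono) auto
    also have "\<dots> = C * (n powr 1 * n powr (- (\<beta> / 2)) * ln n powr (\<beta> / 2))"
      using n by (simp add: C_def powr_minus field_simps)
    also have "n powr 1 * n powr (- (\<beta> / 2)) = n powr (- (\<alpha> - 2) / 4)"
      unfolding powr_add[symmetric] by (simp add: \<beta>_def field_simps)
    finally show ?case .
  qed
  then show ?thesis using x0 V_pos by (intro that[of C \<beta>]) (auto simp: C_def \<beta>_def)
qed

text \<open>
  At \<open>x = s_seq \<alpha> n / 2\<close> the Gaussian tail is about \<open>n\<close> to the power \<open>- (\<alpha> - 2) / 8\<close>, while
  \<open>n V (level n)\<close> has an exponent close to \<open>- (\<alpha> - 2) / 2\<close>, of which \<open>nV_level_bound\<close> keeps one
  half.
\<close>
lemma nV_level_negligible: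
  assumes \<epsilon>: "0 < \<epsilon>"
  shows "\<forall>\<^sub>F n in sequentially. \<forall>x. x \<le> s_seq \<alpha> n / 2 \<longrightarrow> n * V (level n) \<le> \<epsilon> * std_normal_tail (x / sqrt n)"
proof -
  obtain C \<beta> where C: "0 < C" "\<beta> = 1 + \<alpha> / 2"
    "\<forall>\<^sub>F n in sequentially. n * V (level n) \<le> C * (n powr (- (\<alpha> - 2) / 4) * ln n powr (\<beta> / 2))"
    using nV_level_bound by blast
  define g where "g = (\<alpha> - 2) / 8"
  have g: "0 < g" and \<alpha>g: "\<alpha> - 2 = 8 * g" using \<alpha> by (simp_all add: g_def)
  define a where "a = sqrt (\<alpha> - 2) / 2"
  have a: "0 < a" "a\<^sup>2 / 2 = g" using \<alpha> by (auto simp: a_def g_def power_divide)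
  have \<beta>: "0 < \<beta>" using C(2) \<alpha> by linarith
  have "((\<lambda>n::nat. n powr (- g) * ln n powr (\<beta> / 2) * (1 + a * sqrt (ln n))) \<longlonglongrightarrow> 0)"
    using g a(1) \<beta> by real_asymp
  then have "\<forall>\<^sub>F n::nat in sequentially. n powr (- g) * ln n powr (\<beta> / 2) * (1 + a * sqrt (ln n)) < \<epsilon> / (C * mills_const * sqrt (2 * pi))"
    using \<epsilon> C by (intro order_tendstoD(2)) (auto intro!: divide_pos_pos mult_pos_pos)
  then show ?thesis
    using C(3) eventually_gt_at_top[of 1]
  proof (eventually_elim, intro allI impI)
    case (elim n)
    fix x assume x: "x \<le> s_seq \<alpha> n / 2"
    have n: "0 < real n" "0 < ln (real n)" using elim by auto
    define z where "z = a * sqrt (ln n)"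
    have z0: "0 \<le> z" using a n by (simp add: z_def)
    have "s_seq \<alpha> n / 2 / sqrt n = z"
      using elim n by (simp add: s_seq_eq z_def a_def real_sqrt_mult)
    then have "x / sqrt n \<le> z" using x n divide_right_mono[OF x, of "sqrt n"] by simp
    then have tz: "std_normal_tail z \<le> std_normal_tail (x / sqrt n)" by (rule std_normal_tail_mono)
    have "exp (- z\<^sup>2 / 2) = n powr (- g)"
      using n a(2)[symmetric] by (simp add: z_def power_mult_distrib powr_def)
    then have phi: "std_normal_density z = n powr (- g) / sqrt (2 * pi)" by (simp add: std_normal_density_def)
    define D where "D = mills_const * sqrt (2 * pi)"
    have D: "0 < D" by (simp add: D_def)
    have "n * V (level n) \<le> C * (n powr (- (\<alpha> - 2) / 4) * ln n powr (\<beta> / 2))" by (rule elim)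
    also have "n powr (- (\<alpha> - 2) / 4) = n powr (- g) * n powr (- g)"
      unfolding powr_add[symmetric] by (subst \<alpha>g) simp
    also have "C * (n powr (- g) * n powr (- g) * ln n powr (\<beta> / 2)) = C * (n powr (- g) * ln n powr (\<beta> / 2)) * n powr (- g)"
      by simp
    also have "n powr (- g) = sqrt (2 * pi) * std_normal_density z" unfolding phi by simp
    also have "C * (sqrt (2 * pi) * std_normal_density z * ln n powr (\<beta> / 2)) * (sqrt (2 * pi) * std_normal_density z)
      \<le> C * (sqrt (2 * pi) * std_normal_density z * ln n powr (\<beta> / 2)) * (sqrt (2 * pi) * (mills_const * (1 + z) * std_normal_tail z))"
      using C mills_lower[OF z0] by (intro mult_left_mono) auto
    also have "\<dots> = (C * D) * (n powr (- g) * ln n powr (\<beta> / 2) * (1 + a * sqrt (ln n))) * std_normal_tail z"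
      unfolding phi z_def[symmetric] by (simp add: D_def)
    also have "\<dots> \<le> (C * D) * (\<epsilon> / (C * D)) * std_normal_tail z"
      using elim(1) C D std_normal_tail_pos[of z] by (intro mult_right_mono mult_left_mono) (auto simp: D_def mult.assoc)
    also have "\<dots> \<le> \<epsilon> * std_normal_tail (x / sqrt n)" using C D tz \<epsilon> by simp
    finally show "n * V (level n) \<le> \<epsilon> * std_normal_tail (x / sqrt n)" .
  qed
qed

text \<open>
  Chernoff's bound with parameter \<open>\<tau> / level n\<close>: the linear term \<open>- \<tau> e ln n\<close> dominates the
  quadratic one for small \<open>\<tau>\<close>.
\<close>
lemma censored_moderate_deviation:
  assumes e: "0 < e"
  obtains \<delta> where "0 < \<delta>"
    "\<forall>\<^sub>F n in sequentially. \<forall>I x. finite I \<longrightarrow> I \<subseteq> {1..} \<longrightarrow> card I \<le> n \<longrightarrow> e * sqrt (n * ln n) \<le> x \<longrightarrow>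
      prob (exceeds I (level n) x) \<le> n powr (- \<delta>)"
proof -
  define \<tau> where "\<tau> = min 1 (e / exp 1)"
  have \<tau>: "0 < \<tau>" "\<tau> \<le> 1" "\<tau> \<le> e / exp 1" using e by (auto simp: \<tau>_def)
  have \<tau>e: "\<tau> * exp \<tau> \<le> e"
  proof -
    have "\<tau> * exp \<tau> \<le> e / exp 1 * exp 1" using \<tau> e by (intro mult_mono) auto
    then show ?thesis by simp
  qed
  define \<delta> where "\<delta> = \<tau> * e / 2"
  show ?thesis
  proof (rule that)
    show "0 < \<delta>" using \<tau> e by (simp add: \<delta>_def)
    show "\<forall>\<^sub>F n in sequentially. \<forall>I x. finite I \<longrightarrow> I \<subseteq> {1..} \<longrightarrow> card I \<le> n \<longrightarrow> e * sqrt (n * ln n) \<le> x \<longrightarrow>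
      prob (exceeds I (level n) x) \<le> n powr (- \<delta>)"
      using eventually_gt_at_top[of 1]
    proof (eventually_elim, intro allI impI)
      case (elim n)
      fix I :: "nat set" and x :: real assume I: "finite I" "I \<subseteq> {1..}" "card I \<le> n" and x: "e * sqrt (n * ln n) \<le> x"
      have n: "0 < real n" "0 < ln (real n)" using elim by auto
      define l where "l = ln (real n)"
      have l: "0 < l" using n by (simp add: l_def)
      have b: "0 < level n" using n by (simp add: level_def)
      define h where "h = \<tau> / level n"
      have h: "0 < h" "h * level n = \<tau>" using b \<tau> by (auto simp: h_def)
      have h2: "n * h\<^sup>2 = \<tau>\<^sup>2 * l" using n by (simp add: h_def level_def power_divide l_def)
      have hs: "h * sqrt (n * ln n) = \<tau> * l"
        using level_mult_ln[OF elim] h(2) by (simp add: l_def mult.assoc[symmetric])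
      have "prob (exceeds I (level n) x) \<le> exp (- h * x + n * (h\<^sup>2 / 2 * exp \<tau>))"
        using h b \<tau> mgf_small[of h "level n" \<tau>] by (intro chernoff I) auto
      also have "\<dots> \<le> exp (- \<delta> * l)"
      proof -
        have "h * (e * sqrt (n * ln n)) \<le> h * x" using x h by (intro mult_left_mono) auto
        moreover have "h * (e * sqrt (n * ln n)) = e * (\<tau> * l)" unfolding hs[symmetric] by simp
        moreover have "n * (h\<^sup>2 / 2 * exp \<tau>) = (n * h\<^sup>2) * (exp \<tau> / 2)" by simp
        then have "n * (h\<^sup>2 / 2 * exp \<tau>) = (\<tau> * exp \<tau>) * (\<tau> * l / 2)"
          unfolding h2 by (simp add: power2_eq_square)
        moreover have "(\<tau> * exp \<tau>) * (\<tau> * l / 2) \<le> e * (\<tau> * l / 2)"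
          using \<tau>e \<tau> l by (intro mult_right_mono) auto
        moreover have "\<delta> * l = e * (\<tau> * l) - e * (\<tau> * l / 2)" by (simp add: \<delta>_def)
        ultimately have "- (h * x) + n * (h\<^sup>2 / 2 * exp \<tau>) \<le> - (\<delta> * l)" by linarith
        then show ?thesis by (simp only: exp_le_cancel_iff mult_minus_left)
      qed
      also have "\<dots> = n powr (- \<delta>)" using n by (simp add: powr_def l_def)
      finally show "prob (exceeds I (level n) x) \<le> n powr (- \<delta>)" .
    qed
  qed
qed

text \<open>
  A jump beyond \<open>level n\<close> is at most a power of \<open>ln n\<close> times more likely than one beyond \<open>x\<close>,
  whereas a simultaneous contribution \<open>e x\<close> of the remaining summands costs a power of \<open>n\<close>. The
  latter holds for every higher censoring level too, since exceeding \<open>level n\<close> a second time is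
  just as costly.
\<close>
lemma jump_times_deviation_negligible:
  assumes e: "0 < e" and c: "0 < c" and \<epsilon>: "0 < \<epsilon>"
  shows "\<forall>\<^sub>F n in sequentially. \<forall>x. s_seq \<alpha> n / 2 \<le> x \<longrightarrow> x \<le> c * s_seq \<alpha> n \<longrightarrow>
    (\<exists>p. V (level n) * p \<le> \<epsilon> * V x \<and>
      (\<forall>I m. finite I \<longrightarrow> I \<subseteq> {1..} \<longrightarrow> card I \<le> n \<longrightarrow> level n \<le> m \<longrightarrow>
        prob (exceeds I m (e * x)) \<le> p))"
proof -
  obtain C \<beta> where C: "0 < C" "\<beta> = 1 + \<alpha> / 2"
    "\<forall>\<^sub>F n in sequentially. n * V (level n) \<le> C * (n powr (- (\<alpha> - 2) / 4) * ln n powr (\<beta> / 2))"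
    using nV_level_bound by blast
  have \<beta>: "0 < \<beta>" using C(2) \<alpha> by linarith
  define a where "a = sqrt (\<alpha> - 2)"
  have a: "0 < a" using \<alpha> by (simp add: a_def)
  have "0 < e * a / 2" using a e by simp
  from censored_moderate_deviation[OF this] obtain \<delta> where \<delta>: "0 < \<delta>"
    and dev: "\<forall>\<^sub>F n in sequentially. \<forall>I x. finite I \<longrightarrow> I \<subseteq> {1..} \<longrightarrow> card I \<le> n \<longrightarrow> e * a / 2 * sqrt (n * ln n) \<le> x \<longrightarrow>
      prob (exceeds I (level n) x) \<le> n powr (- \<delta>)"
    by blast
  define \<gamma> where "\<gamma> = \<alpha> + 1"
  have \<gamma>: "\<alpha> < \<gamma>" "0 < \<gamma>" using \<alpha> by (auto simp: \<gamma>_def)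
  obtain x0 where x0: "0 < x0" "\<And>t s. x0 \<le> t \<Longrightarrow> 1 \<le> s \<Longrightarrow> V t \<le> (2 * s) powr \<gamma> * V (t * s)"
    using V_potter_lower[OF \<gamma>(1)] by blast
  define g where "g = (\<alpha> - 2) / 4"
  have g: "0 < g" "- (\<alpha> - 2) / 4 = - g" using \<alpha> by (simp_all only: g_def minus_divide_left) simp
  have "(\<lambda>n::nat. (2 * (c * a * ln n)) powr \<gamma> * (C * (n powr (- g) * ln n powr (\<beta> / 2)) + n powr (- \<delta>))) \<longlonglongrightarrow> 0"
  proof -
    have k: "0 < 2 * (c * a)" using c a by simp
    have "(\<lambda>n::nat. (2 * (c * a) * ln n) powr \<gamma> * (C * (n powr (- g) * ln n powr (\<beta> / 2)))) \<longlonglongrightarrow> 0"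
      using k g(1) \<beta> \<gamma>(2) C(1) by real_asymp
    moreover have "(\<lambda>n::nat. (2 * (c * a) * ln n) powr \<gamma> * n powr (- \<delta>)) \<longlonglongrightarrow> 0"
      using k \<delta> \<gamma>(2) by real_asymp
    ultimately have "(\<lambda>n::nat. (2 * (c * a) * ln n) powr \<gamma> * (C * (n powr (- g) * ln n powr (\<beta> / 2))) +
        (2 * (c * a) * ln n) powr \<gamma> * n powr (- \<delta>)) \<longlonglongrightarrow> 0 + 0"
      by (rule tendsto_add)
    then show ?thesis by (simp add: distrib_left mult.assoc)
  qed
  then have lim: "\<forall>\<^sub>F n::nat in sequentially. (2 * (c * a * ln n)) powr \<gamma> * (C * (n powr (- g) * ln n powr (\<beta> / 2)) + n powr (- \<delta>)) < \<epsilon>"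
    using \<epsilon> by (intro order_tendstoD(2)) auto
  have "filterlim level at_top sequentially" unfolding level_def by real_asymp
  then have ev1: "\<forall>\<^sub>F n in sequentially. x0 \<le> level n" by (simp add: filterlim_at_top)
  have ev2: "\<forall>\<^sub>F n in sequentially. level n \<le> a * sqrt (n * ln n) / 2"
    unfolding level_def using a by real_asymp
  show ?thesis
    using lim C(3)[unfolded g] dev ev1 ev2 eventually_gt_at_top[of 1]
  proof (eventually_elim, intro allI impI)
    case (elim n)
    fix x assume x: "s_seq \<alpha> n / 2 \<le> x" "x \<le> c * s_seq \<alpha> n"
    have n: "0 < real n" "0 < ln (real n)" using elim by auto
    have s: "s_seq \<alpha> n = a * sqrt (n * ln n)" using elim by (simp add: s_seq_eq a_def)
    have b: "0 < level n" using n by (simp add: level_def)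
    have xb: "level n \<le> x" using elim x s by linarith
    define p where "p = C * (n powr (- g) * ln n powr (\<beta> / 2)) + n powr (- \<delta>)"
    have p: "0 \<le> p" using C by (auto simp: p_def)
    have sl: "sqrt (n * ln n) = level n * ln n" by (rule level_mult_ln) (use elim in simp)
    have "V (level n) \<le> (2 * (x / level n)) powr \<gamma> * V (level n * (x / level n))"
      using elim xb b by (intro x0(2)) auto
    also have "level n * (x / level n) = x" using b by simp
    also have "(2 * (x / level n)) powr \<gamma> * V x \<le> (2 * (c * a * ln n)) powr \<gamma> * V x"
    proof (intro mult_right_mono powr_mono2 mult_left_mono)
      have "x \<le> c * a * ln n * level n" using x(2) unfolding s sl by (simp add: mult_ac)
      then show "x / level n \<le> c * a * ln n" using b by (simp add: divide_le_eq)
    qed (use \<gamma> V_nonneg xb b in auto)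
    finally have "V (level n) * p \<le> (2 * (c * a * ln n)) powr \<gamma> * V x * p" using p by (intro mult_right_mono)
    also have "\<dots> = ((2 * (c * a * ln n)) powr \<gamma> * p) * V x" by simp
    also have "\<dots> \<le> \<epsilon> * V x" using elim(1) V_nonneg unfolding p_def by (intro mult_right_mono) auto
    finally have Vp: "V (level n) * p \<le> \<epsilon> * V x" .
    have "prob (exceeds I m (e * x)) \<le> p"
      if I: "finite I" "I \<subseteq> {1..}" "card I \<le> n" and m: "level n \<le> m" for I m
    proof -
      have "prob (exceeds I m (e * x)) \<le>
        prob {\<omega> \<in> space P. csum I m \<omega> > e * x \<and> (\<exists>j\<in>I. X j \<omega> > level n)} + prob (exceeds I (level n) (e * x))"
        by (rule prob_split_jump[OF m I(1,2)])
      also have "\<dots> \<le> n * V (level n) + n powr (- \<delta>)"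
      proof (rule add_mono)
        have "prob {\<omega> \<in> space P. csum I m \<omega> > e * x \<and> (\<exists>j\<in>I. X j \<omega> > level n)} \<le> card I * V (level n)"
          by (rule prob_exists_large[OF I(1,2,2)])
        also have "\<dots> \<le> n * V (level n)" using I(3) V_nonneg by (intro mult_right_mono) auto
        finally show "prob {\<omega> \<in> space P. csum I m \<omega> > e * x \<and> (\<exists>j\<in>I. X j \<omega> > level n)} \<le> n * V (level n)" .
        have "e * a / 2 * sqrt (n * ln n) \<le> e * x"
          using mult_left_mono[OF x(1), of e] e by (simp add: s)
        then show "prob (exceeds I (level n) (e * x)) \<le> n powr (- \<delta>)"
          using elim(3) I by blast
      qed
      also have "\<dots> \<le> p" using elim(2) unfolding p_def by simp
      finally show ?thesis .
    qed
    with Vp show "\<exists>p. V (level n) * p \<le> \<epsilon> * V x \<and>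
      (\<forall>I m. finite I \<longrightarrow> I \<subseteq> {1..} \<longrightarrow> card I \<le> n \<longrightarrow> level n \<le> m \<longrightarrow>
        prob (exceeds I m (e * x)) \<le> p)" by blast
  qed
qed

lemma csum_mono_level:
  assumes "y \<le> m" shows "csum I y \<omega> \<le> csum I m \<omega>"
  unfolding csum_def using assms by (intro sum_mono) auto

lemma prob_csum_mono_level:
  assumes "y \<le> m"
  shows "prob (exceeds {1..n} y x) \<le> prob (exceeds {1..n} m x)"
proof (rule finite_measure_mono)
  show "exceeds {1..n} y x \<subseteq> exceeds {1..n} m x"
    using csum_mono_level[OF assms] by (auto intro: less_le_trans)
qed measurable

lemma large_deviation_asymp:
  assumes c: "1 < c" and \<epsilon>: "0 < \<epsilon>"
    and d: "\<forall>K>0. \<forall>\<^sub>F n in sequentially. K * sqrt n \<le> d n"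
  shows "\<forall>\<^sub>F n in sequentially. \<forall>x m. c * s_seq \<alpha> n \<le> x \<longrightarrow> x + d n \<le> m \<longrightarrow>
    (1 - \<epsilon>) * (n * V x) \<le> prob (exceeds {1..n} m x) \<and>
    prob (exceeds {1..n} m x) \<le> (1 + \<epsilon>) * (n * V x)"
proof -
  obtain K R where K: "0 < K" "0 < R"
    "\<And>(n::nat) x m. 1 \<le> n \<Longrightarrow> R * sqrt n \<le> x \<Longrightarrow> x + K * sqrt n \<le> m \<Longrightarrow>
      (1 - \<epsilon>) * (n * V x) \<le> prob (jump_event n m (x + K * sqrt n) (K * sqrt n))"
    using jump_event_lower[OF \<epsilon>] by blast
  have c0: "0 < c" using c by simp
  show ?thesis
    using large_deviation_upper[OF c \<epsilon>] d[rule_format, OF K(1)] s_seq_ge[OF c0 \<alpha>, of R]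
  proof (eventually_elim, intro allI impI)
    case (elim n)
    fix x m assume x: "c * s_seq \<alpha> n \<le> x" "x + d n \<le> m"
    have xm: "x + K * sqrt n \<le> m" "x \<le> m" "R * sqrt n \<le> x"
      using x elim K by (auto intro: order_trans) (smt (verit) mult_nonneg_nonneg real_sqrt_ge_zero of_nat_0_le_iff)
    have "(1 - \<epsilon>) * (n * V x) \<le> prob (jump_event n m (x + K * sqrt n) (K * sqrt n))"
      using elim xm by (intro K(3)) auto
    also have "\<dots> \<le> prob (exceeds {1..n} m x)"
      by (rule prob_csum_ge_jump_event[OF xm(1)])
    finally show "(1 - \<epsilon>) * (n * V x) \<le> prob (exceeds {1..n} m x) \<and>
      prob (exceeds {1..n} m x) \<le> (1 + \<epsilon>) * (n * V x)"
      using elim x xm by auto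
  qed
qed

text \<open>
  The upper bound distinguishes whether some summand exceeds \<open>level n\<close>. For the lower bound, the
  exceedance by the sum censored at \<open>level n\<close> and the jump event both force the sum beyond \<open>x\<close>,
  and they overlap negligibly: a summand beyond \<open>level n \<le> x / 2\<close> contributes at most \<open>x / 2\<close> to
  the former sum.
\<close>
lemma moderate_deviation_asymp:
  assumes tau: "((\<lambda>t. ln t * square_tail t) \<longlongrightarrow> 0) at_top"
    and c: "0 < c" and \<epsilon>: "0 < \<epsilon>"
    and d: "\<forall>K>0. \<forall>\<^sub>F n in sequentially. K * sqrt n \<le> d n"
  shows "\<forall>\<^sub>F n in sequentially. \<forall>x m. s_seq \<alpha> n / 2 \<le> x \<longrightarrow> x \<le> c * s_seq \<alpha> n \<longrightarrow> x + d n \<le> m \<longrightarrow>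
    (1 - \<epsilon>) * (std_normal_tail (x / sqrt n) + n * V x) \<le> prob (exceeds {1..n} m x) \<and>
    prob (exceeds {1..n} m x) \<le> (1 + \<epsilon>) * (std_normal_tail (x / sqrt n) + n * V x)"
proof -
  define \<eta> where "\<eta> = \<epsilon> / 2"
  have \<eta>: "0 < \<eta>" "\<eta> \<le> \<epsilon>" "2 * \<eta> = \<epsilon>" using \<epsilon> by (auto simp: \<eta>_def)
  define a where "a = sqrt (\<alpha> - 2)"
  have a: "0 < a" using \<alpha> by (simp add: a_def)
  have C0: "0 < c * a" using c a by simp
  obtain e x1 where e: "0 < e" "e < 1"
    "\<forall>x\<ge>x1. V ((1 - e) * x) \<le> (1 + \<eta>) * V x"
    "\<forall>x\<ge>x1. (1 - \<eta>) * V x \<le> V ((1 + e) * x)"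
    using V_near_constant[OF \<eta>(1)] by blast
  obtain K R where K: "0 < K" "0 < R"
    "\<And>(n::nat) x m. 1 \<le> n \<Longrightarrow> R * sqrt n \<le> x \<Longrightarrow> x + K * sqrt n \<le> m \<Longrightarrow>
      (1 - \<eta>) * (n * V x) \<le> prob (jump_event n m (x + K * sqrt n) (K * sqrt n))"
    using jump_event_lower[OF \<eta>(1)] by blast
  have half: "(0::real) < 1 / 2" by simp
  have ev1: "\<forall>\<^sub>F n in sequentially. max 0 x1 \<le> a * sqrt (n * ln n) / 2 \<and> 2 * level n \<le> a * sqrt (n * ln n) / 2"
  proof -
    have "filterlim (\<lambda>n::nat. a * sqrt (n * ln n) / 2) at_top sequentially" using a by real_asymp
    then have 1: "\<forall>\<^sub>F n::nat in sequentially. max 0 x1 \<le> a * sqrt (n * ln n) / 2" by (simp add: filterlim_at_top)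
    have "\<forall>\<^sub>F n in sequentially. 2 * level n \<le> a * sqrt (n * ln n) / 2" unfolding level_def using a by real_asymp
    with 1 show ?thesis by (rule eventually_conj)
  qed
  show ?thesis
    using normal_approximation[OF tau C0 \<eta>(1)] jump_times_deviation_negligible[OF e(1) c \<eta>(1)]
      jump_times_deviation_negligible[OF half c \<eta>(1)] ev1 d[rule_format, OF K(1)] s_seq_ge[OF half \<alpha>, of R] eventually_gt_at_top[of 1]
  proof (eventually_elim, intro allI impI)
    case (elim n)
    fix x m assume x: "s_seq \<alpha> n / 2 \<le> x" "x \<le> c * s_seq \<alpha> n" and m: "x + d n \<le> m"
    let ?b = "level n" and ?tl = "std_normal_tail (x / sqrt n)"
    let ?S = "\<lambda>m. exceeds {1..n} m x"
    let ?J = "\<lambda>m. {\<omega> \<in> space P. csum {1..n} m \<omega> > x \<and> (\<exists>j\<in>{1..n}. X j \<omega> > ?b)}"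
    have n: "0 < real n" "0 < ln (real n)" using elim by auto
    have s: "s_seq \<alpha> n = a * sqrt (n * ln n)" using elim by (simp add: s_seq_eq a_def)
    have b: "0 < ?b" using n by (simp add: level_def)
    have xb: "2 * ?b \<le> x" "x1 \<le> x" "0 < x" using elim x b unfolding s by auto
    have Kn: "0 \<le> K * sqrt n" using K by simp
    have xm: "x + K * sqrt n \<le> m" "R * sqrt n \<le> x" "?b \<le> m"
      using x elim m xb Kn b by auto
    have card: "card ({1..n} - {j}) \<le> n" for j using card_mono[of "{1..n}" "{1..n} - {j}"] by simp
    have normal: "(1 - \<eta>) * ?tl \<le> prob (?S ?b)" "prob (?S ?b) \<le> (1 + \<eta>) * ?tl"
      using elim(1) x xb unfolding s by (auto simp: mult.assoc)
    obtain p where p: "V ?b * p \<le> \<eta> * V x"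
      "\<And>I m. finite I \<Longrightarrow> I \<subseteq> {1..} \<Longrightarrow> card I \<le> n \<Longrightarrow> ?b \<le> m \<Longrightarrow> prob (exceeds I m (e * x)) \<le> p"
      using elim(2) x by blast
    have "prob (?J m) \<le> n * ((if x - e * x < m then V (x - e * x) else 0) + V ?b * p)"
      using card xm by (intro prob_with_jump_le p(2)) auto
    also have "\<dots> \<le> n * ((1 + \<eta>) * V x + \<eta> * V x)"
    proof (intro mult_left_mono add_mono p(1))
      show "(if x - e * x < m then V (x - e * x) else 0) \<le> (1 + \<eta>) * V x"
        using e(3)[rule_format, OF xb(2)] V_nonneg[of x] \<eta> by (simp add: algebra_simps)
    qed auto
    also have "\<dots> = (1 + \<epsilon>) * (n * V x)" using \<eta>(3) by (simp add: algebra_simps flip: \<eta>(3))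
    finally have jump_up: "prob (?J m) \<le> (1 + \<epsilon>) * (n * V x)" .
    have "prob (?S m) \<le> prob (?J m) + prob (?S ?b)"
      by (rule prob_split_jump[OF xm(3)]) auto
    moreover have "(1 + \<eta>) * ?tl \<le> (1 + \<epsilon>) * ?tl"
      using \<eta> std_normal_tail_pos[of "x / sqrt n"] by (intro mult_right_mono) auto
    ultimately have upper: "prob (?S m) \<le> (1 + \<epsilon>) * (?tl + n * V x)"
      using jump_up normal by (simp add: distrib_left)
    obtain p' where p': "V ?b * p' \<le> \<eta> * V x"
      "\<And>I m. finite I \<Longrightarrow> I \<subseteq> {1..} \<Longrightarrow> card I \<le> n \<Longrightarrow> ?b \<le> m \<Longrightarrow> prob (exceeds I m (1 / 2 * x)) \<le> p'"
      using elim(3) x by blast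
    have "prob (?J ?b) \<le> n * ((if x - 1 / 2 * x < ?b then V (x - 1 / 2 * x) else 0) + V ?b * p')"
      using card by (intro prob_with_jump_le p'(2)) auto
    also have "\<dots> \<le> n * (0 + \<eta> * V x)"
      using xb by (intro mult_left_mono add_mono p'(1)) auto
    finally have overlap: "prob (?J ?b) \<le> \<eta> * (n * V x)" by (simp add: mult.left_commute)
    define E where "E = jump_event n m (x + K * sqrt n) (K * sqrt n)"
    have E: "(1 - \<eta>) * (n * V x) \<le> prob E" unfolding E_def using elim xm by (intro K(3)) auto
    have Eev: "E \<in> events" unfolding E_def by (rule jump_event_sets)
    have Sev: "?S m \<in> events" for m by measurable
    have Jev: "?J ?b \<in> events" by (rule exists_large_sets) auto
    have "prob (?S ?b \<union> E) \<le> prob (?S m)"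
    proof (rule finite_measure_mono[OF _ Sev])
      show "?S ?b \<union> E \<subseteq> ?S m"
        using csum_mono_level[OF xm(3), of "{1..n}"] jump_event_subset[OF xm(1), of n "K * sqrt n"]
        unfolding E_def by (auto intro: less_le_trans)
    qed
    moreover have "prob (?S ?b \<union> E) = prob (?S ?b) + prob E - prob (?S ?b \<inter> E)"
      using measure_Un3[of "?S ?b" P E] Sev Eev by (simp add: fmeasurable_eq_sets)
    moreover have "prob (?S ?b \<inter> E) \<le> prob (?J ?b)"
    proof (rule finite_measure_mono[OF _ Jev])
      have "?b < x + K * sqrt n" using xb b Kn by linarith
      then show "?S ?b \<inter> E \<subseteq> ?J ?b"
        unfolding E_def jump_event_def by (auto intro: less_trans)
    qed
    ultimately have "(1 - \<eta>) * ?tl + (1 - \<eta>) * (n * V x) - \<eta> * (n * V x) \<le> prob (?S m)"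
      using normal E overlap by linarith
    moreover have "(1 - \<epsilon>) * ?tl \<le> (1 - \<eta>) * ?tl"
      using \<eta> std_normal_tail_pos[of "x / sqrt n"] by (intro mult_right_mono) auto
    moreover have "(1 - \<eta>) * (n * V x) - \<eta> * (n * V x) = (1 - \<epsilon>) * (n * V x)"
      by (simp add: algebra_simps flip: \<eta>(3))
    ultimately have "(1 - \<epsilon>) * (?tl + n * V x) \<le> prob (?S m)" by (simp add: distrib_left)
    with upper show "(1 - \<epsilon>) * (?tl + n * V x) \<le> prob (?S m) \<and> prob (?S m) \<le> (1 + \<epsilon>) * (?tl + n * V x)" by simp
  qed
qed

lemma normal_range_asymp:
  assumes tau: "((\<lambda>t. ln t * square_tail t) \<longlongrightarrow> 0) at_top" and \<epsilon>: "0 < \<epsilon>"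
  shows "\<forall>\<^sub>F n in sequentially. \<forall>x m. 0 \<le> x \<longrightarrow> x \<le> s_seq \<alpha> n / 2 \<longrightarrow> level n \<le> m \<longrightarrow>
    (1 - \<epsilon>) * std_normal_tail (x / sqrt n) \<le> prob (exceeds {1..n} m x) \<and>
    prob (exceeds {1..n} m x) \<le> (1 + \<epsilon>) * std_normal_tail (x / sqrt n) \<and>
    n * V (sqrt n) \<le> \<epsilon> * std_normal_tail (x / sqrt n)"
proof -
  define \<eta> where "\<eta> = \<epsilon> / 2"
  have \<eta>: "0 < \<eta>" "\<eta> \<le> \<epsilon>" "2 * \<eta> = \<epsilon>" using \<epsilon> by (auto simp: \<eta>_def)
  have C0: "0 < sqrt (\<alpha> - 2)" using \<alpha> by simp
  have ev: "\<forall>\<^sub>F n in sequentially. level n \<le> sqrt n" unfolding level_def by real_asymp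
  show ?thesis
    using normal_approximation[OF tau C0 \<eta>(1)] nV_level_negligible[OF \<eta>(1)] ev eventually_gt_at_top[of 1]
  proof (eventually_elim, intro allI impI)
    case (elim n)
    fix x m assume x: "0 \<le> x" "x \<le> s_seq \<alpha> n / 2" and m: "level n \<le> m"
    let ?b = "level n" and ?tl = "std_normal_tail (x / sqrt n)"
    let ?S = "\<lambda>m. exceeds {1..n} m x"
    have n: "0 < real n" "0 < ln (real n)" using elim by auto
    have s: "s_seq \<alpha> n = sqrt (\<alpha> - 2) * sqrt (n * ln n)" using elim by (simp add: s_seq_eq)
    have tl: "0 < ?tl" by (rule std_normal_tail_pos)
    have "x \<le> sqrt (\<alpha> - 2) * sqrt (n * ln n)" using x s by linarith
    then have normal: "(1 - \<eta>) * ?tl \<le> prob (?S ?b)" "prob (?S ?b) \<le> (1 + \<eta>) * ?tl"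
      using elim(1) x by auto
    have small: "n * V ?b \<le> \<eta> * ?tl" using elim(2) x by auto
    have "prob (?S m) \<le> prob {\<omega> \<in> space P. csum {1..n} m \<omega> > x \<and> (\<exists>j\<in>{1..n}. X j \<omega> > ?b)} + prob (?S ?b)"
      by (rule prob_split_jump[OF m]) auto
    moreover have "prob {\<omega> \<in> space P. csum {1..n} m \<omega> > x \<and> (\<exists>j\<in>{1..n}. X j \<omega> > ?b)} \<le> n * V ?b"
      using prob_exists_large[of "{1..n}" "{1..n}" x m ?b] by auto
    ultimately have "prob (?S m) \<le> (1 + \<eta>) * ?tl + \<eta> * ?tl" using small normal by linarith
    then have 1: "prob (?S m) \<le> (1 + \<epsilon>) * ?tl" by (simp add: algebra_simps flip: \<eta>(3))
    have "(1 - \<epsilon>) * ?tl \<le> (1 - \<eta>) * ?tl" using \<eta> tl by (intro mult_right_mono) auto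
    then have 2: "(1 - \<epsilon>) * ?tl \<le> prob (?S m)"
      using normal prob_csum_mono_level[OF m, where n = n and x = x] by linarith
    have "n * V (sqrt n) \<le> n * V ?b" using elim by (intro mult_left_mono V_antimono) auto
    also have "\<dots> \<le> \<epsilon> * ?tl" using small \<eta> tl by (smt (verit) mult_right_mono)
    finally show "(1 - \<epsilon>) * ?tl \<le> prob (?S m) \<and> prob (?S m) \<le> (1 + \<epsilon>) * ?tl \<and> n * V (sqrt n) \<le> \<epsilon> * ?tl"
      using 1 2 by simp
  qed
qed

text \<open>
  Three ranges of \<open>x\<close>: up to \<open>s_seq \<alpha> n / 2\<close> the jump term is negligible in \<open>H_fun\<close>, beyond
  \<open>c s_seq \<alpha> n\<close> the Gaussian term is, and in between both count.
\<close>
lemma H_asymp: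
  assumes tau: "((\<lambda>t. ln t * square_tail t) \<longlongrightarrow> 0) at_top"
    and c: "1 < c" and \<epsilon>: "0 < \<epsilon>" "\<epsilon> \<le> 1"
    and d: "\<forall>K>0. \<forall>\<^sub>F n in sequentially. K * sqrt n \<le> d n"
  shows "\<forall>\<^sub>F n in sequentially. \<forall>x m. 0 < x \<longrightarrow> x + d n \<le> m \<longrightarrow> c * s_seq \<alpha> n + d n \<le> m \<longrightarrow>
    (1 - \<epsilon>) * H_fun V n x \<le> prob (exceeds {1..n} m x) \<and>
    prob (exceeds {1..n} m x) \<le> (1 + \<epsilon>) * H_fun V n x"
proof -
  define \<eta> where "\<eta> = \<epsilon> / 2"
  have \<eta>: "0 < \<eta>" "\<eta> \<le> \<epsilon>" "2 * \<eta> = \<epsilon>" "\<eta> \<le> 1" using \<epsilon> by (auto simp: \<eta>_def)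
  have c0: "0 < c" and half: "(0::real) < 1 / 2" using c by auto
  have ev: "\<forall>\<^sub>F n in sequentially. level n \<le> sqrt n" unfolding level_def by real_asymp
  show ?thesis
    using large_deviation_asymp[OF c \<eta>(1) d] moderate_deviation_asymp[OF tau c0 \<eta>(1) d]
      normal_range_asymp[OF tau \<eta>(1)] gaussian_negligible[OF c \<eta>(1)] d[rule_format, OF zero_less_one]
      s_seq_ge[OF half \<alpha>, of 2] ev
  proof (eventually_elim, intro allI impI)
    case (elim n)
    fix x m assume x: "0 < x" "x + d n \<le> m" "c * s_seq \<alpha> n + d n \<le> m"
    let ?S = "exceeds {1..n} m x" and ?tl = "std_normal_tail (x / sqrt n)"
    have n: "0 < real n" "0 < sqrt n" using elim(6) by simp_all
    have s: "2 * sqrt n \<le> s_seq \<alpha> n / 2" using elim(6) by simp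
    have tl: "0 < ?tl" by (rule std_normal_tail_pos)
    have s0: "0 \<le> s_seq \<alpha> n" using s n by linarith
    have cs: "1 * s_seq \<alpha> n \<le> c * s_seq \<alpha> n" using c by (intro mult_right_mono s0) auto
    have lm: "level n \<le> m" using elim s cs x n by auto
    have nV: "0 \<le> n * V x" using V_nonneg by simp
    consider "x \<le> s_seq \<alpha> n / 2" | "s_seq \<alpha> n / 2 \<le> x" "x \<le> c * s_seq \<alpha> n" | "c * s_seq \<alpha> n \<le> x" by linarith
    then show "(1 - \<epsilon>) * H_fun V n x \<le> prob ?S \<and> prob ?S \<le> (1 + \<epsilon>) * H_fun V n x"
    proof cases
      case 1
      then have *: "(1 - \<eta>) * ?tl \<le> prob ?S" "prob ?S \<le> (1 + \<eta>) * ?tl" "n * V (sqrt n) \<le> \<eta> * ?tl"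
        using elim(3) x lm by auto
      have "n * V x * indicator {sqrt n<..} x \<le> \<eta> * ?tl"
      proof (cases "sqrt n < x")
        case True
        then have "n * V x \<le> n * V (sqrt n)" by (intro mult_left_mono V_antimono) auto
        then show ?thesis using True * by simp
      qed (use \<eta> tl in auto)
      moreover have "0 \<le> n * V x * indicator {sqrt n<..} x"
        using nV by (rule mult_nonneg_nonneg) simp
      ultimately have H: "?tl \<le> H_fun V n x" "H_fun V n x \<le> (1 + \<eta>) * ?tl"
        unfolding H_fun_def distrib_right by linarith+
      have "(1 - \<epsilon>) * H_fun V n x \<le> (1 - \<epsilon>) * ((1 + \<eta>) * ?tl)" using H \<epsilon> by (intro mult_left_mono) auto
      also have "\<dots> \<le> (1 - \<eta>) * ?tl"
      proof -
        have "(1 - \<epsilon>) * (1 + \<eta>) \<le> 1 - \<eta>" using \<epsilon> by (simp add: \<eta>_def field_simps)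
        then show ?thesis using tl mult_right_mono[of "(1 - \<epsilon>) * (1 + \<eta>)" "1 - \<eta>" ?tl] by (simp only: mult.assoc)
      qed
      finally have "(1 - \<epsilon>) * H_fun V n x \<le> prob ?S" using * by linarith
      moreover have "(1 + \<eta>) * ?tl \<le> (1 + \<epsilon>) * H_fun V n x" using H \<eta> tl by (intro mult_mono) auto
      ultimately show ?thesis using * by linarith
    next
      case 2
      then have xs: "sqrt n < x" using s n by linarith
      have H: "H_fun V n x = ?tl + n * V x" using xs by (simp add: H_fun_def)
      have *: "(1 - \<eta>) * (?tl + n * V x) \<le> prob ?S" "prob ?S \<le> (1 + \<eta>) * (?tl + n * V x)"
        using elim(2) x 2 by auto
      have "(1 - \<epsilon>) * (?tl + n * V x) \<le> (1 - \<eta>) * (?tl + n * V x)"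
        "(1 + \<eta>) * (?tl + n * V x) \<le> (1 + \<epsilon>) * (?tl + n * V x)"
        using \<eta> tl nV by (auto intro!: mult_right_mono)
      then show ?thesis unfolding H using * by linarith
    next
      case 3
      then have xs: "sqrt n < x" using s n cs by linarith
      have H: "H_fun V n x = ?tl + n * V x" using xs by (simp add: H_fun_def)
      have *: "(1 - \<eta>) * (n * V x) \<le> prob ?S" "prob ?S \<le> (1 + \<eta>) * (n * V x)"
        using elim(1) x 3 by auto
      have "?tl \<le> exp (- (x / sqrt n)\<^sup>2 / 2)" using x n by (intro std_normal_tail_le_exp) auto
      also have "\<dots> = exp (- x\<^sup>2 / (2 * n))" using n by (simp add: power_divide)
      also have "\<dots> \<le> \<eta> * (n * V x)" using elim(4) 3 by auto
      finally have t: "?tl \<le> \<eta> * (n * V x)" .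
      have "(1 - \<epsilon>) * (?tl + n * V x) \<le> (1 - \<epsilon>) * ((1 + \<eta>) * (n * V x))"
        using t \<epsilon> by (intro mult_left_mono) (auto simp: algebra_simps)
      also have "\<dots> \<le> (1 - \<eta>) * (n * V x)"
      proof -
        have "(1 - \<epsilon>) * (1 + \<eta>) \<le> 1 - \<eta>" using \<epsilon> by (simp add: \<eta>_def field_simps)
        then show ?thesis using nV mult_right_mono[of "(1 - \<epsilon>) * (1 + \<eta>)" "1 - \<eta>" "n * V x"] by (simp only: mult.assoc)
      qed
      finally have "(1 - \<epsilon>) * (?tl + n * V x) \<le> prob ?S" using * by linarith
      moreover have "(1 + \<eta>) * (n * V x) \<le> (1 + \<epsilon>) * (?tl + n * V x)"
        using \<eta> tl nV by (intro mult_mono) auto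
      ultimately show ?thesis unfolding H using * by linarith
    qed
  qed
qed

end

section \<open>Uniform asymptotics\<close>

text \<open>
  Two-sided multiplicative bounds are the form in which all estimates above are obtained.
\<close>
lemma uniformly_asympI:
  assumes "\<And>\<epsilon>. 0 < \<epsilon> \<Longrightarrow> \<forall>\<^sub>F n in sequentially. \<forall>x\<in>I n.
     0 < g n x \<and> (1 - \<epsilon>) * g n x \<le> f n x \<and> f n x \<le> (1 + \<epsilon>) * g n x"
  shows "uniformly_asymp I f g"
  unfolding uniformly_asymp_def
proof (rule order_tendstoI)
  fix a :: ennreal assume a: "0 < a"
  obtain \<epsilon> where \<epsilon>: "0 < \<epsilon>" "ennreal \<epsilon> < a"
  proof (cases a)
    case (real r)
    then show ?thesis using a by (intro that[of "r / 2"]) (auto simp: ennreal_less_iff)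
  qed (auto intro: that[of 1])
  show "\<forall>\<^sub>F n in sequentially. (SUP x\<in>I n. ennreal \<bar>f n x / g n x - 1\<bar>) < a"
    using assms[OF \<epsilon>(1)]
  proof eventually_elim
    case (elim n)
    have "(SUP x\<in>I n. ennreal \<bar>f n x / g n x - 1\<bar>) \<le> ennreal \<epsilon>"
    proof (rule SUP_least)
      fix x assume "x \<in> I n"
      with elim have g: "0 < g n x" "(1 - \<epsilon>) * g n x \<le> f n x" "f n x \<le> (1 + \<epsilon>) * g n x"
        by auto
      then have "1 - \<epsilon> \<le> f n x / g n x" "f n x / g n x \<le> 1 + \<epsilon>"
        by (simp_all add: field_simps)
      then show "ennreal \<bar>f n x / g n x - 1\<bar> \<le> ennreal \<epsilon>"
        by (intro ennreal_leI) linarith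
    qed
    then show ?case using \<epsilon>(2) by (rule le_less_trans)
  qed
qed auto

theorem theorem1:
  fixes P :: "'a measure"
    and \<xi> :: "'a \<Rightarrow> real" and X :: "nat \<Rightarrow> 'a \<Rightarrow> real"
    and L :: "real \<Rightarrow> real" and \<alpha> c :: real and M d :: "nat \<Rightarrow> real"
  assumes "prob_space P"
    and "\<xi> \<in> borel_measurable P"
    and "prob_space.indep_vars P (\<lambda>_. borel) X {1..}"
    and "\<And>j. j \<ge> 1 \<Longrightarrow> distr P borel (X j) = distr P borel \<xi>"
    and "integrable P \<xi>" and "(\<integral>\<omega>. \<xi> \<omega> \<partial>P) = 0"
    and "integrable P (\<lambda>\<omega>. (\<xi> \<omega>)\<^sup>2)" and "(\<integral>\<omega>. (\<xi> \<omega>)\<^sup>2 \<partial>P) = 1"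
    and "\<alpha> > 2" and "slowly_varying L"
    and "\<And>t. t > 0 \<Longrightarrow> right_tail P \<xi> t = t powr (- \<alpha>) * L t"
    and "much_greater M (s_seq \<alpha>)"
    and "c > 1"
    and "\<forall>\<^sub>F n in sequentially. M n - c * s_seq \<alpha> n > d n"
    and "much_greater d (\<lambda>n. sqrt (real n))"
  shows "uniformly_asymp (\<lambda>n. {c * s_seq \<alpha> n<..<M n - d n})
           (\<lambda>n x. \<P>(\<omega> in P. censored_sum X M n \<omega> > x))
           (\<lambda>n x. real n * right_tail P \<xi> x)
       \<and> ((\<lambda>t. \<integral>\<omega>. (\<xi> \<omega>)\<^sup>2 * indicator {\<omega> \<in> space P. \<bar>\<xi> \<omega>\<bar> > t} \<omega> \<partial>P) \<in> o(\<lambda>t. 1 / ln t)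
          \<longrightarrow> uniformly_asymp (\<lambda>n. {0<..<M n - d n})
                (\<lambda>n x. \<P>(\<omega> in P. censored_sum X M n \<omega> > x))
                (\<lambda>n x. H_fun (right_tail P \<xi>) n x))"
proof -
  note [measurable] = assms(2)
  define D where "D = distr P borel \<xi>"
  have sample: "standardized_sample P X D"
    unfolding standardized_sample_def standardized_sample_axioms_def D_def
    using assms by (auto simp: integrable_distr_eq integral_distr)
  interpret standardized_sample P X D by (rule sample)
  have tail: "right_tail P \<xi> = V"
    unfolding right_tail_def V_def unfolding D_def
    by (intro ext, subst measure_distr) (auto intro!: arg_cong[where f=prob])
  have "regvar_sample P X D \<alpha>"
  proof (intro regvar_sample.intro sample regvar_sample_axioms.intro)
    fix y :: real assume y: "0 < y"
    have "((\<lambda>t. y powr (- \<alpha>) * (L (t * y) / L t)) \<longlongrightarrow> y powr (- \<alpha>) * 1) at_top"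
      using assms(10) y unfolding slowly_varying_def by (intro tendsto_mult tendsto_const) auto
    moreover have "\<forall>\<^sub>F t in at_top. y powr (- \<alpha>) * (L (t * y) / L t) = V (t * y) / V t"
      using eventually_gt_at_top[of 0]
    proof eventually_elim
      case (elim t)
      then show ?case using assms(11)[of t] assms(11)[of "t * y"] y
        by (simp add: tail powr_mult)
    qed
    ultimately show "((\<lambda>t. V (t * y) / V t) \<longlongrightarrow> y powr (- \<alpha>)) at_top"
      by (simp add: tendsto_cong)
  qed (rule assms)
  then interpret regvar_sample P X D \<alpha> .
  have d: "\<forall>K>0. \<forall>\<^sub>F n in sequentially. K * sqrt n \<le> d n"
  proof (intro allI impI)
    fix K :: real assume K: "0 < K"
    have "\<forall>\<^sub>F n in sequentially. sqrt n / d n < 1 / K" "\<forall>\<^sub>F n in sequentially. 0 < d n"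
      using assms(15) K unfolding much_greater_def by (auto intro: order_tendstoD(2))
    then show "\<forall>\<^sub>F n in sequentially. K * sqrt n \<le> d n"
    proof eventually_elim
      case (elim n)
      then show ?case using K by (simp add: field_simps)
    qed
  qed
  have csum: "\<P>(\<omega> in P. censored_sum X M n \<omega> > x) = prob (exceeds {1..n} (M n) x)" for n x
    by (simp add: censored_sum_def csum_def)
  have main1: "uniformly_asymp (\<lambda>n. {c * s_seq \<alpha> n<..<M n - d n})
           (\<lambda>n x. \<P>(\<omega> in P. censored_sum X M n \<omega> > x)) (\<lambda>n x. real n * right_tail P \<xi> x)"
  proof (rule uniformly_asympI)
    fix \<epsilon> :: real assume "0 < \<epsilon>"
    from large_deviation_asymp[OF assms(13) this d] eventually_gt_at_top[of 0]
    show "\<forall>\<^sub>F n in sequentially. \<forall>x\<in>{c * s_seq \<alpha> n<..<M n - d n}.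
      0 < real n * right_tail P \<xi> x \<and>
      (1 - \<epsilon>) * (real n * right_tail P \<xi> x) \<le> \<P>(\<omega> in P. censored_sum X M n \<omega> > x) \<and>
      \<P>(\<omega> in P. censored_sum X M n \<omega> > x) \<le> (1 + \<epsilon>) * (real n * right_tail P \<xi> x)"
      unfolding tail csum
    proof (eventually_elim, intro ballI)
      case (elim n)
      fix x assume "x \<in> {c * s_seq \<alpha> n<..<M n - d n}"
      then show "0 < n * V x \<and> (1 - \<epsilon>) * (n * V x) \<le> prob (exceeds {1..n} (M n) x) \<and>
        prob (exceeds {1..n} (M n) x) \<le> (1 + \<epsilon>) * (n * V x)"
        using elim V_pos[of x] by auto
    qed
  qed
  have main2: "uniformly_asymp (\<lambda>n. {0<..<M n - d n})
       (\<lambda>n x. \<P>(\<omega> in P. censored_sum X M n \<omega> > x)) (\<lambda>n x. H_fun (right_tail P \<xi>) n x)"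
    if small: "(\<lambda>t. \<integral>\<omega>. (\<xi> \<omega>)\<^sup>2 * indicator {\<omega> \<in> space P. \<bar>\<xi> \<omega>\<bar> > t} \<omega> \<partial>P) \<in> o(\<lambda>t. 1 / ln t)"
  proof (rule uniformly_asympI)
    have st: "(\<integral>\<omega>. (\<xi> \<omega>)\<^sup>2 * indicator {\<omega> \<in> space P. \<bar>\<xi> \<omega>\<bar> > t} \<omega> \<partial>P) = square_tail t" for t
    proof -
      have "square_tail t = (\<integral>\<omega>. (\<xi> \<omega>)\<^sup>2 * indicator {v. t < \<bar>v\<bar>} (\<xi> \<omega>) \<partial>P)"
        unfolding square_tail_def unfolding D_def by (subst integral_distr) auto
      also have "\<dots> = (\<integral>\<omega>. (\<xi> \<omega>)\<^sup>2 * indicator {\<omega> \<in> space P. \<bar>\<xi> \<omega>\<bar> > t} \<omega> \<partial>P)"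
        by (intro Bochner_Integration.integral_cong) (auto simp: indicator_def)
      finally show ?thesis by simp
    qed
    have "((\<lambda>t. square_tail t / (1 / ln t)) \<longlongrightarrow> 0) at_top"
      using smalloD_tendsto[OF small] unfolding st .
    then have tau: "((\<lambda>t. ln t * square_tail t) \<longlongrightarrow> 0) at_top" by (simp add: mult.commute)
    fix \<epsilon> :: real assume \<epsilon>: "0 < \<epsilon>"
    have "0 < min 1 \<epsilon>" "min 1 \<epsilon> \<le> 1" using \<epsilon> by auto
    from H_asymp[OF tau assms(13) this d] assms(14)
    show "\<forall>\<^sub>F n in sequentially. \<forall>x\<in>{0<..<M n - d n}.
      0 < H_fun (right_tail P \<xi>) n x \<and>
      (1 - \<epsilon>) * H_fun (right_tail P \<xi>) n x \<le> \<P>(\<omega> in P. censored_sum X M n \<omega> > x) \<and>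
      \<P>(\<omega> in P. censored_sum X M n \<omega> > x) \<le> (1 + \<epsilon>) * H_fun (right_tail P \<xi>) n x"
      unfolding tail csum
    proof (eventually_elim, intro ballI)
      case (elim n)
      fix x assume x: "x \<in> {0<..<M n - d n}"
      have H: "0 < H_fun V n x" using V_nonneg std_normal_tail_pos
        unfolding H_fun_def by (intro add_pos_nonneg) auto
      have "(1 - min 1 \<epsilon>) * H_fun V n x \<le> prob (exceeds {1..n} (M n) x)"
        "prob (exceeds {1..n} (M n) x) \<le> (1 + min 1 \<epsilon>) * H_fun V n x"
        using elim x by auto
      moreover have "(1 - \<epsilon>) * H_fun V n x \<le> (1 - min 1 \<epsilon>) * H_fun V n x"
        "(1 + min 1 \<epsilon>) * H_fun V n x \<le> (1 + \<epsilon>) * H_fun V n x"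
        using H by (auto intro!: mult_right_mono)
      ultimately show "0 < H_fun V n x \<and> (1 - \<epsilon>) * H_fun V n x \<le> prob (exceeds {1..n} (M n) x) \<and>
        prob (exceeds {1..n} (M n) x) \<le> (1 + \<epsilon>) * H_fun V n x"
        using H by linarith
    qed
  qed
  show ?thesis using main1 main2 by blast
qed

end
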